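(* Let $p>0$, $E>0$ and let $u(\cdot,0)\in H^p(\mathbb{R}^n)$ with $\|u(\cdot,0)\|_{H^p}\le E$ and $Au(\cdot,0)=g$. Let $g^\delta\in L^2(\mathbb{R}^n)$ satisfy $\|g-g^\delta\|_{L^2}\le\delta$ and $\delta+\delta^r\le\frac12\|g^\delta\|_{L^2}$, where $r\in(0,1]$. Let $q=p/(2\tau)$, $\rho=C(p)E$, and $$\beta_r=\beta(\delta,g^\delta,r)=\sup\left\{\beta>0:\ \|Au_\beta^\delta-g^\delta\|_{L^2}<\delta+\delta^r\right\}.$$ Then the following hold. (i) If $s\le p/2$, then for all $r\in(0,1)$ the selection rule $\beta_r$ is order-optimal under the smoothness condition $\|u(\cdot,0)\|_{H^p}\le E$, that is, there exists a constant $K_3(p)$ independent of $\rho$ and $\delta$ such that $$\|u(\cdot,0)-u_{\beta_r}^\delta\|_{L^2}\le K_3(p)\,\rho f_q(\delta^2/\rho^2)(1+o(1))\quad\text{as }\delta\to0.$$ (ii) Assume $s>p/2$. For all $r<p/(2s)$ there exists a constant $K_4(p)$ independent of $\rho$ and $\delta$ such that $$\|u(\cdot,0)-u_{\beta_r}^\delta\|_{L^2}\le K_4(p)\,\rho^{2s/p} f_q(\delta^2/\rho^2)(1+o(1))\quad\text{as }\delta\to0.$$ For $r=p/(2s)$ there exists a constant $K_5(p)$ independent of $\rho$ and $\delta$ such that $$\|u(\cdot,0)-u_{\beta_r}^\delta\|_{L^2}\le K_5(p)\,\rho^{2s/p} \left(f_q(\delta^2/\rho^2)\right)^{1\wedge(s/p)}(1+o(1))\quad\text{as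 }\delta\to0.$$
   Context: Let $n\in\mathbb{N}$, $T>0$, $\tau\in(0,1]$, and let $\gamma:(0,T)\to(0,\infty)$ be integrable. The Fourier transform is $\hat f(\xi)=\mathcal{F}(f)(\xi)=\int_{\mathbb{R}^n} f(x)e^{-2\pi i x\cdot\xi}\,dx$. Put $\psi(\xi)=\exp\left(-|2\pi\xi|^{2\tau}\int_0^T\gamma(\lambda)\,d\lambda\right)$ and let $A:L^2(\mathbb{R}^n)\to L^2(\mathbb{R}^n)$ be $Af=\mathcal{F}^{-1}(\psi\hat f)$; $\bar A=A/\sqrt e$. The function $u(\cdot,0)\in L^2(\mathbb{R}^n)$ is the exact initial temperature, and $g=Au(\cdot,0)=u(\cdot,T)$ the exact final temperature. Kernel: $\phi\in L^1(\mathbb{R}^n)$ is smooth, real-valued, $\int_{\mathbb{R}^n}\phi=1$, $|\hat\phi(\xi)|<1$ for $\xi\ne0$, $\hat\phi$ is radially decreasing (decreasing along every ray from the origin), and for some $s>0$, $|1-\hat\phi(\xi)|\sim|\xi|^s$ as $\xi\to0$, where $a\sim b$ means that $a/b$ stays between two positive constants in the limit considered. For $\beta>0$, $\phi_\beta(x)=\beta^{-n}\phi(x/\beta)$ and $C_\beta f=\phi_\beta\star f$ on $L^2(\mathbb{R}^n)$; $I$ is the identity. The regularized solution with noisy data is $$u_\beta^\delta=\underset{u\in L^2(\mathbb{R}^n)}{\mathrm{argmin}}\ \|Au-g^\delta\|_{L^2}^2+\|(I-C_\beta)u\|_{L^2}^2 .$$ $\|f\|_{H^p}^2=\int_{\mathbb{R}^n}(1+|\xi|^2)^p|\hat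 f(\xi)|^2\,d\xi$; $a\wedge b=\min\{a,b\}$. For $q>0$, $f_q(\lambda)=(-\ln\lambda)^{-q}$, $\lambda\in(0,1)$; $f_q(\bar A^*\bar A)$ is given by functional calculus, i.e. it is the Fourier multiplier with symbol $f_q(\psi(\xi)^2/e)=\left(1+2|2\pi\xi|^{2\tau}\int_0^T\gamma(\lambda)\,d\lambda\right)^{-q}$. $C(p)>0$ denotes a constant depending on $p$ (not on $E$) such that every $v\in H^p(\mathbb{R}^n)$ with $\|v\|_{H^p}\le E$ can be written $v=f_q(\bar A^*\bar A)w$ with $q=p/(2\tau)$ and $\|w\|_{L^2}\le C(p)E$. *)

theory Defs
  imports "HOL-Analysis.Analysis" "HOL-Library.Landau_Symbols"
begin

section \<open>Square-integrable functions\<close>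

text \<open>Elements of \<open>L\<^sup>2\<close> are represented by functions; equality in \<open>L\<^sup>2\<close> is equality
  almost everywhere.\<close>

definition L2 :: "(real^'n \<Rightarrow> complex) set" where
  "L2 = {f \<in> borel_measurable lborel. integrable lborel (\<lambda>x. (norm (f x))\<^sup>2)}"

definition L2norm :: "(real^'n \<Rightarrow> complex) \<Rightarrow> real" where
  "L2norm f = sqrt (LINT x|lborel. (norm (f x))\<^sup>2)"

section \<open>Fourier transform\<close>

definition fourier :: "(real^'n \<Rightarrow> complex) \<Rightarrow> real^'n \<Rightarrow> complex" where
  "fourier f \<xi> = (LINT x|lborel. cis (- 2 * pi * (x \<bullet> \<xi>)) * f x)"

text \<open>The Fourier transform on \<open>L\<^sup>2\<close> is the \<open>L\<^sup>2\<close>-limit of the transforms of the truncations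
  of \<open>f\<close> to balls. It determines \<open>F\<close> from \<open>f\<close>, and \<open>f\<close> from \<open>F\<close>, up to null sets; the two
  choices below pick representatives.\<close>

definition has_fourier_L2 ::
    "(real^'n \<Rightarrow> complex) \<Rightarrow> (real^'n \<Rightarrow> complex) \<Rightarrow> bool" where
  "has_fourier_L2 f F \<longleftrightarrow> f \<in> L2 \<and> F \<in> L2 \<and>
     ((\<lambda>R. L2norm (\<lambda>\<xi>. F \<xi> - fourier (\<lambda>x. indicator (cball 0 R) x *\<^sub>R f x) \<xi>)) \<longlongrightarrow> 0) at_top"

definition fourier_L2 :: "(real^'n \<Rightarrow> complex) \<Rightarrow> real^'n \<Rightarrow> complex" where
  "fourier_L2 f = (SOME F. has_fourier_L2 f F)"

definition inv_fourier_L2 :: "(real^'n \<Rightarrow> complex) \<Rightarrow> real^'n \<Rightarrow> complex" where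
  "inv_fourier_L2 F = (SOME f. has_fourier_L2 f F)"

definition fourier_multiplier ::
    "(real^'n \<Rightarrow> real) \<Rightarrow> (real^'n \<Rightarrow> complex) \<Rightarrow> real^'n \<Rightarrow> complex" where
  "fourier_multiplier m f = inv_fourier_L2 (\<lambda>\<xi>. complex_of_real (m \<xi>) * fourier_L2 f \<xi>)"

section \<open>Sobolev balls\<close>

definition Sobolev :: "real \<Rightarrow> (real^'n \<Rightarrow> complex) set" where
  "Sobolev p = {f \<in> L2. integrable lborel
     (\<lambda>\<xi>. (1 + (norm \<xi>)\<^sup>2) powr p * (norm (fourier_L2 f \<xi>))\<^sup>2)}"

definition Sobolev_norm :: "real \<Rightarrow> (real^'n \<Rightarrow> complex) \<Rightarrow> real" where
  "Sobolev_norm p f =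
     sqrt (LINT \<xi>|lborel. (1 + (norm \<xi>)\<^sup>2) powr p * (norm (fourier_L2 f \<xi>))\<^sup>2)"

definition Sobolev_ball :: "real \<Rightarrow> real \<Rightarrow> (real^'n \<Rightarrow> complex) set" where
  "Sobolev_ball p E = {f \<in> Sobolev p. Sobolev_norm p f \<le> E}"

section \<open>The forward operator and the source condition\<close>

definition heat_symbol :: "real \<Rightarrow> real \<Rightarrow> (real \<Rightarrow> real) \<Rightarrow> real^'n \<Rightarrow> real" where
  "heat_symbol \<tau> T \<gamma> \<xi> =
     exp (- ((norm ((2 * pi) *\<^sub>R \<xi>)) powr (2 * \<tau>) * (LINT l:{0<..<T}|lborel. \<gamma> l)))"

definition heat_op ::
    "real \<Rightarrow> real \<Rightarrow> (real \<Rightarrow> real) \<Rightarrow> (real^'n \<Rightarrow> complex) \<Rightarrow> real^'n \<Rightarrow> complex" where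
  "heat_op \<tau> T \<gamma> = fourier_multiplier (heat_symbol \<tau> T \<gamma>)"

text \<open>The function \<open>f\<^sub>q\<close>, meaningful for arguments in \<open>(0, 1)\<close> only.\<close>

definition f_log :: "real \<Rightarrow> real \<Rightarrow> real" where
  "f_log q t = (- ln t) powr (- q)"

text \<open>The operator \<open>f\<^sub>q(B\<^sup>*B)\<close> for \<open>B = heat_op / sqrt e\<close>; the multiplier \<open>B\<^sup>*B\<close>
  has symbol \<open>heat_symbol\<^sup>2 / e\<close>.\<close>

definition source_op ::
    "real \<Rightarrow> real \<Rightarrow> (real \<Rightarrow> real) \<Rightarrow> real \<Rightarrow> (real^'n \<Rightarrow> complex) \<Rightarrow> real^'n \<Rightarrow> complex" where
  "source_op \<tau> T \<gamma> q = fourier_multiplier (\<lambda>\<xi>. f_log q ((heat_symbol \<tau> T \<gamma> \<xi>)\<^sup>2 / exp 1))"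

text \<open>The type token fixes the dimension of the underlying space.\<close>

definition source_constant ::
    "'n::finite itself \<Rightarrow> real \<Rightarrow> real \<Rightarrow> (real \<Rightarrow> real) \<Rightarrow> real \<Rightarrow> real \<Rightarrow> bool" where
  "source_constant _ \<tau> T \<gamma> p C \<longleftrightarrow> C > 0 \<and>
     (\<forall>E>0. \<forall>v \<in> (Sobolev_ball p E :: (real^'n \<Rightarrow> complex) set). \<exists>w \<in> L2.
        (AE x in lborel. v x = source_op \<tau> T \<gamma> (p / (2 * \<tau>)) w x) \<and> L2norm w \<le> C * E)"

section \<open>The kernel\<close>

text \<open>Class \<open>C\<^sup>k\<close>: all partial derivatives up to order \<open>k\<close> exist and are continuous;
  \<open>D i\<close> is the \<open>i\<close>-th partial derivative.\<close>

primrec Ck :: "nat \<Rightarrow> (real^'n \<Rightarrow> real) \<Rightarrow> bool" where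
  "Ck 0 = (\<lambda>f. continuous_on UNIV f)"
| "Ck (Suc k) = (\<lambda>f. \<exists>D. (\<forall>x. (f has_derivative (\<lambda>h. \<Sum>i\<in>UNIV. h $ i * D i x)) (at x)) \<and>
     (\<forall>i. Ck k (D i)))"

definition smooth :: "(real^'n \<Rightarrow> real) \<Rightarrow> bool" where
  "smooth f \<longleftrightarrow> (\<forall>k. Ck k f)"

abbreviation fourier_real :: "(real^'n \<Rightarrow> real) \<Rightarrow> real^'n \<Rightarrow> complex" where
  "fourier_real \<phi> \<equiv> fourier (\<lambda>x. complex_of_real (\<phi> x))"

text \<open>That the transform decreases along rays presupposes that it takes real values.\<close>

definition radially_decreasing :: "(real^'n \<Rightarrow> complex) \<Rightarrow> bool" where
  "radially_decreasing F \<longleftrightarrow> (\<forall>\<xi>. Im (F \<xi>) = 0) \<and>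
     (\<forall>\<xi> a b. 0 \<le> a \<and> a \<le> b \<longrightarrow> Re (F (b *\<^sub>R \<xi>)) \<le> Re (F (a *\<^sub>R \<xi>)))"

definition admissible_kernel :: "real \<Rightarrow> (real^'n \<Rightarrow> real) \<Rightarrow> bool" where
  "admissible_kernel s \<phi> \<longleftrightarrow>
     smooth \<phi> \<and> integrable lborel \<phi> \<and> (LINT x|lborel. \<phi> x) = 1 \<and>
     (\<forall>\<xi>. \<xi> \<noteq> 0 \<longrightarrow> norm (fourier_real \<phi> \<xi>) < 1) \<and>
     radially_decreasing (fourier_real \<phi>) \<and>
     (\<lambda>\<xi>. norm (1 - fourier_real \<phi> \<xi>)) \<in> \<Theta>[at 0](\<lambda>\<xi>. norm \<xi> powr s)"

definition dilate :: "(real^'n \<Rightarrow> real) \<Rightarrow> real \<Rightarrow> real^'n \<Rightarrow> real" where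
  "dilate \<phi> \<beta> x = \<phi> (x /\<^sub>R \<beta>) / \<beta> ^ CARD('n)"

definition mollify ::
    "(real^'n \<Rightarrow> real) \<Rightarrow> real \<Rightarrow> (real^'n \<Rightarrow> complex) \<Rightarrow> real^'n \<Rightarrow> complex" where
  "mollify \<phi> \<beta> f x = (LINT y|lborel. dilate \<phi> \<beta> (x - y) *\<^sub>R f y)"

section \<open>Regularization and parameter choice\<close>

definition mollifier_functional ::
    "real \<Rightarrow> real \<Rightarrow> (real \<Rightarrow> real) \<Rightarrow> (real^'n \<Rightarrow> real) \<Rightarrow> real \<Rightarrow> (real^'n \<Rightarrow> complex) \<Rightarrow>
     (real^'n \<Rightarrow> complex) \<Rightarrow> real" where
  "mollifier_functional \<tau> T \<gamma> \<phi> \<beta> g u =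
     (L2norm (\<lambda>x. heat_op \<tau> T \<gamma> u x - g x))\<^sup>2 + (L2norm (\<lambda>x. u x - mollify \<phi> \<beta> u x))\<^sup>2"

definition reg_solution ::
    "real \<Rightarrow> real \<Rightarrow> (real \<Rightarrow> real) \<Rightarrow> (real^'n \<Rightarrow> real) \<Rightarrow> real \<Rightarrow> (real^'n \<Rightarrow> complex) \<Rightarrow>
     real^'n \<Rightarrow> complex" where
  "reg_solution \<tau> T \<gamma> \<phi> \<beta> g = arg_min (mollifier_functional \<tau> T \<gamma> \<phi> \<beta> g) (\<lambda>u. u \<in> L2)"

definition beta_choice ::
    "real \<Rightarrow> real \<Rightarrow> (real \<Rightarrow> real) \<Rightarrow> (real^'n \<Rightarrow> real) \<Rightarrow> real \<Rightarrow> (real^'n \<Rightarrow> complex) \<Rightarrow>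
     real \<Rightarrow> real" where
  "beta_choice \<tau> T \<gamma> \<phi> \<delta> g r =
     Sup {\<beta>. \<beta> > 0 \<and>
       L2norm (\<lambda>x. heat_op \<tau> T \<gamma> (reg_solution \<tau> T \<gamma> \<phi> \<beta> g) x - g x) < \<delta> + \<delta> powr r}"

text \<open>\<open>error_bound \<dots> r U b\<close>: the error is at most \<open>b \<delta> (1 + o(1))\<close> as \<open>\<delta>\<close> decreases to 0, where
  the term \<open>o(1)\<close> is the same for all exact solutions in \<open>U\<close> and all admissible noisy data. For a Sobolev ball \<open>U\<close> this is a
  worst-case rate; for a singleton \<open>U\<close> the exact solution is fixed while \<open>\<delta>\<close> tends to 0.\<close>

definition error_bound ::
    "real \<Rightarrow> real \<Rightarrow> (real \<Rightarrow> real) \<Rightarrow> (real^'n \<Rightarrow> real) \<Rightarrow> real \<Rightarrow> (real^'n \<Rightarrow> complex) set \<Rightarrow>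
     (real \<Rightarrow> real) \<Rightarrow> bool" where
  "error_bound \<tau> T \<gamma> \<phi> r U b \<longleftrightarrow>
     (\<exists>\<epsilon> \<in> o[at_right 0](\<lambda>_. 1). eventually (\<lambda>\<delta>. \<forall>u\<in>U. \<forall>g\<delta>\<in>L2.
        L2norm (\<lambda>x. heat_op \<tau> T \<gamma> u x - g\<delta> x) \<le> \<delta> \<and> \<delta> + \<delta> powr r \<le> L2norm g\<delta> / 2 \<longrightarrow>
        L2norm (\<lambda>x. u x - reg_solution \<tau> T \<gamma> \<phi> (beta_choice \<tau> T \<gamma> \<phi> \<delta> g\<delta> r) g\<delta> x)
          \<le> b \<delta> * (1 + \<epsilon> \<delta>)) (at_right 0))"

end

theory Submission
  imports Defs "HOL-Probability.Characteristic_Functions" "HOL-Real_Asymp.Real_Asymp"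
begin

text \<open>In Fourier variables everything is a multiplier. With \<open>\<psi>\<close> the symbol of the heat operator and
  \<open>m \<beta> \<xi> = 1 - \<phi>^(\<beta> \<xi>)\<close>, the unique minimizer for the datum \<open>G\<close> is \<open>\<psi> G / (\<psi>\<^sup>2 + m\<^sup>2)\<close> and its residual
  is \<open>-m\<^sup>2 G / (\<psi>\<^sup>2 + m\<^sup>2)\<close>, whose norm increases with \<open>\<beta>\<close>. Since \<open>m\<^sup>2 \<psi> / (\<psi>\<^sup>2 + m\<^sup>2) \<le> m\<^sup>a \<psi>\<^sup>1\<^sup>-\<^sup>a\<close> is at most
  a constant times \<open>\<beta>\<^sup>a\<^sup>s\<close> for every \<open>a < 1\<close>, whatever the smoothness of the solution, the selected \<open>\<beta>\<close> is at
  least a constant times \<open>\<delta>\<close> to the power \<open>r / (a s)\<close>. With \<open>r < a < 1\<close> the noise contribution, of order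
  \<open>\<delta> \<beta>\<^sup>-\<^sup>s\<close>, is then a positive power of \<open>\<delta>\<close>. The error on the frequencies below \<open>R\<close> is at most the residual
  divided by \<open>\<psi>(R)\<close>, the one above \<open>R\<close> at most \<open>R\<^sup>-\<^sup>p\<close> times the tail of the Sobolev norm; choosing
  \<open>\<psi>(R) = \<delta>\<close> to the power \<open>r / 2\<close> yields the rate \<open>f\<^sub>q\<close> for every \<open>r < 1\<close>, and a rate of smaller order for a
  fixed solution. The weaker rates for \<open>s > p / 2\<close> follow from this one.\<close>

section \<open>Square-integrable functions\<close>

text \<open>The bound of \<open>\<delta> + \<delta> powr r\<close> by half the norm of the datum is
  what makes the supremum finite. As \<beta> grows, the residual multiplier tends to 1 / (1 +
  \<psi>^2), which exceeds 1/2 except at the origin; this needs the transform of \<phi> to vanish at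
  infinity along almost every ray. Since the inequality that defines the parameter is strict, the
  supremum itself only satisfies the weak one, by continuity from below. \<open>fourier_L2\<close>,
  \<open>inv_fourier_L2\<close> and \<open>reg_solution\<close> are choices, meaningful only once
  existence and uniqueness up to null sets are known. Hence Plancherel's theorem and surjectivity
  come before any estimate, and identities are carried by the relation
  \<open>has_fourier_L2\<close>. The powers of \<rho> = C E need care. The argument gives \<rho> to
  the first power, with a constant free of \<rho> because the \<rho> inside the logarithm disappears
  in the limit. For s > p / 2 the inequality between \<rho> and its power 2 s / p holds only when
  \<rho> is at least 1; for smaller \<rho> the statement about a fixed solution is rescued by its
  rate of smaller order, which absorbs any positive constant.\<close>

lemma L2_measurable: "f \<in> L2 \<Longrightarrow> f \<in> borel_measurable lborel" "f \<in> L2 \<Longrightarrow> f \<in> borel_measurable borel"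
  by (auto simp: L2_def)

lemma L2_integrable: "f \<in> L2 \<Longrightarrow> integrable lborel (\<lambda>x. (norm (f x))\<^sup>2)"
  by (simp add: L2_def)

lemma L2norm_nonneg [simp]: "0 \<le> L2norm f"
  by (simp add: L2norm_def)

lemma L2norm_squared: "(L2norm f)\<^sup>2 = (LINT x|lborel. (norm (f x))\<^sup>2)"
  by (simp add: L2norm_def)

lemma L2norm_cong_AE:
  assumes "f \<in> borel_measurable lborel" "g \<in> borel_measurable lborel" "AE x in lborel. f x = g x"
  shows "L2norm f = L2norm g"
  unfolding L2norm_def using assms by (intro arg_cong[where f=sqrt] integral_cong_AE) auto

lemma L2_iff_nn_integral:
  "f \<in> L2 \<longleftrightarrow> f \<in> borel_measurable lborel \<and> (\<integral>\<^sup>+x. ennreal ((norm (f x))\<^sup>2) \<partial>lborel) < \<infinity>"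
  unfolding L2_def by (auto simp: integrable_iff_bounded)

lemma L2norm_nn_integral:
  "f \<in> L2 \<Longrightarrow> ennreal ((L2norm f)\<^sup>2) = (\<integral>\<^sup>+x. ennreal ((norm (f x))\<^sup>2) \<partial>lborel)"
  by (simp add: L2norm_squared L2_integrable nn_integral_eq_integral)

lemma L2_nn_integral_le:
  assumes "f \<in> borel_measurable lborel" "0 \<le> c"
    and "(\<integral>\<^sup>+x. ennreal ((norm (f x))\<^sup>2) \<partial>lborel) \<le> ennreal (c\<^sup>2)"
  shows "f \<in> L2" "L2norm f \<le> c"
proof -
  show f: "f \<in> L2" using assms by (auto simp: L2_iff_nn_integral le_less_trans)
  have "(L2norm f)\<^sup>2 \<le> c\<^sup>2" using L2norm_nn_integral[OF f] assms(3) by (metis ennreal_le_iff zero_le_power2)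
  then show "L2norm f \<le> c" using assms(2) by (rule power2_le_imp_le)
qed

lemma L2_bound:
  assumes "f \<in> borel_measurable lborel" "g \<in> L2" "AE x in lborel. norm (f x) \<le> norm (g x)"
  shows "f \<in> L2" "L2norm f \<le> L2norm g"
proof -
  have le: "AE x in lborel. norm ((norm (f x))\<^sup>2) \<le> norm ((norm (g x))\<^sup>2)"
    using assms(3) by (auto intro: power_mono)
  have fi: "integrable lborel (\<lambda>x. (norm (f x))\<^sup>2)"
    by (rule Bochner_Integration.integrable_bound[OF L2_integrable[OF assms(2)] _ le]) (use assms(1) in measurable)
  show "f \<in> L2" using assms(1) fi by (simp add: L2_def)
  show "L2norm f \<le> L2norm g" unfolding L2norm_def
    using le by (intro real_sqrt_le_mono integral_mono_AE fi L2_integrable assms) auto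
qed

text \<open>Nearly all multiplier estimates of the error analysis are instances of this bound by the
  supremum of the symbol.\<close>

lemma L2_mult_bounded:
  assumes f: "f \<in> L2" and m [measurable]: "m \<in> borel_measurable lborel"
    and b: "\<And>x. norm (m x) \<le> B"
  shows "(\<lambda>x. m x * f x) \<in> L2" "L2norm (\<lambda>x. m x * f x) \<le> B * L2norm f"
proof -
  note [measurable] = L2_measurable[OF f]
  have B: "0 \<le> B" using b[of 0] norm_ge_zero order_trans by blast
  have Bf: "(\<lambda>x. of_real B * f x) \<in> L2"
    unfolding L2_def using L2_integrable[OF f] by (auto simp: norm_mult power_mult_distrib)
  have le: "AE x in lborel. norm (m x * f x) \<le> norm (of_real B * f x)"
    using b B by (auto simp: norm_mult intro!: mult_right_mono)
  have "L2norm (\<lambda>x. of_real B * f x) = B * L2norm f"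
    using B by (simp add: L2norm_def norm_mult power_mult_distrib real_sqrt_mult)
  with L2_bound[OF _ Bf le] show "(\<lambda>x. m x * f x) \<in> L2" "L2norm (\<lambda>x. m x * f x) \<le> B * L2norm f"
    by auto
qed

text \<open>The product carries no conjugate because the pairing used later is the bilinear one of
  the multiplication formula.\<close>

lemma L2_Cauchy_Schwarz:
  assumes f: "f \<in> L2" and g: "g \<in> L2"
  shows "integrable lborel (\<lambda>x. f x * g x)"
    and "(LINT x|lborel. norm (f x) * norm (g x)) \<le> L2norm f * L2norm g"
    and "integrable lborel (\<lambda>x. norm (f x) * norm (g x))"
    and "norm (LINT x|lborel. f x * g x) \<le> L2norm f * L2norm g"
proof -
  note [measurable] = L2_measurable[OF f] L2_measurable[OF g]
  have "(\<integral>\<^sup>+x. ennreal (norm (f x)) * ennreal (norm (g x)) \<partial>lborel)\<^sup>2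
     \<le> (\<integral>\<^sup>+x. (ennreal (norm (f x)))\<^sup>2 \<partial>lborel) * (\<integral>\<^sup>+x. (ennreal (norm (g x)))\<^sup>2 \<partial>lborel)"
    by (rule Cauchy_Schwarz_nn_integral) auto
  also have "\<dots> = ennreal ((L2norm f)\<^sup>2) * ennreal ((L2norm g)\<^sup>2)"
    by (simp add: L2norm_nn_integral f g ennreal_power)
  also have "\<dots> = (ennreal (L2norm f * L2norm g))\<^sup>2"
    by (simp add: ennreal_power power_mult_distrib ennreal_mult)
  finally have le: "(\<integral>\<^sup>+x. ennreal (norm (f x) * norm (g x)) \<partial>lborel) \<le> ennreal (L2norm f * L2norm g)"
    by (cases "\<integral>\<^sup>+x. ennreal (norm (f x) * norm (g x)) \<partial>lborel")
       (auto simp: ennreal_power ennreal_mult[symmetric] power2_le_iff_abs_le top_unique)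
  have fin: "(\<integral>\<^sup>+x. ennreal (norm (f x) * norm (g x)) \<partial>lborel) < \<infinity>"
    using le by (rule le_less_trans) simp
  show i: "integrable lborel (\<lambda>x. norm (f x) * norm (g x))"
    using fin by (auto simp: integrable_iff_bounded)
  show i2: "integrable lborel (\<lambda>x. f x * g x)"
    using fin by (auto simp: integrable_iff_bounded norm_mult)
  show le2: "(LINT x|lborel. norm (f x) * norm (g x)) \<le> L2norm f * L2norm g"
    using le by (subst (asm) nn_integral_eq_integral[OF i]) (auto)
  have "norm (LINT x|lborel. f x * g x) \<le> (LINT x|lborel. norm (f x * g x))" by simp
  with le2 show "norm (LINT x|lborel. f x * g x) \<le> L2norm f * L2norm g"
    by (simp add: norm_mult)
qed

lemma L2_add:
  assumes f: "f \<in> L2" and g: "g \<in> L2"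
  shows "(\<lambda>x. f x + g x) \<in> L2" "L2norm (\<lambda>x. f x + g x) \<le> L2norm f + L2norm g"
proof -
  note [measurable] = L2_measurable[OF f] L2_measurable[OF g]
  let ?b = "\<lambda>x. (norm (f x))\<^sup>2 + (norm (g x))\<^sup>2 + 2 * (norm (f x) * norm (g x))"
  have le: "(norm (f x + g x))\<^sup>2 \<le> ?b x" for x
  proof -
    have "(norm (f x + g x))\<^sup>2 \<le> (norm (f x) + norm (g x))\<^sup>2"
      by (intro power_mono norm_triangle_ineq) auto
    then show ?thesis by (simp add: power2_sum)
  qed
  have bi: "integrable lborel ?b"
    by (intro Bochner_Integration.integrable_add integrable_mult_right L2_integrable L2_Cauchy_Schwarz f g)
  have "integrable lborel (\<lambda>x. (norm (f x + g x))\<^sup>2)"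
    by (rule Bochner_Integration.integrable_bound[OF bi]) (use le in \<open>auto intro: order_trans\<close>)
  then show m: "(\<lambda>x. f x + g x) \<in> L2" by (simp add: L2_def)
  have "(L2norm (\<lambda>x. f x + g x))\<^sup>2 \<le> (LINT x|lborel. ?b x)"
    unfolding L2norm_squared by (intro integral_mono bi L2_integrable m le)
  also have "\<dots> = (L2norm f)\<^sup>2 + (L2norm g)\<^sup>2 + 2 * (LINT x|lborel. norm (f x) * norm (g x))"
    by (simp add: L2norm_squared L2_integrable L2_Cauchy_Schwarz f g)
  also have "\<dots> \<le> (L2norm f + L2norm g)\<^sup>2"
    using L2_Cauchy_Schwarz(2)[OF f g] by (simp add: power2_sum)
  finally show "L2norm (\<lambda>x. f x + g x) \<le> L2norm f + L2norm g"
    by (rule power2_le_imp_le) simp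
qed

lemma L2_uminus: "f \<in> L2 \<Longrightarrow> (\<lambda>x. - f x) \<in> L2"
  by (auto simp: L2_def)

lemma L2norm_minus_commute: "L2norm (\<lambda>x. f x - g x) = L2norm (\<lambda>x. g x - f x)"
  by (simp add: L2norm_def norm_minus_commute)

lemma L2_diff:
  assumes f: "f \<in> L2" and g: "g \<in> L2"
  shows "(\<lambda>x. f x - g x) \<in> L2" "L2norm (\<lambda>x. f x - g x) \<le> L2norm f + L2norm g"
  using L2_add[OF f L2_uminus[OF g]] by (auto simp: L2norm_def)

lemma L2norm_triangle:
  assumes "f \<in> L2" "g \<in> L2" "h \<in> L2"
  shows "L2norm (\<lambda>x. f x - h x) \<le> L2norm (\<lambda>x. f x - g x) + L2norm (\<lambda>x. g x - h x)"
  using L2_add(2)[OF L2_diff(1)[OF assms(1,2)] L2_diff(1)[OF assms(2,3)]] by simp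

lemma L2norm_diff_abs:
  assumes "f \<in> L2" "g \<in> L2"
  shows "\<bar>L2norm f - L2norm g\<bar> \<le> L2norm (\<lambda>x. f x - g x)"
  using L2_add(2)[OF L2_diff(1)[OF assms] assms(2)] L2_add(2)[OF L2_diff(1)[OF assms(2,1)] assms(1)]
  by (simp add: L2norm_minus_commute[of g f] abs_le_iff)

lemma L2norm_eq_0:
  assumes "f \<in> L2" "L2norm f = 0"
  shows "AE x in lborel. f x = 0"
  using assms(2) integral_nonneg_eq_0_iff_AE[OF L2_integrable[OF assms(1)]] by (simp add: L2norm_def)

lemma L2_AE_eqI:
  assumes "f \<in> L2" "g \<in> L2" "L2norm (\<lambda>x. f x - g x) = 0"
  shows "AE x in lborel. f x = g x"
  using L2norm_eq_0[OF L2_diff(1)[OF assms(1,2)] assms(3)] by simp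

lemma L2norm_diff_AE_eq:
  assumes "f \<in> L2" "g \<in> L2" "AE x in lborel. f x = g x"
  shows "L2norm (\<lambda>x. f x - g x) = 0"
proof -
  have "AE x in lborel. f x - g x = 0" using assms(3) by simp
  then have "L2norm (\<lambda>x. f x - g x) = L2norm (\<lambda>x. 0 * f x)"
    using L2_measurable(1)[OF L2_diff(1)[OF assms(1,2)]] by (intro L2norm_cong_AE) auto
  then show ?thesis by (simp add: L2norm_def)
qed

section \<open>Limits in the square norm\<close>

lemma L2_unique_limit:
  assumes "F \<noteq> bot" "f \<in> L2" "g \<in> L2" "\<And>i. h i \<in> L2"
    and "((\<lambda>i. L2norm (\<lambda>x. f x - h i x)) \<longlongrightarrow> 0) F"
    and "((\<lambda>i. L2norm (\<lambda>x. g x - h i x)) \<longlongrightarrow> 0) F"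
  shows "AE x in lborel. f x = g x"
proof (rule L2_AE_eqI[OF assms(2,3)])
  have "((\<lambda>i. L2norm (\<lambda>x. f x - h i x) + L2norm (\<lambda>x. g x - h i x)) \<longlongrightarrow> 0 + 0) F"
    by (intro tendsto_add assms)
  moreover have "L2norm (\<lambda>x. f x - g x) \<le> L2norm (\<lambda>x. f x - h i x) + L2norm (\<lambda>x. g x - h i x)" for i
    using L2norm_triangle[OF assms(2,4,3), of i] by (simp add: L2norm_minus_commute[of g])
  ultimately have "L2norm (\<lambda>x. f x - g x) \<le> 0 + 0"
    by (intro tendsto_lowerbound[OF _ _ assms(1)]) auto
  then show "L2norm (\<lambda>x. f x - g x) = 0" by (simp add: antisym)
qed

lemma L2_dominated_convergence:
  fixes f :: "real^'n \<Rightarrow> complex"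
  assumes [measurable]: "f \<in> borel_measurable lborel" "\<And>i. s i \<in> borel_measurable lborel"
    and w: "w \<in> L2"
    and lim: "AE x in lborel. (\<lambda>i::nat. s i x) \<longlonglongrightarrow> f x"
    and b: "\<And>i. AE x in lborel. norm (s i x) \<le> norm (w x)"
  shows "(\<lambda>i. L2norm (\<lambda>x. s i x - f x)) \<longlonglongrightarrow> 0" "f \<in> L2" "\<And>i. s i \<in> L2"
proof -
  note [measurable] = L2_measurable[OF w]
  show s: "\<And>i. s i \<in> L2" using L2_bound(1)[OF _ w b] by simp
  have "AE x in lborel. \<forall>i. norm (s i x) \<le> norm (w x)" using b by (simp add: AE_all_countable)
  then have fb: "AE x in lborel. norm (f x) \<le> norm (w x)"
    using lim
  proof eventually_elim
    case (elim x)
    then show ?case by (intro tendsto_upperbound[OF tendsto_norm[of "\<lambda>i. s i x"]]) auto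
  qed
  show f: "f \<in> L2" using L2_bound(1)[OF _ w fb] by simp
  have "(\<lambda>i. LINT x|lborel. (norm (s i x - f x))\<^sup>2) \<longlonglongrightarrow> (LINT x|(lborel::(real^'n) measure). 0)"
  proof (rule integral_dominated_convergence[where w="\<lambda>x. 4 * (norm (w x))\<^sup>2"])
    show "AE x in lborel. (\<lambda>i. (norm (s i x - f x))\<^sup>2) \<longlonglongrightarrow> 0"
      using lim
    proof eventually_elim
      case (elim x)
      then have "(\<lambda>i. (norm (s i x - f x))\<^sup>2) \<longlonglongrightarrow> (norm (f x - f x))\<^sup>2"
        by (intro tendsto_intros)
      then show ?case by simp
    qed
    show "AE x in lborel. norm ((norm (s i x - f x))\<^sup>2) \<le> 4 * (norm (w x))\<^sup>2" for i
      using b[of i] fb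
    proof eventually_elim
      case (elim x)
      then have "norm (s i x - f x) \<le> 2 * norm (w x)"
        by (intro order_trans[OF norm_triangle_ineq4]) auto
      then have "(norm (s i x - f x))\<^sup>2 \<le> (2 * norm (w x))\<^sup>2" by (intro power_mono) auto
      then show ?case by (simp add: power_mult_distrib)
    qed
    show "integrable lborel (\<lambda>x. 4 * (norm (w x))\<^sup>2)" using L2_integrable[OF w] by simp
  qed auto
  then show "(\<lambda>i. L2norm (\<lambda>x. s i x - f x)) \<longlonglongrightarrow> 0"
    unfolding L2norm_def by (auto dest: tendsto_real_sqrt)
qed

lemma L2_norm_convergence:
  assumes "\<And>i. s i \<in> L2" "f \<in> L2" "((\<lambda>i. L2norm (\<lambda>x. s i x - f x)) \<longlongrightarrow> 0) F"
  shows "((\<lambda>i. L2norm (s i)) \<longlongrightarrow> L2norm f) F"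
proof -
  have "((\<lambda>i. L2norm (s i) - L2norm f) \<longlongrightarrow> 0) F"
    by (rule Lim_null_comparison[OF _ assms(3)]) (use L2norm_diff_abs[OF assms(1,2)] in auto)
  then show ?thesis by (simp add: LIM_zero_iff)
qed

section \<open>Completeness\<close>

text \<open>Riesz-Fischer for geometrically decreasing increments. The partial sums of the absolute
  increments have norm at most 2, so monotone convergence makes the increments summable almost
  everywhere. The telescoping limit then exists there, and the full sum of the increments dominates
  every remainder.\<close>

lemma L2_limit_of_summable:
  assumes s: "\<And>i::nat. s i \<in> L2"
    and c: "\<And>i. L2norm (\<lambda>x. s (Suc i) x - s i x) \<le> (1/2) ^ i"
  shows "\<exists>f\<in>L2. (\<lambda>i. L2norm (\<lambda>x. s i x - f x)) \<longlonglongrightarrow> 0"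
proof -
  note [measurable] = L2_measurable[OF s]
  define d where "d i x = norm (s (Suc i) x - s i x)" for i x
  have [measurable]: "d i \<in> borel_measurable lborel" for i unfolding d_def by measurable
  have d0: "0 \<le> d i x" for i x by (simp add: d_def)
  have S: "(\<lambda>x. complex_of_real (\<Sum>i<n. d i x)) \<in> L2 \<and> L2norm (\<lambda>x. complex_of_real (\<Sum>i<n. d i x)) \<le> (\<Sum>i<n. (1/2)^i)" for n
  proof (induction n)
    case 0 show ?case by (simp add: L2_def L2norm_def)
  next
    case (Suc n)
    have dn: "(\<lambda>x. complex_of_real (d n x)) \<in> L2" "L2norm (\<lambda>x. complex_of_real (d n x)) \<le> (1/2)^n"
      using L2_diff(1)[OF s s, of "Suc n" n] c[of n] by (auto simp: L2_def L2norm_def d_def)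
    from L2_add[OF conjunct1[OF Suc] dn(1)] conjunct2[OF Suc] dn(2) show ?case by auto
  qed
  have sum2: "(\<Sum>i<n. (1/2::real)^i) \<le> 2" for n
    by (simp add: sum_gp_strict)
  have le: "(\<integral>\<^sup>+x. ennreal ((\<Sum>i<n. d i x)\<^sup>2) \<partial>lborel) \<le> 4" for n
  proof -
    have "(\<integral>\<^sup>+x. ennreal ((\<Sum>i<n. d i x)\<^sup>2) \<partial>lborel) = ennreal ((L2norm (\<lambda>x. complex_of_real (\<Sum>i<n. d i x)))\<^sup>2)"
      using S[of n] by (subst L2norm_nn_integral) (auto simp del: of_real_sum)
    also have "\<dots> \<le> ennreal (2\<^sup>2)"
      using S[of n] sum2[of n] by (intro ennreal_leI power_mono) auto
    finally show ?thesis by simp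
  qed
  have "(\<integral>\<^sup>+x. (SUP n. ennreal ((\<Sum>i<n. d i x)\<^sup>2)) \<partial>lborel) = (SUP n. \<integral>\<^sup>+x. ennreal ((\<Sum>i<n. d i x)\<^sup>2) \<partial>lborel)"
    by (rule nn_integral_monotone_convergence_SUP)
       (auto simp: incseq_Suc_iff le_fun_def intro!: ennreal_leI power_mono sum_nonneg d0)
  also have "\<dots> \<le> 4" by (intro SUP_least le)
  finally have b4: "(\<integral>\<^sup>+x. (SUP n. ennreal ((\<Sum>i<n. d i x)\<^sup>2)) \<partial>lborel) \<le> 4" .
  \<comment> \<open>The squared partial sums increase to \<open>W\<close>, whose integral is at most
    4 by \<open>b4\<close>; hence \<open>W\<close> is finite almost everywhere.\<close>
  define W where "W x = (SUP n. ennreal ((\<Sum>i<n. d i x)\<^sup>2))" for x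
  have [measurable]: "W \<in> borel_measurable lborel" unfolding W_def by measurable
  have "AE x in lborel. W x \<noteq> \<infinity>"
    using b4 by (intro nn_integral_PInf_AE) (auto simp: W_def[symmetric] top_unique)
  then have summ: "AE x in lborel. summable (\<lambda>i. d i x)"
  proof eventually_elim
    case (elim x)
    then obtain w where w: "0 \<le> w" "W x = ennreal w" by (cases "W x") auto
    have "(\<Sum>i<n. d i x) \<le> sqrt w" for n
    proof -
      have "ennreal ((\<Sum>i<n. d i x)\<^sup>2) \<le> W x" unfolding W_def by (rule SUP_upper) simp
      then have "(\<Sum>i<n. d i x)\<^sup>2 \<le> w" using w by simp
      then show ?thesis by (rule real_le_rsqrt)
    qed
    then show ?case by (intro summableI_nonneg_bounded[where x="sqrt w"] d0)
  qed
  \<comment> \<open>\<open>lim\<close> is meaningful only where the increments are summable. The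
    default 0 on the remaining null set keeps \<open>f\<close> measurable.\<close>
  define f where "f x = (if summable (\<lambda>i. d i x) then lim (\<lambda>i. s i x) else 0)" for x
  have ms: "Measurable.pred lborel (\<lambda>x. convergent (\<lambda>i. (\<Sum>j<i. d j x)))"
    unfolding pred_def Cauchy_convergent_iff[symmetric] by (rule sets_Collect_Cauchy) measurable
  have [measurable]: "f \<in> borel_measurable lborel"
    unfolding f_def using ms by (simp add: summable_iff_convergent)
  have conv: "(\<lambda>i. s i x) \<longlonglongrightarrow> f x" if "summable (\<lambda>i. d i x)" for x
  proof -
    have "summable (\<lambda>i. s (Suc i) x - s i x)"
      using that unfolding d_def by (rule summable_norm_cancel)
    then have "convergent (\<lambda>i. s i x)"
      using convergent_diff_const_right_iff[of "\<lambda>i. s i x" "s 0 x"]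
      by (simp add: summable_iff_convergent sum_lessThan_telescope[of "\<lambda>i. s i x"])
    then show ?thesis using that by (simp add: f_def convergent_LIMSEQ_iff)
  qed
  have bd: "norm (f x - s i x) \<le> suminf (\<lambda>j. d (j + i) x)" if sm: "summable (\<lambda>i. d i x)" for x i
  proof -
    have sm': "summable (\<lambda>j. d (j + i) x)" using sm by (rule summable_ignore_initial_segment)
    have "norm (s (i + n) x - s i x) \<le> suminf (\<lambda>j. d (j + i) x)" for n
    proof -
      have "s (i + n) x - s i x = (\<Sum>j<n. s (Suc (j + i)) x - s (j + i) x)"
        using sum_lessThan_telescope[of "\<lambda>j. s (j + i) x" n] by (simp add: add.commute)
      also have "norm \<dots> \<le> (\<Sum>j<n. d (j + i) x)" unfolding d_def by (rule norm_sum)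
      also have "\<dots> \<le> suminf (\<lambda>j. d (j + i) x)" by (intro sum_le_suminf sm') (auto simp: d0)
      finally show ?thesis .
    qed
    moreover have "(\<lambda>n. norm (s (i + n) x - s i x)) \<longlonglongrightarrow> norm (f x - s i x)"
      using LIMSEQ_ignore_initial_segment[OF conv[OF sm], of i] by (intro tendsto_intros) (simp add: add.commute)
    ultimately show ?thesis by (intro LIMSEQ_le_const2) auto
  qed
  have bd0: "norm (s i x - f x) \<le> suminf (\<lambda>j. d j x)" if sm: "summable (\<lambda>i. d i x)" for x i
    using bd[OF sm, of i] suminf_split_initial_segment[OF sm, of i] sum_nonneg[of "{..<i}" "\<lambda>j. d j x"] d0
    by (simp add: norm_minus_commute)
  define w where "w x = (if summable (\<lambda>i. d i x) then suminf (\<lambda>j. d j x) else 0)" for x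
  have [measurable]: "w \<in> borel_measurable lborel"
    unfolding w_def using ms by (simp add: summable_iff_convergent suminf_eq_lim)
  have w0: "0 \<le> w x" for x by (auto simp: w_def d0 intro!: suminf_nonneg)
  have wle: "ennreal ((w x)\<^sup>2) \<le> W x" if sm: "summable (\<lambda>i. d i x)" for x
  proof -
    have "(\<lambda>n. ennreal ((\<Sum>i<n. d i x)\<^sup>2)) \<longlonglongrightarrow> ennreal ((w x)\<^sup>2)"
      using sm by (auto simp: w_def intro!: tendsto_ennrealI tendsto_power summable_LIMSEQ)
    then show ?thesis
      by (rule LIMSEQ_le_const2) (auto simp: W_def intro!: SUP_upper)
  qed
  have "(\<integral>\<^sup>+x. ennreal ((norm (complex_of_real (w x)))\<^sup>2) \<partial>lborel) \<le> (\<integral>\<^sup>+x. W x \<partial>lborel)"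
    by (rule nn_integral_mono_AE) (use summ wle in auto)
  also have "\<dots> \<le> ennreal (2\<^sup>2)" using b4 by (simp add: W_def)
  finally have wL: "(\<lambda>x. complex_of_real (w x)) \<in> L2"
    by (intro L2_nn_integral_le(1)[of _ 2]) auto
  have L: "(\<lambda>i. L2norm (\<lambda>x. (s i x - f x) - 0)) \<longlonglongrightarrow> 0" and m: "\<And>i. (\<lambda>x. s i x - f x) \<in> L2"
  proof -
    have a: "AE x in lborel. (\<lambda>i. s i x - f x) \<longlonglongrightarrow> 0"
      using summ by eventually_elim (use conv in \<open>auto simp: LIM_zero_iff\<close>)
    have b: "AE x in lborel. norm (s i x - f x) \<le> norm (complex_of_real (w x))" for i
      using summ
    proof eventually_elim
      case (elim x)
      then show ?case using bd0[OF elim, of i] w0[of x] by (simp add: w_def)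
    qed
    show "(\<lambda>i. L2norm (\<lambda>x. (s i x - f x) - 0)) \<longlonglongrightarrow> 0"
      by (rule L2_dominated_convergence(1)[OF _ _ wL a b]) auto
    show "(\<lambda>x. s i x - f x) \<in> L2" for i
      by (rule L2_dominated_convergence(3)[OF _ _ wL a b]) auto
  qed
  have "f \<in> L2" using L2_diff(1)[OF s[of 0] m[of 0]] by simp
  with L show ?thesis by auto
qed

section \<open>Changes of variables and product integrals\<close>

lemma borel_measurable_cis [measurable (raw)]:
  "f \<in> borel_measurable M \<Longrightarrow> (\<lambda>x. cis (f x)) \<in> borel_measurable M"
  unfolding cis_conv_exp by measurable

lemma borel_measurable_cnj [measurable (raw)]:
  "f \<in> borel_measurable M \<Longrightarrow> (\<lambda>x. cnj (f x)) \<in> borel_measurable M"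
  by (rule borel_measurable_continuous_on[where f=cnj]) (auto intro: continuous_intros)

lemma lborel_integral_affine:
  fixes f :: "'a::euclidean_space \<Rightarrow> 'b::{banach, second_countable_topology}"
  assumes c: "c \<noteq> 0" and f [measurable]: "f \<in> borel_measurable lborel"
  shows "(LINT x|lborel. f x) = \<bar>c\<bar> ^ DIM('a) *\<^sub>R (LINT x|lborel. f (t + c *\<^sub>R x))"
proof -
  have "(LINT x|lborel. f x) = (LINT x|density (distr lborel borel (\<lambda>x. t + c *\<^sub>R x)) (\<lambda>_. ennreal (\<bar>c\<bar> ^ DIM('a))). f x)"
    by (subst lborel_affine[OF c, of t]) (simp add: ennreal_power)
  also have "\<dots> = (LINT x|distr lborel borel (\<lambda>x. t + c *\<^sub>R x). \<bar>c\<bar> ^ DIM('a) *\<^sub>R f x)"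
    by (rule integral_density) auto
  also have "\<dots> = (LINT x|lborel. \<bar>c\<bar> ^ DIM('a) *\<^sub>R f (t + c *\<^sub>R x))"
    by (rule integral_distr) auto
  finally show ?thesis by simp
qed

lemma lborel_integrable_affine:
  fixes f :: "'a::euclidean_space \<Rightarrow> 'b::{banach, second_countable_topology}"
  assumes c: "c \<noteq> 0" and f: "integrable lborel f"
  shows "integrable lborel (\<lambda>x. f (t + c *\<^sub>R x))"
proof -
  have [measurable]: "f \<in> borel_measurable lborel" using f by simp
  have "integrable (density (distr lborel borel (\<lambda>x. t + c *\<^sub>R x)) (\<lambda>_. ennreal (\<bar>c\<bar> ^ DIM('a)))) f"
    using f by (subst (asm) lborel_affine[OF c, of t]) (simp add: ennreal_power)
  then have "integrable (distr lborel borel (\<lambda>x. t + c *\<^sub>R x)) (\<lambda>x. \<bar>c\<bar> ^ DIM('a) *\<^sub>R f x)"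
    by (subst (asm) integrable_density) auto
  then have "integrable lborel (\<lambda>x. \<bar>c\<bar> ^ DIM('a) *\<^sub>R f (t + c *\<^sub>R x))"
    by (subst (asm) integrable_distr_eq) auto
  then have "integrable lborel (\<lambda>x. inverse (\<bar>c\<bar> ^ DIM('a)) *\<^sub>R (\<bar>c\<bar> ^ DIM('a) *\<^sub>R f (t + c *\<^sub>R x)))"
    by (rule integrable_scaleR_right)
  then show ?thesis using c by simp
qed

lemma lborel_nn_integral_affine:
  fixes f :: "'a::euclidean_space \<Rightarrow> ennreal"
  assumes c: "c \<noteq> 0" and f [measurable]: "f \<in> borel_measurable lborel"
  shows "(\<integral>\<^sup>+x. f x \<partial>lborel) = ennreal (\<bar>c\<bar> ^ DIM('a)) * (\<integral>\<^sup>+x. f (t + c *\<^sub>R x) \<partial>lborel)"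
proof -
  have "(\<integral>\<^sup>+x. f x \<partial>lborel) = (\<integral>\<^sup>+x. f x \<partial>density (distr lborel borel (\<lambda>x. t + c *\<^sub>R x)) (\<lambda>_. ennreal (\<bar>c\<bar> ^ DIM('a))))"
    by (subst lborel_affine[OF c, of t]) (simp add: ennreal_power)
  also have "\<dots> = ennreal (\<bar>c\<bar> ^ DIM('a)) * (\<integral>\<^sup>+x. f (t + c *\<^sub>R x) \<partial>lborel)"
    by (simp add: nn_integral_density nn_integral_distr nn_integral_cmult)
  finally show ?thesis .
qed

text \<open>Fubini for tensor products: \<open>lborel\<close> is the image of a product measure
  under the expansion in the basis. This reduces the Gaussian to one dimension.\<close>

lemma
  fixes f :: "'a::euclidean_space \<Rightarrow> real \<Rightarrow> complex"
  assumes f: "\<And>b. b \<in> Basis \<Longrightarrow> integrable lborel (f b)"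
  shows integral_lborel_prod: "(LINT x|lborel. (\<Prod>b\<in>Basis. f b (x \<bullet> b))) = (\<Prod>b\<in>Basis. (LINT t|lborel. f b t))"
    and integrable_lborel_prod: "integrable lborel (\<lambda>x. \<Prod>b\<in>Basis. f b (x \<bullet> b))"
proof -
  interpret product_sigma_finite "\<lambda>b::'a. lborel :: real measure" by standard
  have [measurable]: "f b \<in> borel_measurable borel" if "b \<in> Basis" for b using f[OF that] by simp
  let ?P = "\<Pi>\<^sub>M b\<in>(Basis::'a set). (lborel::real measure)"
  let ?s = "\<lambda>g. \<Sum>b\<in>(Basis::'a set). g b *\<^sub>R b"
  have l: "lborel = distr ?P borel ?s"
    by (rule lborel_eq)
  have s: "(\<Prod>b\<in>Basis. f b (?s g \<bullet> b)) = (\<Prod>b\<in>Basis. f b (g b))" for g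
    by (intro prod.cong) auto
  have "(LINT x|lborel. (\<Prod>b\<in>Basis. f b (x \<bullet> b))) = (LINT g|?P. (\<Prod>b\<in>Basis. f b (?s g \<bullet> b)))"
    unfolding l by (subst integral_distr) auto
  also have "\<dots> = (\<Prod>b\<in>Basis. (LINT t|lborel. f b t))"
    unfolding s by (intro product_integral_prod f) auto
  finally show "(LINT x|lborel. (\<Prod>b\<in>Basis. f b (x \<bullet> b))) = (\<Prod>b\<in>Basis. (LINT t|lborel. f b t))" .
  have "integrable ?P (\<lambda>g. \<Prod>b\<in>Basis. f b (?s g \<bullet> b))"
    unfolding s by (intro product_integrable_prod f) auto
  then show "integrable lborel (\<lambda>x. \<Prod>b\<in>Basis. f b (x \<bullet> b))"
    unfolding l by (subst integrable_distr_eq) auto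
qed

section \<open>The Gaussian\<close>

text \<open>The factor \<open>pi\<close> makes this function its own Fourier transform for the phase
  used here and gives it integral 1, so that its dilations form an approximate identity.\<close>

definition gauss :: "real^'n \<Rightarrow> real" where
  "gauss x = exp (- pi * (norm x)\<^sup>2)"

text \<open>The substitution t -> c t with c^2 = 2 pi turns the integrand into the standard normal
  density times a phase. The value is therefore the characteristic function of the normal
  distribution at - c k.\<close>

lemma gauss_1d:
  "integrable lborel (\<lambda>t. cis (- 2 * pi * (t * k)) * complex_of_real (exp (- pi * t\<^sup>2)))"
  "(LINT t|lborel. cis (- 2 * pi * (t * k)) * complex_of_real (exp (- pi * t\<^sup>2)))
     = complex_of_real (exp (- pi * k\<^sup>2))"
proof -
  define c where "c = sqrt (2 * pi)"
  have c: "c > 0" "c * c = 2 * pi" by (auto simp: c_def)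
  define F where "F x = std_normal_density x *\<^sub>R iexp (- c * k * x)" for x
  have Fi: "integrable lborel F"
    unfolding F_def
    by (rule Bochner_Integration.integrable_bound[OF integrable_normal_density[of 1 0]])
       (auto simp: normal_density_nonneg)
  have "char std_normal_distribution (- c * k) = (LINT x|lborel. F x)"
    unfolding char_def F_def by (subst integral_density) (auto simp: normal_density_nonneg mult_ac)
  then have FI: "(LINT x|lborel. F x) = complex_of_real (exp (- pi * k\<^sup>2))"
    using c by (simp add: char_std_normal_distribution power_mult_distrib power2_eq_square[of c])
  have Fc: "c *\<^sub>R F (c * t) = cis (- 2 * pi * (t * k)) * complex_of_real (exp (- pi * t\<^sup>2))" for t
  proof -
    have a: "- c * k * (c * t) = - 2 * pi * (t * k)" using c(2) by (simp add: algebra_simps)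
    have "iexp (- c * k * (c * t)) = cis (- 2 * pi * (t * k))"
      unfolding a by (simp only: cis_conv_exp)
    moreover have "(c * t)\<^sup>2 / 2 = pi * t\<^sup>2" using c by (simp add: power_mult_distrib power2_eq_square[of c])
    then have "c * std_normal_density (c * t) = exp (- pi * t\<^sup>2)"
      unfolding std_normal_density_def c_def[symmetric] using c by simp
    ultimately show ?thesis unfolding F_def scaleR_scaleR by (simp add: scaleR_conv_of_real)
  qed
  have "(LINT x|lborel. F x) = (LINT t|lborel. c *\<^sub>R F (c * t))"
    using lborel_integral_affine[of c F 0] c Fi by simp
  then show "(LINT t|lborel. cis (- 2 * pi * (t * k)) * complex_of_real (exp (- pi * t\<^sup>2)))
     = complex_of_real (exp (- pi * k\<^sup>2))" unfolding Fc FI by simp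
  have "integrable lborel (\<lambda>t. c *\<^sub>R F (c * t))"
    using lborel_integrable_affine[of c F 0] c Fi by simp
  then show "integrable lborel (\<lambda>t. cis (- 2 * pi * (t * k)) * complex_of_real (exp (- pi * t\<^sup>2)))"
    unfolding Fc .
qed

lemma gauss_product:
  fixes x k :: "real^'n"
  shows "cis (- 2 * pi * (x \<bullet> k)) * complex_of_real (gauss x)
    = (\<Prod>b\<in>Basis. cis (- 2 * pi * ((x \<bullet> b) * (k \<bullet> b))) * complex_of_real (exp (- pi * (x \<bullet> b)\<^sup>2)))"
proof -
  have "(norm x)\<^sup>2 = (\<Sum>b\<in>Basis. (x \<bullet> b)\<^sup>2)"
    by (subst power2_norm_eq_inner, subst euclidean_inner) (simp add: power2_eq_square)
  moreover have "x \<bullet> k = (\<Sum>b\<in>Basis. (x \<bullet> b) * (k \<bullet> b))" by (rule euclidean_inner)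
  ultimately show ?thesis
    by (simp add: prod.distrib gauss_def sum_distrib_left exp_sum cis_conv_exp
        flip: of_real_prod sum_negf)
qed

lemma
  shows gauss_integrable: "integrable lborel (gauss :: real^'n \<Rightarrow> real)"
    and fourier_gauss: "fourier_real gauss k = complex_of_real (gauss (k :: real^'n))"
proof -
  have i: "integrable lborel (\<lambda>x::real^'n. cis (- 2 * pi * (x \<bullet> k)) * complex_of_real (gauss x))" for k
    unfolding gauss_product
    by (rule integrable_lborel_prod[where f="\<lambda>b t. cis (- 2 * pi * (t * (k \<bullet> b))) * complex_of_real (exp (- pi * t\<^sup>2))"])
       (rule gauss_1d)
  from i[of 0] show "integrable lborel (gauss :: real^'n \<Rightarrow> real)"
    by (simp add: complex_of_real_integrable_eq)
  have "fourier_real gauss k = (\<Prod>b\<in>Basis. (LINT t|lborel. cis (- 2 * pi * (t * (k \<bullet> b))) * complex_of_real (exp (- pi * t\<^sup>2))))"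
    unfolding fourier_def gauss_product
    by (rule integral_lborel_prod[where f="\<lambda>b t. cis (- 2 * pi * (t * (k \<bullet> b))) * complex_of_real (exp (- pi * t\<^sup>2))"])
       (rule gauss_1d)
  also have "\<dots> = complex_of_real (gauss k)"
    unfolding gauss_1d(2) using gauss_product[of k 0] by simp
  finally show "fourier_real gauss k = complex_of_real (gauss k)" .
qed

lemma gauss_measurable [measurable]: "gauss \<in> borel_measurable borel"
  unfolding gauss_def by measurable

lemma gauss_bounds: "0 < gauss x" "gauss x \<le> 1"
  by (auto simp: gauss_def)

lemma gauss_uminus [simp]: "gauss (- x) = gauss x"
  by (simp add: gauss_def)

lemma gauss_integral: "(LINT x|lborel. gauss (x :: real^'n)) = 1"
proof -
  have "fourier_real gauss (0 :: real^'n) = complex_of_real (LINT x|lborel. gauss (x :: real^'n))"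
    unfolding fourier_def by (simp flip: integral_complex_of_real)
  then show ?thesis unfolding fourier_gauss by (simp add: gauss_def)
qed

lemma gauss_scaled_integrable:
  "\<epsilon> \<noteq> 0 \<Longrightarrow> integrable lborel (\<lambda>x::real^'n. gauss (\<epsilon> *\<^sub>R x))"
  using lborel_integrable_affine[of \<epsilon> gauss 0] gauss_integrable by simp

section \<open>The Fourier integral\<close>

lemma fourier_integrable:
  "integrable lborel f \<Longrightarrow> integrable lborel (\<lambda>x. cis (- 2 * pi * (x \<bullet> \<xi>)) * f x)"
  by (rule Bochner_Integration.integrable_bound[of lborel f]) (auto simp: norm_mult)

lemma fourier_norm_le: "norm (fourier f \<xi>) \<le> (LINT x|lborel. norm (f x))"
  unfolding fourier_def by (rule order_trans[OF integral_norm_bound]) (simp add: norm_mult)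

lemma fourier_measurable [measurable]:
  assumes [measurable]: "f \<in> borel_measurable lborel"
  shows "fourier f \<in> borel_measurable borel"
proof -
  have "(\<lambda>\<xi>. LINT x|lborel. cis (- 2 * pi * (x \<bullet> \<xi>)) * f x) \<in> borel_measurable borel"
    by (rule lborel.borel_measurable_lebesgue_integral) measurable
  then show ?thesis by (simp add: fourier_def[abs_def])
qed

lemma fourier_diff:
  assumes "integrable lborel f" "integrable lborel g"
  shows "fourier (\<lambda>x. f x - g x) = (\<lambda>\<xi>. fourier f \<xi> - fourier g \<xi>)"
  unfolding fourier_def right_diff_distrib using assms
  by (intro ext Bochner_Integration.integral_diff fourier_integrable)

lemma fourier_cnj: "fourier (\<lambda>x. cnj (f x)) \<xi> = cnj (fourier f (- \<xi>))"
  unfolding fourier_def Bochner_Integration.integral_cnj[symmetric]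
  by (rule Bochner_Integration.integral_cong) (auto simp: cis_cnj)

lemma fourier_reflect:
  assumes [measurable]: "f \<in> borel_measurable lborel"
  shows "fourier (\<lambda>x. f (- x)) \<xi> = fourier f (- \<xi>)"
  unfolding fourier_def using lborel_integral_affine[of "-1" "\<lambda>x. cis (- 2 * pi * (x \<bullet> - \<xi>)) * f x" 0]
  by simp

lemma integrable_pair_mult:
  fixes f g :: "'a::euclidean_space \<Rightarrow> complex"
  assumes f: "integrable lborel f" and g: "integrable lborel g"
    and [measurable]: "h \<in> borel_measurable (lborel \<Otimes>\<^sub>M lborel)" and h: "\<And>z. norm (h z) \<le> 1"
  shows "integrable (lborel \<Otimes>\<^sub>M lborel) (\<lambda>(x, y). h (x, y) * (f x * g y))"
proof -
  have [measurable]: "f \<in> borel_measurable lborel" "g \<in> borel_measurable lborel" using f g by auto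
  have i: "integrable (lborel \<Otimes>\<^sub>M lborel) (\<lambda>(x, y). f x * g y)"
    by (rule lborel_pair.Fubini_integrable) (use f g in \<open>auto simp: norm_mult\<close>)
  show ?thesis
    by (rule Bochner_Integration.integrable_bound[OF i])
       (auto simp: norm_mult intro!: AE_I2 mult_left_le_one_le h)
qed

text \<open>Both sides are the double integral of f(x) h(\<xi>) against the phase, and Fubini
  applies because the phase has modulus one. Moving the transform from one factor to the other in
  this way is the source of Bessel's inequality and of inversion.\<close>

lemma fourier_multiplication:
  assumes f: "integrable lborel f" and h: "integrable lborel h"
  shows "(LINT \<xi>|lborel. fourier f \<xi> * h \<xi>) = (LINT x|lborel. f x * fourier h x)"
proof -
  have [measurable]: "f \<in> borel_measurable lborel" "h \<in> borel_measurable lborel" using f h by auto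
  have i: "integrable (lborel \<Otimes>\<^sub>M lborel) (\<lambda>(x, \<xi>). cis (- 2 * pi * (x \<bullet> \<xi>)) * (f x * h \<xi>))"
    using integrable_pair_mult[OF f h, of "\<lambda>(x, \<xi>). cis (- 2 * pi * (x \<bullet> \<xi>))"] by (auto simp: split_beta')
  have "(LINT \<xi>|lborel. fourier f \<xi> * h \<xi>) = (LINT \<xi>|lborel. (LINT x|lborel. cis (- 2 * pi * (x \<bullet> \<xi>)) * (f x * h \<xi>)))"
    unfolding fourier_def by (simp flip: integral_mult_left_zero add: mult.assoc)
  also have "\<dots> = (LINT x|lborel. (LINT \<xi>|lborel. cis (- 2 * pi * (x \<bullet> \<xi>)) * (f x * h \<xi>)))"
    by (rule lborel_pair.Fubini_integral[OF i])
  also have "\<dots> = (LINT x|lborel. f x * fourier h x)"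
    unfolding fourier_def
    by (simp flip: integral_mult_right_zero add: mult_ac inner_commute)
  finally show ?thesis .
qed

lemma fourier_scale:
  fixes f :: "real^'n \<Rightarrow> complex"
  assumes [measurable]: "f \<in> borel_measurable lborel" and "\<epsilon> > 0"
  shows "fourier (\<lambda>x. f (\<epsilon> *\<^sub>R x)) \<xi> = fourier f (\<xi> /\<^sub>R \<epsilon>) /\<^sub>R \<epsilon> ^ CARD('n)"
  unfolding fourier_def
  using lborel_integral_affine[of \<epsilon> "\<lambda>x. cis (- 2 * pi * (x \<bullet> \<xi> / \<epsilon>)) * f x" 0] assms
  by (simp add: divide_inverse_commute mult.assoc[symmetric, of "inverse \<epsilon>" \<epsilon>])

lemma fourier_modulate:
  "fourier (\<lambda>x. cis (2 * pi * (a \<bullet> x)) * f x) \<xi> = fourier f (\<xi> - a)"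
  unfolding fourier_def
  by (simp add: mult.assoc[symmetric] cis_mult inner_diff_right inner_commute right_diff_distrib)

lemma dilate_integrable:
  assumes "integrable lborel \<phi>" "\<beta> > 0"
  shows "integrable lborel (dilate \<phi> \<beta>)"
  using lborel_integrable_affine[of "inverse \<beta>" \<phi> 0] assms by (simp add: dilate_def[abs_def])

lemma fourier_dilate:
  fixes \<phi> :: "real^'n \<Rightarrow> real"
  assumes [measurable]: "\<phi> \<in> borel_measurable lborel" and \<beta>: "\<beta> > 0"
  shows "fourier_real (dilate \<phi> \<beta>) \<xi> = fourier_real \<phi> (\<beta> *\<^sub>R \<xi>)"
proof -
  have "fourier_real (dilate \<phi> \<beta>) \<xi> = fourier (\<lambda>x. complex_of_real (\<phi> (inverse \<beta> *\<^sub>R x))) \<xi> / of_real (\<beta> ^ CARD('n))"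
    unfolding fourier_def dilate_def by (simp add: divide_inverse mult.assoc[symmetric])
  also have "\<dots> = fourier_real \<phi> (\<beta> *\<^sub>R \<xi>)"
    using fourier_scale[of "\<lambda>x. complex_of_real (\<phi> x)" "inverse \<beta>" \<xi>] \<beta>
    by (simp add: scaleR_conv_of_real power_inverse)
  finally show ?thesis .
qed

text \<open>The multiplication formula is applied to a scaled Gaussian modulated by x, whose
  transform is a dilated Gaussian centred at x. Evaluation at - x turns the outer transform into the
  inverse one, so this is inversion damped by a Gaussian.\<close>

lemma gauss_inversion:
  fixes g :: "real^'n \<Rightarrow> complex"
  assumes g: "integrable lborel g" and \<epsilon>: "\<epsilon> > 0"
  shows "fourier (\<lambda>\<xi>. complex_of_real (gauss (\<epsilon> *\<^sub>R \<xi>)) * fourier g \<xi>) (- x) = mollify gauss \<epsilon> g x"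
proof -
  have gi: "integrable lborel (\<lambda>\<xi>::real^'n. complex_of_real (gauss (\<epsilon> *\<^sub>R \<xi>)))"
    using gauss_scaled_integrable[of \<epsilon>] \<epsilon> by (simp add: complex_of_real_integrable_eq)
  have hi: "integrable lborel (\<lambda>\<xi>. cis (2 * pi * (x \<bullet> \<xi>)) * complex_of_real (gauss (\<epsilon> *\<^sub>R \<xi>)))"
    using fourier_integrable[OF gi, of "- x"] by (simp add: inner_commute)
  have "fourier (\<lambda>\<xi>. complex_of_real (gauss (\<epsilon> *\<^sub>R \<xi>)) * fourier g \<xi>) (- x)
     = (LINT \<xi>|lborel. fourier g \<xi> * (cis (2 * pi * (x \<bullet> \<xi>)) * complex_of_real (gauss (\<epsilon> *\<^sub>R \<xi>))))"
    unfolding fourier_def[of "\<lambda>\<xi>. complex_of_real (gauss (\<epsilon> *\<^sub>R \<xi>)) * fourier g \<xi>"]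
    by (rule Bochner_Integration.integral_cong) (auto simp: mult_ac inner_commute)
  also have "\<dots> = (LINT y|lborel. g y * fourier (\<lambda>\<xi>. complex_of_real (gauss (\<epsilon> *\<^sub>R \<xi>))) (y - x))"
    by (simp add: fourier_multiplication[OF g hi] fourier_modulate)
  also have "\<dots> = (LINT y|lborel. dilate gauss \<epsilon> (x - y) *\<^sub>R g y)"
  proof (rule Bochner_Integration.integral_cong)
    fix y
    have "gauss ((y - x) /\<^sub>R \<epsilon>) = gauss ((x - y) /\<^sub>R \<epsilon>)"
      by (metis gauss_uminus minus_diff_eq scaleR_minus_right)
    then show "g y * fourier (\<lambda>\<xi>. complex_of_real (gauss (\<epsilon> *\<^sub>R \<xi>))) (y - x) = dilate gauss \<epsilon> (x - y) *\<^sub>R g y"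
      using fourier_scale[of "\<lambda>x. complex_of_real (gauss x)" \<epsilon> "y - x"] \<epsilon>
      by (simp add: dilate_def fourier_gauss scaleR_conv_of_real divide_inverse mult_ac)
  qed simp
  finally show ?thesis by (simp add: mollify_def)
qed

section \<open>Convolution\<close>

text \<open>\<open>mollify\<close> with the dilation removed, so that norm bounds and transforms can
  be proved for an arbitrary integrable kernel.\<close>

definition conv :: "(real^'n \<Rightarrow> real) \<Rightarrow> (real^'n \<Rightarrow> complex) \<Rightarrow> real^'n \<Rightarrow> complex" where
  "conv k u x = (LINT y|lborel. k (x - y) *\<^sub>R u y)"

lemma mollify_eq_conv: "mollify \<phi> \<beta> = conv (dilate \<phi> \<beta>)"
  by (simp add: fun_eq_iff mollify_def conv_def)

lemma conv_measurable [measurable]: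
  assumes [measurable]: "k \<in> borel_measurable lborel" "u \<in> borel_measurable lborel"
  shows "conv k u \<in> borel_measurable borel"
proof -
  have "(\<lambda>x. LINT y|lborel. k (x - y) *\<^sub>R u y) \<in> borel_measurable borel"
    by (rule lborel.borel_measurable_lebesgue_integral) measurable
  then show ?thesis by (simp add: conv_def[abs_def])
qed

lemma integral_dilate_norm:
  fixes \<phi> :: "real^'n \<Rightarrow> real"
  assumes [measurable]: "\<phi> \<in> borel_measurable lborel" and "\<beta> > 0"
  shows "(LINT x|lborel. \<bar>dilate \<phi> \<beta> x\<bar>) = (LINT x|lborel. \<bar>\<phi> x\<bar>)"
  using lborel_integral_affine[of \<beta> "\<lambda>x. \<bar>dilate \<phi> \<beta> x\<bar>" 0] assms
  by (simp add: dilate_def[abs_def])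

text \<open>Young's inequality. Writing |k| as the product of two square roots, Cauchy-Schwarz
  bounds the square of \<open>N x\<close> by the L1 norm of k times the integral of |k(x - y)|
  |u(y)|^2; integration over x and Fubini give the claim. Finiteness of \<open>N\<close> almost
  everywhere is the integrability statement.\<close>

lemma
  fixes k :: "real^'n \<Rightarrow> real"
  assumes k: "integrable lborel k" and u: "u \<in> L2"
  shows conv_integrable_AE: "AE x in lborel. integrable lborel (\<lambda>y. k (x - y) *\<^sub>R u y)"
    and conv_L2: "conv k u \<in> L2"
    and conv_norm: "L2norm (conv k u) \<le> (LINT x|lborel. \<bar>k x\<bar>) * L2norm u"
proof -
  note [measurable] = L2_measurable[OF u]
  have [measurable]: "k \<in> borel_measurable lborel" using k by simp
  let ?K = "LINT x|lborel. \<bar>k x\<bar>"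
  have K0: "0 \<le> ?K" by simp
  have K: "(\<integral>\<^sup>+x. ennreal \<bar>k x\<bar> \<partial>lborel) = ennreal ?K"
    using k by (simp add: nn_integral_eq_integral)
  have K1: "(\<integral>\<^sup>+y. ennreal \<bar>k (x - y)\<bar> \<partial>lborel) = ennreal ?K" for x
    using lborel_nn_integral_affine[of "-1" "\<lambda>x. ennreal \<bar>k x\<bar>" x] K by simp
  have K2: "(\<integral>\<^sup>+x. ennreal \<bar>k (x - y)\<bar> \<partial>lborel) = ennreal ?K" for y
    using lborel_nn_integral_affine[of 1 "\<lambda>x. ennreal \<bar>k x\<bar>" "- y"] K by simp
  define N where "N x = (\<integral>\<^sup>+y. ennreal (\<bar>k (x - y)\<bar> * norm (u y)) \<partial>lborel)" for x
  have [measurable]: "N \<in> borel_measurable borel" unfolding N_def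
    by (rule lborel.borel_measurable_nn_integral) measurable
  have N2: "(N x)\<^sup>2 \<le> ennreal ?K * (\<integral>\<^sup>+y. ennreal (\<bar>k (x - y)\<bar> * (norm (u y))\<^sup>2) \<partial>lborel)" for x
  proof -
    have "(N x)\<^sup>2 = (\<integral>\<^sup>+y. ennreal (sqrt \<bar>k (x - y)\<bar>) * ennreal (sqrt \<bar>k (x - y)\<bar> * norm (u y)) \<partial>lborel)\<^sup>2"
      unfolding N_def by (simp add: ennreal_mult[symmetric] mult.assoc[symmetric])
    also have "\<dots> \<le> (\<integral>\<^sup>+y. (ennreal (sqrt \<bar>k (x - y)\<bar>))\<^sup>2 \<partial>lborel) * (\<integral>\<^sup>+y. (ennreal (sqrt \<bar>k (x - y)\<bar> * norm (u y)))\<^sup>2 \<partial>lborel)"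
      by (rule Cauchy_Schwarz_nn_integral) measurable
    also have "\<dots> = ennreal ?K * (\<integral>\<^sup>+y. ennreal (\<bar>k (x - y)\<bar> * (norm (u y))\<^sup>2) \<partial>lborel)"
      by (simp add: ennreal_power power_mult_distrib K1)
    finally show ?thesis .
  qed
  have "(\<integral>\<^sup>+x. (N x)\<^sup>2 \<partial>lborel) \<le> (\<integral>\<^sup>+x. ennreal ?K * (\<integral>\<^sup>+y. ennreal (\<bar>k (x - y)\<bar> * (norm (u y))\<^sup>2) \<partial>lborel) \<partial>lborel)"
    by (rule nn_integral_mono) (rule N2)
  also have "\<dots> = ennreal ?K * (\<integral>\<^sup>+x. (\<integral>\<^sup>+y. ennreal (\<bar>k (x - y)\<bar> * (norm (u y))\<^sup>2) \<partial>lborel) \<partial>lborel)"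
    by (rule nn_integral_cmult) measurable
  also have "(\<integral>\<^sup>+x. (\<integral>\<^sup>+y. ennreal (\<bar>k (x - y)\<bar> * (norm (u y))\<^sup>2) \<partial>lborel) \<partial>lborel)
     = (\<integral>\<^sup>+y. (\<integral>\<^sup>+x. ennreal (\<bar>k (x - y)\<bar> * (norm (u y))\<^sup>2) \<partial>lborel) \<partial>lborel)"
    by (rule lborel_pair.Fubini'[symmetric]) measurable
  also have "\<dots> = (\<integral>\<^sup>+y. ennreal ?K * ennreal ((norm (u y))\<^sup>2) \<partial>lborel)"
    by (simp add: ennreal_mult nn_integral_multc K2)
  also have "\<dots> = ennreal ?K * ennreal ((L2norm u)\<^sup>2)"
    by (simp add: nn_integral_cmult L2norm_nn_integral[OF u])
  also have "ennreal ?K * (ennreal ?K * ennreal ((L2norm u)\<^sup>2)) = ennreal ((?K * L2norm u)\<^sup>2)"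
    using K0 by (simp add: ennreal_mult[symmetric] power_mult_distrib power2_eq_square mult_ac)
  finally have NN: "(\<integral>\<^sup>+x. (N x)\<^sup>2 \<partial>lborel) \<le> ennreal ((?K * L2norm u)\<^sup>2)" .
  have "AE x in lborel. (N x)\<^sup>2 \<noteq> \<infinity>"
    using NN by (intro nn_integral_PInf_AE) (auto simp: top_unique)
  then have NA: "AE x in lborel. N x < \<infinity>"
    by eventually_elim (auto simp: less_top power2_eq_square ennreal_mult_eq_top_iff)
  then show "AE x in lborel. integrable lborel (\<lambda>y. k (x - y) *\<^sub>R u y)"
    by eventually_elim (auto simp: integrable_iff_bounded N_def)
  \<comment> \<open>Where the integral fails to exist, \<open>conv\<close> takes the default value
    0, so the bound holds at every point.\<close>
  have cN: "ennreal (norm (conv k u x)) \<le> N x" for x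
  proof (cases "integrable lborel (\<lambda>y. k (x - y) *\<^sub>R u y)")
    case True
    then show ?thesis unfolding conv_def N_def
      by (rule order_trans[OF integral_norm_bound_ennreal]) simp
  qed (simp add: conv_def not_integrable_integral_eq)
  have "(\<integral>\<^sup>+x. ennreal ((norm (conv k u x))\<^sup>2) \<partial>lborel) \<le> (\<integral>\<^sup>+x. (N x)\<^sup>2 \<partial>lborel)"
    by (rule nn_integral_mono) (use cN in \<open>simp add: ennreal_power[symmetric] power_mono\<close>)
  with NN have "(\<integral>\<^sup>+x. ennreal ((norm (conv k u x))\<^sup>2) \<partial>lborel) \<le> ennreal ((?K * L2norm u)\<^sup>2)"
    by (rule order_trans[rotated])
  then show "conv k u \<in> L2" "L2norm (conv k u) \<le> ?K * L2norm u"
    using K0 by (auto intro: L2_nn_integral_le[of _ "?K * L2norm u"])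
qed

lemma conv_diff:
  assumes "integrable lborel k" "u \<in> L2" "v \<in> L2"
  shows "AE x in lborel. conv k (\<lambda>x. u x - v x) x = conv k u x - conv k v x"
  using conv_integrable_AE[OF assms(1,2)] conv_integrable_AE[OF assms(1,3)]
  by eventually_elim (simp add: conv_def scaleR_diff_right)

text \<open>Fubini and the translation x -> y + x, under which the phase splits into two
  factors.\<close>

lemma
  fixes k :: "real^'n \<Rightarrow> real"
  assumes k: "integrable lborel k" and u: "integrable lborel u"
  shows conv_integrable: "integrable lborel (conv k u)"
    and fourier_conv: "fourier (conv k u) \<xi> = fourier_real k \<xi> * fourier u \<xi>"
proof -
  have [measurable]: "k \<in> borel_measurable lborel" "u \<in> borel_measurable lborel" using k u by auto
  have ki: "integrable lborel (\<lambda>x. k (x - y))" for y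
    using lborel_integrable_affine[of 1 k "- y"] k by simp
  have kn: "(LINT x|lborel. \<bar>k (x - y)\<bar>) = (LINT x|lborel. \<bar>k x\<bar>)" for y
    using lborel_integral_affine[of 1 "\<lambda>x. \<bar>k x\<bar>" "- y"] by simp
  have i: "integrable (lborel \<Otimes>\<^sub>M lborel) (\<lambda>(y, x). k (x - y) *\<^sub>R u y)"
    by (rule lborel_pair.Fubini_integrable) (use ki u in \<open>auto simp: kn\<close>)
  from lborel_pair.integrable_snd[OF i] show "integrable lborel (conv k u)"
    by (simp add: conv_def[abs_def])
  have i2: "integrable (lborel \<Otimes>\<^sub>M lborel) (\<lambda>(y, x). cis (- 2 * pi * (x \<bullet> \<xi>)) * (k (x - y) *\<^sub>R u y))"
    by (rule Bochner_Integration.integrable_bound[OF i]) (auto simp: norm_mult intro!: AE_I2)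
  have F: "(LINT x|lborel. cis (- 2 * pi * (x \<bullet> \<xi>)) * (k (x - y) *\<^sub>R u y))
     = cis (- 2 * pi * (y \<bullet> \<xi>)) * u y * fourier_real k \<xi>" for y
  proof -
    have "(LINT x|lborel. cis (- 2 * pi * (x \<bullet> \<xi>)) * (k (x - y) *\<^sub>R u y))
      = (LINT x|lborel. cis (- 2 * pi * ((y + x) \<bullet> \<xi>)) * (k x *\<^sub>R u y))"
      using lborel_integral_affine[of 1 "\<lambda>x. cis (- 2 * pi * (x \<bullet> \<xi>)) * (k (x - y) *\<^sub>R u y)" y] by simp
    also have "\<dots> = (LINT x|lborel. (cis (- 2 * pi * (y \<bullet> \<xi>)) * u y) * (cis (- 2 * pi * (x \<bullet> \<xi>)) * complex_of_real (k x)))"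
    proof (rule Bochner_Integration.integral_cong)
      fix x
      have "cis (- 2 * pi * ((y + x) \<bullet> \<xi>)) = cis (- 2 * pi * (y \<bullet> \<xi>)) * cis (- 2 * pi * (x \<bullet> \<xi>))"
        by (simp add: cis_mult inner_add_left distrib_left)
      then show "cis (- 2 * pi * ((y + x) \<bullet> \<xi>)) * (k x *\<^sub>R u y) =
          (cis (- 2 * pi * (y \<bullet> \<xi>)) * u y) * (cis (- 2 * pi * (x \<bullet> \<xi>)) * complex_of_real (k x))"
        by (simp add: scaleR_conv_of_real mult_ac)
    qed simp
    also have "\<dots> = (cis (- 2 * pi * (y \<bullet> \<xi>)) * u y) * fourier_real k \<xi>"
      unfolding fourier_def by (rule Bochner_Integration.integral_mult_right_zero)
    finally show ?thesis .
  qed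
  have "fourier (conv k u) \<xi> = (LINT x|lborel. (LINT y|lborel. cis (- 2 * pi * (x \<bullet> \<xi>)) * (k (x - y) *\<^sub>R u y)))"
    unfolding fourier_def conv_def by (simp only: integral_mult_right_zero)
  also have "\<dots> = (LINT y|lborel. (LINT x|lborel. cis (- 2 * pi * (x \<bullet> \<xi>)) * (k (x - y) *\<^sub>R u y)))"
    by (rule lborel_pair.Fubini_integral[OF i2])
  also have "\<dots> = fourier_real k \<xi> * fourier u \<xi>"
    unfolding F by (simp add: fourier_def[of u])
  finally show "fourier (conv k u) \<xi> = fourier_real k \<xi> * fourier u \<xi>" .
qed

section \<open>Bessel's inequality\<close>

lemma mollify_gauss:
  fixes f :: "real^'n \<Rightarrow> complex"
  assumes "f \<in> L2" "\<epsilon> > 0"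
  shows "mollify gauss \<epsilon> f \<in> L2" "L2norm (mollify gauss \<epsilon> f) \<le> L2norm f"
proof -
  have i: "integrable lborel (dilate (gauss :: real^'n \<Rightarrow> real) \<epsilon>)"
    by (intro dilate_integrable gauss_integrable assms)
  have "(LINT x|lborel. \<bar>dilate (gauss :: real^'n \<Rightarrow> real) \<epsilon> x\<bar>) = 1"
    using integral_dilate_norm[of "gauss :: real^'n \<Rightarrow> real" \<epsilon>] assms(2) gauss_integral
    by (simp add: gauss_def)
  then show "mollify gauss \<epsilon> f \<in> L2" "L2norm (mollify gauss \<epsilon> f) \<le> L2norm f"
    using conv_L2[OF i assms(1)] conv_norm[OF i assms(1)] by (auto simp: mollify_eq_conv)
qed

lemma bounded_gauss_integrable:
  fixes F :: "real^'n \<Rightarrow> complex"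
  assumes [measurable]: "F \<in> borel_measurable lborel" and "\<And>x. norm (F x) \<le> B" and "\<epsilon> \<noteq> 0"
  shows "integrable lborel (\<lambda>\<xi>. complex_of_real (gauss (\<epsilon> *\<^sub>R \<xi>)) * F \<xi>)"
proof -
  have "integrable lborel (\<lambda>\<xi>::real^'n. gauss (\<epsilon> *\<^sub>R \<xi>) * B)"
    by (intro integrable_mult_left gauss_scaled_integrable assms)
  then show ?thesis
    by (rule Bochner_Integration.integrable_bound)
       (auto simp: norm_mult abs_mult intro!: AE_I2 mult_mono order_trans[OF assms(2)])
qed

text \<open>A Gaussian weight makes the squared transform integrable. By the multiplication formula
  the weighted integral equals the pairing of f with the conjugate of its mollification, and
  mollification does not increase the norm. Fatou's lemma removes the weight. Equality is obtained
  only later, from inversion.\<close>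

lemma fourier_Bessel:
  fixes f :: "real^'n \<Rightarrow> complex"
  assumes f: "integrable lborel f" and f2: "f \<in> L2"
  shows "fourier f \<in> L2" "L2norm (fourier f) \<le> L2norm f"
proof -
  have [measurable]: "f \<in> borel_measurable lborel" using f by simp
  have le: "(\<integral>\<^sup>+\<xi>. ennreal (gauss (\<epsilon> *\<^sub>R \<xi>) * (norm (fourier f \<xi>))\<^sup>2) \<partial>lborel) \<le> ennreal ((L2norm f)\<^sup>2)"
    if \<epsilon>: "\<epsilon> > 0" for \<epsilon>
  proof -
    let ?h = "\<lambda>\<xi>. complex_of_real (gauss (\<epsilon> *\<^sub>R \<xi>)) * cnj (fourier f \<xi>)"
    have hi: "integrable lborel ?h"
      using \<epsilon> by (intro bounded_gauss_integrable[where B="LINT x|lborel. norm (f x)"])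
        (auto simp: fourier_norm_le)
    have hf: "fourier ?h x = cnj (mollify gauss \<epsilon> f x)" for x
      using fourier_cnj[of "\<lambda>\<xi>. complex_of_real (gauss (\<epsilon> *\<^sub>R \<xi>)) * fourier f \<xi>" x]
        gauss_inversion[OF f \<epsilon>, of x] by simp
    have m: "(\<lambda>x. cnj (mollify gauss \<epsilon> f x)) \<in> L2" "L2norm (\<lambda>x. cnj (mollify gauss \<epsilon> f x)) \<le> L2norm f"
      using mollify_gauss[OF f2 \<epsilon>] by (auto simp: L2_def L2norm_def)
    have eq: "fourier f \<xi> * ?h \<xi> = complex_of_real (gauss (\<epsilon> *\<^sub>R \<xi>) * (norm (fourier f \<xi>))\<^sup>2)" for \<xi>
      by (simp add: complex_norm_square[symmetric] mult_ac del: of_real_power)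
    have ii: "integrable lborel (\<lambda>\<xi>. complex_of_real (gauss (\<epsilon> *\<^sub>R \<xi>) * (norm (fourier f \<xi>))\<^sup>2))"
    proof -
      let ?J = "LINT x|lborel. norm (f x)"
      have "integrable lborel (\<lambda>\<xi>. complex_of_real (gauss (\<epsilon> *\<^sub>R \<xi>)) * (cnj (fourier f \<xi>) * fourier f \<xi>))"
      proof (rule bounded_gauss_integrable)
        show "norm (cnj (fourier f \<xi>) * fourier f \<xi>) \<le> ?J * ?J" for \<xi>
          unfolding norm_mult complex_mod_cnj by (intro mult_mono fourier_norm_le) auto
      qed (use \<epsilon> in auto)
      then show ?thesis unfolding eq[symmetric] by (simp add: mult_ac)
    qed
    have "(LINT \<xi>|lborel. gauss (\<epsilon> *\<^sub>R \<xi>) * (norm (fourier f \<xi>))\<^sup>2)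
       \<le> norm (LINT \<xi>|lborel. fourier f \<xi> * ?h \<xi>)"
      unfolding eq by (simp only: integral_complex_of_real norm_of_real)
    also have "\<dots> = norm (LINT x|lborel. f x * cnj (mollify gauss \<epsilon> f x))"
      by (simp only: fourier_multiplication[OF f hi] hf)
    also have "\<dots> \<le> L2norm f * L2norm f"
      using L2_Cauchy_Schwarz(4)[OF f2 m(1)] m(2) by (meson L2norm_nonneg mult_left_mono order_trans)
    finally have "(LINT \<xi>|lborel. gauss (\<epsilon> *\<^sub>R \<xi>) * (norm (fourier f \<xi>))\<^sup>2) \<le> (L2norm f)\<^sup>2"
      by (simp add: power2_eq_square)
    then show ?thesis
      using ii unfolding complex_of_real_integrable_eq
      by (subst nn_integral_eq_integral) (auto simp: gauss_bounds(1) less_imp_le)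
  qed
  let ?\<epsilon> = "\<lambda>n. inverse (real (Suc n))"
  have lim: "(\<lambda>n. ennreal (gauss (?\<epsilon> n *\<^sub>R \<xi>) * (norm (fourier f \<xi>))\<^sup>2)) \<longlonglongrightarrow> ennreal ((norm (fourier f \<xi>))\<^sup>2)" for \<xi>
  proof -
    have "(\<lambda>n. gauss (?\<epsilon> n *\<^sub>R \<xi>)) \<longlonglongrightarrow> exp (- pi * (norm (0 *\<^sub>R \<xi>))\<^sup>2)"
      unfolding gauss_def by (intro tendsto_intros LIMSEQ_inverse_real_of_nat)
    then have "(\<lambda>n. ennreal (gauss (?\<epsilon> n *\<^sub>R \<xi>) * (norm (fourier f \<xi>))\<^sup>2)) \<longlonglongrightarrow> ennreal (1 * (norm (fourier f \<xi>))\<^sup>2)"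
      by (intro tendsto_ennrealI tendsto_mult tendsto_const) simp
    then show ?thesis by simp
  qed
  have "(\<integral>\<^sup>+\<xi>. ennreal ((norm (fourier f \<xi>))\<^sup>2) \<partial>lborel)
      = (\<integral>\<^sup>+\<xi>. liminf (\<lambda>n. ennreal (gauss (?\<epsilon> n *\<^sub>R \<xi>) * (norm (fourier f \<xi>))\<^sup>2)) \<partial>lborel)"
    using lim by (intro nn_integral_cong lim_imp_Liminf[symmetric]) auto
  also have "\<dots> \<le> liminf (\<lambda>n. \<integral>\<^sup>+\<xi>. ennreal (gauss (?\<epsilon> n *\<^sub>R \<xi>) * (norm (fourier f \<xi>))\<^sup>2) \<partial>lborel)"
    by (rule nn_integral_liminf) measurable
  also have "\<dots> \<le> ennreal ((L2norm f)\<^sup>2)"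
    by (rule order_trans[OF Liminf_le_Limsup Limsup_bounded]) (auto intro!: always_eventually le)
  finally show "fourier f \<in> L2" "L2norm (fourier f) \<le> L2norm f"
    by (auto intro: L2_nn_integral_le[of _ "L2norm f"])
qed

section \<open>The Fourier transform on square-integrable functions\<close>

text \<open>The truncation occurring in \<open>has_fourier_L2\<close>. A truncated L2 function is
  also integrable, so the Fourier integral applies to it.\<close>

definition trunc :: "real \<Rightarrow> (real^'n \<Rightarrow> complex) \<Rightarrow> real^'n \<Rightarrow> complex" where
  "trunc R f = (\<lambda>x. indicator (cball 0 R) x *\<^sub>R f x)"

lemma trunc:
  fixes f :: "real^'n \<Rightarrow> complex"
  assumes f: "f \<in> L2"
  shows trunc_L2: "trunc R f \<in> L2" and trunc_integrable: "integrable lborel (trunc R f)"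
    and fourier_trunc_L2: "fourier (trunc R f) \<in> L2"
    and trunc_tendsto: "((\<lambda>R. L2norm (\<lambda>x. f x - trunc R f x)) \<longlongrightarrow> 0) at_top"
proof -
  note [measurable] = L2_measurable[OF f]
  have [measurable]: "trunc R f \<in> borel_measurable lborel" for R
    using L2_measurable[OF f] unfolding trunc_def
    by (intro borel_measurable_scaleR borel_measurable_indicator) auto
  show t2: "trunc R f \<in> L2" for R
    by (rule L2_bound[OF _ f]) (auto simp: trunc_def indicator_def)
  have "(\<lambda>x::real^'n. complex_of_real (indicator (cball 0 R) x)) \<in> L2"
  proof -
    have "(norm (complex_of_real (indicator (cball 0 R) x)))\<^sup>2 = indicator (cball 0 R) x" for x :: "real^'n"
      by (simp add: indicator_def)
    moreover have "integrable lborel (indicator (cball 0 R) :: real^'n \<Rightarrow> real)"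
      by (intro integrable_real_indicator emeasure_lborel_cball_finite) auto
    ultimately show ?thesis by (simp add: L2_def)
  qed
  from L2_Cauchy_Schwarz(1)[OF this f] show ti: "integrable lborel (trunc R f)"
    by (simp add: trunc_def scaleR_conv_of_real)
  show "fourier (trunc R f) \<in> L2" by (rule fourier_Bessel[OF ti t2])
  show "((\<lambda>R. L2norm (\<lambda>x. f x - trunc R f x)) \<longlongrightarrow> 0) at_top"
  proof (rule tendsto_at_topI_sequentially)
    fix X :: "nat \<Rightarrow> real" assume X: "filterlim X at_top sequentially"
    have "(\<lambda>n. L2norm (\<lambda>x. trunc (X n) f x - f x)) \<longlonglongrightarrow> 0"
    proof (rule L2_dominated_convergence(1)[OF _ _ f])
      show "AE x in lborel. (\<lambda>n. trunc (X n) f x) \<longlonglongrightarrow> f x"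
      proof (intro AE_I2 tendsto_eventually)
        fix x :: "real^'n"
        from X have "eventually (\<lambda>n. X n \<ge> norm x) sequentially" by (simp add: filterlim_at_top)
        then show "\<forall>\<^sub>F n in sequentially. trunc (X n) f x = f x"
          by eventually_elim (simp add: trunc_def)
      qed
    qed (auto simp: trunc_def indicator_def)
    then show "(\<lambda>n. L2norm (\<lambda>x. f x - trunc (X n) f x)) \<longlonglongrightarrow> 0"
      by (simp add: L2norm_minus_commute)
  qed
qed

lemma has_fourier_L2_trunc:
  "has_fourier_L2 f F \<longleftrightarrow> f \<in> L2 \<and> F \<in> L2 \<and> ((\<lambda>R. L2norm (\<lambda>\<xi>. F \<xi> - fourier (trunc R f) \<xi>)) \<longlongrightarrow> 0) at_top"
  by (simp add: has_fourier_L2_def trunc_def)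

lemma has_fourier_L2D: "has_fourier_L2 f F \<Longrightarrow> f \<in> L2" "has_fourier_L2 f F \<Longrightarrow> F \<in> L2"
  by (auto simp: has_fourier_L2_def)

lemma fourier_trunc_dist:
  assumes "f \<in> L2"
  shows "L2norm (\<lambda>\<xi>. fourier (trunc R f) \<xi> - fourier (trunc S f) \<xi>)
     \<le> L2norm (\<lambda>x. f x - trunc R f x) + L2norm (\<lambda>x. f x - trunc S f x)"
proof -
  have "L2norm (\<lambda>\<xi>. fourier (trunc R f) \<xi> - fourier (trunc S f) \<xi>) \<le> L2norm (\<lambda>x. trunc R f x - trunc S f x)"
    using fourier_Bessel(2)[of "\<lambda>x. trunc R f x - trunc S f x"] trunc[OF assms]
    by (simp add: fourier_diff L2_diff)
  also have "\<dots> \<le> L2norm (\<lambda>x. f x - trunc R f x) + L2norm (\<lambda>x. f x - trunc S f x)"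
    using L2norm_triangle[OF trunc_L2[OF assms] assms trunc_L2[OF assms], of R S]
    by (simp add: L2norm_minus_commute)
  finally show ?thesis .
qed

text \<open>Completeness is available along sequences only, whereas the definition asks for a limit
  over real radii. The sequence produces a candidate \<open>F\<close>, whose distance to the
  transform of any truncation is then bounded by the truncation error itself.\<close>

lemma has_fourier_L2_exists:
  assumes f: "f \<in> L2" shows "\<exists>F. has_fourier_L2 f F"
proof -
  \<comment> \<open>The extra factor 1/2 leaves room for two consecutive truncation errors within
    the increment (1/2)^i.\<close>
  have "\<exists>R. L2norm (\<lambda>x. f x - trunc R f x) \<le> (1/2)^i / 2" for i
  proof -
    have "eventually (\<lambda>R. L2norm (\<lambda>x. f x - trunc R f x) < (1/2)^i / 2) at_top"
      by (rule order_tendstoD[OF trunc_tendsto[OF f]]) simp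
    then show ?thesis by (meson eventually_happens' trivial_limit_at_top_linorder less_imp_le)
  qed
  then obtain R where R: "\<And>i. L2norm (\<lambda>x. f x - trunc (R i) f x) \<le> (1/2)^i / 2" by metis
  define s where "s i = fourier (trunc (R i) f)" for i
  have s: "s i \<in> L2" for i unfolding s_def by (rule fourier_trunc_L2[OF f])
  have half: "(1/2::real) ^ Suc i / 2 + (1/2) ^ i / 2 \<le> (1/2) ^ i" for i by simp
  have "L2norm (\<lambda>x. s (Suc i) x - s i x) \<le> (1/2)^i" for i
    using fourier_trunc_dist[OF f, of "R (Suc i)" "R i"] R[of "Suc i"] R[of i] half[of i] unfolding s_def by linarith
  from L2_limit_of_summable[OF s this] obtain F where F: "F \<in> L2" "(\<lambda>i. L2norm (\<lambda>x. s i x - F x)) \<longlonglongrightarrow> 0"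
    by auto
  \<comment> \<open>The radius S stays fixed while the index i of the approximating sequence tends
    to infinity.\<close>
  have "L2norm (\<lambda>\<xi>. F \<xi> - fourier (trunc S f) \<xi>) \<le> L2norm (\<lambda>x. f x - trunc S f x)" for S
  proof (rule LIMSEQ_le_const[where X="\<lambda>i. L2norm (\<lambda>x. s i x - F x) + ((1/2)^i / 2 + L2norm (\<lambda>x. f x - trunc S f x))"])
    have "(\<lambda>i. L2norm (\<lambda>x. s i x - F x) + ((1/2)^i / 2 + L2norm (\<lambda>x. f x - trunc S f x)))
      \<longlonglongrightarrow> 0 + (0 / 2 + L2norm (\<lambda>x. f x - trunc S f x))"
      by (intro tendsto_intros F LIMSEQ_power_zero) auto
    then show "(\<lambda>i. L2norm (\<lambda>x. s i x - F x) + ((1/2)^i / 2 + L2norm (\<lambda>x. f x - trunc S f x)))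
      \<longlonglongrightarrow> L2norm (\<lambda>x. f x - trunc S f x)" by simp
    show "\<exists>N. \<forall>n\<ge>N. L2norm (\<lambda>\<xi>. F \<xi> - fourier (trunc S f) \<xi>)
       \<le> L2norm (\<lambda>x. s n x - F x) + ((1/2)^n / 2 + L2norm (\<lambda>x. f x - trunc S f x))"
    proof (intro exI[of _ 0] allI impI)
      fix n
      show "L2norm (\<lambda>\<xi>. F \<xi> - fourier (trunc S f) \<xi>)
       \<le> L2norm (\<lambda>x. s n x - F x) + ((1/2)^n / 2 + L2norm (\<lambda>x. f x - trunc S f x))"
        using L2norm_triangle[OF F(1) s[of n] fourier_trunc_L2[OF f, of S]] fourier_trunc_dist[OF f, of "R n" S] R[of n]
        by (simp add: s_def L2norm_minus_commute[of F])
    qed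
  qed
  then have "((\<lambda>S. L2norm (\<lambda>\<xi>. F \<xi> - fourier (trunc S f) \<xi>)) \<longlongrightarrow> 0) at_top"
    by (intro Lim_null_comparison[OF _ trunc_tendsto[OF f]]) auto
  then show ?thesis using f F(1) by (auto simp: has_fourier_L2_trunc)
qed

lemma has_fourier_L2_Bessel:
  assumes h: "has_fourier_L2 f F" shows "L2norm F \<le> L2norm f"
proof -
  note f = has_fourier_L2D(1)[OF h] and F = has_fourier_L2D(2)[OF h]
  have "((\<lambda>R. L2norm (fourier (trunc R f))) \<longlongrightarrow> L2norm F) at_top"
    using h by (intro L2_norm_convergence fourier_trunc_L2 f F) (simp add: has_fourier_L2_trunc L2norm_minus_commute)
  moreover have "L2norm (fourier (trunc R f)) \<le> L2norm f" for R
    by (rule order_trans[OF fourier_Bessel(2)[OF trunc_integrable[OF f] trunc_L2[OF f]]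
          L2_bound(2)[OF L2_measurable(1)[OF trunc_L2[OF f]] f]])
       (auto simp: trunc_def indicator_def)
  ultimately show ?thesis by (intro tendsto_upperbound) auto
qed

lemma has_fourier_L2_diff:
  assumes h: "has_fourier_L2 f F" "has_fourier_L2 g G"
  shows "has_fourier_L2 (\<lambda>x. f x - g x) (\<lambda>x. F x - G x)"
proof -
  note D = has_fourier_L2D[OF h(1)] has_fourier_L2D[OF h(2)]
  have t: "trunc R (\<lambda>x. f x - g x) = (\<lambda>x. trunc R f x - trunc R g x)" for R
    by (simp add: trunc_def scaleR_diff_right)
  have le: "L2norm (\<lambda>\<xi>. F \<xi> - G \<xi> - fourier (trunc R (\<lambda>x. f x - g x)) \<xi>)
    \<le> L2norm (\<lambda>\<xi>. F \<xi> - fourier (trunc R f) \<xi>) + L2norm (\<lambda>\<xi>. G \<xi> - fourier (trunc R g) \<xi>)" for R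
    using L2_diff(2)[OF L2_diff(1)[OF D(2) fourier_trunc_L2[OF D(1)]] L2_diff(1)[OF D(4) fourier_trunc_L2[OF D(3)]], of R R]
    by (simp add: t fourier_diff trunc_integrable D algebra_simps)
  have "((\<lambda>R. L2norm (\<lambda>\<xi>. F \<xi> - fourier (trunc R f) \<xi>) + L2norm (\<lambda>\<xi>. G \<xi> - fourier (trunc R g) \<xi>)) \<longlongrightarrow> 0 + 0) at_top"
    using h by (intro tendsto_add) (auto simp: has_fourier_L2_trunc)
  then have "((\<lambda>R. L2norm (\<lambda>\<xi>. F \<xi> - G \<xi> - fourier (trunc R (\<lambda>x. f x - g x)) \<xi>)) \<longlongrightarrow> 0) at_top"
    unfolding add_0_left by (rule Lim_null_comparison[rotated]) (use le in simp)
  then show ?thesis using D by (simp add: has_fourier_L2_trunc L2_diff)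
qed

lemma has_fourier_L2_dist:
  "has_fourier_L2 f F \<Longrightarrow> has_fourier_L2 g G \<Longrightarrow> L2norm (\<lambda>x. F x - G x) \<le> L2norm (\<lambda>x. f x - g x)"
  by (rule has_fourier_L2_Bessel[OF has_fourier_L2_diff])

lemma has_fourier_L2_unique_AE:
  assumes "has_fourier_L2 f F" "has_fourier_L2 g G" "AE x in lborel. f x = g x"
  shows "AE x in lborel. F x = G x"
proof (rule L2_AE_eqI)
  have "L2norm (\<lambda>x. f x - g x) = 0"
    by (intro L2norm_diff_AE_eq has_fourier_L2D(1)[OF assms(1)] has_fourier_L2D(1)[OF assms(2)] assms(3))
  then show "L2norm (\<lambda>x. F x - G x) = 0"
    using has_fourier_L2_dist[OF assms(1,2)] by (simp add: antisym)
qed (auto intro: has_fourier_L2D assms)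

text \<open>Allows the arbitrary representatives picked by the choice operators to be replaced by
  explicit multiplier formulas.\<close>

lemma has_fourier_L2_cong_AE:
  assumes h: "has_fourier_L2 f F" and f: "f' \<in> borel_measurable lborel" "F' \<in> borel_measurable lborel"
    and ae: "AE x in lborel. f x = f' x" "AE x in lborel. F x = F' x"
  shows "has_fourier_L2 f' F'"
proof -
  note D = has_fourier_L2D[OF h]
  have f': "f' \<in> L2" using ae(1) by (intro L2_bound(1)[OF f(1) D(1)]) auto
  have F': "F' \<in> L2" using ae(2) by (intro L2_bound(1)[OF f(2) D(2)]) auto
  have eq: "fourier (trunc R f') = fourier (trunc R f)" for R
  proof
    fix \<xi>
    note [measurable] = L2_measurable[OF trunc_L2[OF f']] L2_measurable[OF trunc_L2[OF D(1)]]
    have "AE x in lborel. trunc R f' x = trunc R f x"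
      using ae(1) by eventually_elim (simp add: trunc_def)
    then show "fourier (trunc R f') \<xi> = fourier (trunc R f) \<xi>"
      unfolding fourier_def by (intro integral_cong_AE) auto
  qed
  have "L2norm (\<lambda>\<xi>. F' \<xi> - fourier (trunc R f') \<xi>) = L2norm (\<lambda>\<xi>. F \<xi> - fourier (trunc R f) \<xi>)" for R
    unfolding eq using ae(2) D(2) F' fourier_trunc_L2[OF D(1)]
    by (intro L2norm_cong_AE L2_measurable L2_diff) auto
  then show ?thesis using h f' F' by (simp add: has_fourier_L2_trunc)
qed

lemma has_fourier_L2_fourier:
  assumes f: "integrable lborel f" "f \<in> L2"
  shows "has_fourier_L2 f (fourier f)"
proof -
  have "L2norm (\<lambda>\<xi>. fourier f \<xi> - fourier (trunc R f) \<xi>) \<le> L2norm (\<lambda>x. f x - trunc R f x)" for R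
    using fourier_Bessel(2)[of "\<lambda>x. f x - trunc R f x"] trunc[OF f(2)] f
    by (simp add: fourier_diff L2_diff)
  then have "((\<lambda>R. L2norm (\<lambda>\<xi>. fourier f \<xi> - fourier (trunc R f) \<xi>)) \<longlongrightarrow> 0) at_top"
    by (intro Lim_null_comparison[OF _ trunc_tendsto[OF f(2)]]) auto
  then show ?thesis using f fourier_Bessel(1)[OF f] by (simp add: has_fourier_L2_trunc)
qed

lemma has_fourier_L2_tendsto:
  assumes "\<And>i. has_fourier_L2 (s i) (S i)" "has_fourier_L2 f F" "((\<lambda>i. L2norm (\<lambda>x. s i x - f x)) \<longlongrightarrow> 0) X"
  shows "((\<lambda>i. L2norm (\<lambda>x. S i x - F x)) \<longlongrightarrow> 0) X"
  by (rule Lim_null_comparison[OF _ assms(3)])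
     (use has_fourier_L2_dist[OF assms(1,2)] in auto)

lemma L2_reflect:
  assumes u: "u \<in> L2"
  shows "(\<lambda>x. u (- x)) \<in> L2" "L2norm (\<lambda>x. u (- x)) = L2norm u"
proof -
  note [measurable] = L2_measurable[OF u]
  show "(\<lambda>x. u (- x)) \<in> L2" "L2norm (\<lambda>x. u (- x)) = L2norm u"
    using lborel_integrable_affine[OF _ L2_integrable[OF u], of "-1" 0]
      lborel_integral_affine[of "-1" "\<lambda>x. (norm (u x))\<^sup>2" 0]
    by (simp_all add: L2_def L2norm_def)
qed

lemma has_fourier_L2_reflect:
  assumes h: "has_fourier_L2 f F"
  shows "has_fourier_L2 (\<lambda>x. f (- x)) (\<lambda>x. F (- x))"
proof -
  note D = has_fourier_L2D[OF h]
  have t: "trunc R (\<lambda>x. f (- x)) = (\<lambda>x. trunc R f (- x))" for R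
    by (auto simp: trunc_def indicator_def)
  have "L2norm (\<lambda>\<xi>. F (- \<xi>) - fourier (trunc R (\<lambda>x. f (- x))) \<xi>) = L2norm (\<lambda>\<xi>. F \<xi> - fourier (trunc R f) \<xi>)" for R
    using L2_reflect(2)[OF L2_diff(1)[OF D(2) fourier_trunc_L2[OF D(1)], of R]]
    by (simp add: t fourier_reflect trunc_L2[OF D(1)] L2_measurable)
  then show ?thesis using h L2_reflect(1)[OF D(1)] L2_reflect(1)[OF D(2)] by (simp add: has_fourier_L2_trunc)
qed

section \<open>Inversion and Plancherel's theorem\<close>

lemma bounded_integrable_L2:
  fixes h :: "real^'n \<Rightarrow> complex"
  assumes "integrable lborel h" "\<And>x. norm (h x) \<le> B"
  shows "h \<in> L2"
proof -
  have [measurable]: "h \<in> borel_measurable lborel" using assms by simp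
  have "integrable lborel (\<lambda>x. B * norm (h x))" using assms by simp
  then have "integrable lborel (\<lambda>x. (norm (h x))\<^sup>2)"
  proof (rule Bochner_Integration.integrable_bound)
    show "AE x in lborel. norm ((norm (h x))\<^sup>2) \<le> norm (B * norm (h x))"
    proof (rule AE_I2)
      fix x
      have "norm (h x) * norm (h x) \<le> B * norm (h x)" using assms(2) by (intro mult_right_mono) auto
      then show "norm ((norm (h x))\<^sup>2) \<le> norm (B * norm (h x))" by (simp add: power2_eq_square)
    qed
  qed measurable
  then show ?thesis by (simp add: L2_def)
qed

text \<open>Measurable functions are almost everywhere limits of continuous ones, so that \<open>w\<close> may be
  tested against bounded continuous functions converging to \<open>cnj w / (1 + norm w)\<close>.\<close>

lemma L2_weak_zero:
  fixes w :: "real^'n \<Rightarrow> complex"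
  assumes w: "w \<in> L2"
    and z: "\<And>h B. continuous_on UNIV h \<Longrightarrow> integrable lborel h \<Longrightarrow> (\<And>x. norm (h x) \<le> B) \<Longrightarrow>
       (LINT x|lborel. w x * h x) = 0"
  shows "AE x in lborel. w x = 0"
proof -
  note [measurable] = L2_measurable[OF w]
  have "w measurable_on UNIV"
    by (rule lebesgue_measurable_imp_measurable_on) (auto intro: measurable_completion)
  then obtain N c where N: "negligible N" and c: "\<And>n. continuous_on UNIV (c n)"
    and lim: "\<And>x. x \<notin> N \<Longrightarrow> (\<lambda>n::nat. c n x) \<longlonglongrightarrow> w x"
    unfolding measurable_on_def by auto
  have "N \<in> null_sets lebesgue" using N by (simp add: negligible_iff_null_sets)
  then have "AE x in lebesgue. x \<notin> N" by (rule AE_not_in)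
  then have AEN: "AE x in lborel. x \<notin> N" by (simp add: AE_completion_iff)
  \<comment> \<open>The Gaussian factor makes the test functions integrable and supplies the
    dominating function \<open>norm (w x) * gauss x\<close>.\<close>
  define h where "h n x = cnj (c n x) / of_real (1 + norm (c n x)) * of_real (gauss x)" for n x
  have pos: "complex_of_real (1 + norm z) \<noteq> 0" for z :: complex
    unfolding of_real_eq_0_iff using norm_ge_zero[of z] by linarith
  have hc: "continuous_on UNIV (h n)" for n
    unfolding h_def gauss_def using pos by (intro continuous_intros c) auto
  then have [measurable]: "h n \<in> borel_measurable borel" for n by (rule borel_measurable_continuous_onI)
  have hb: "norm (h n x) \<le> gauss x" for n x
  proof -
    have "0 < 1 + norm (c n x)" by (simp add: add_pos_nonneg)
    then have "norm (cnj (c n x) / of_real (1 + norm (c n x))) \<le> 1"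
      unfolding norm_divide norm_of_real by (simp add: divide_le_eq)
    then have "norm (cnj (c n x) / of_real (1 + norm (c n x))) * gauss x \<le> 1 * gauss x"
      by (intro mult_right_mono) (auto simp: gauss_def)
    moreover have "norm (h n x) = norm (cnj (c n x) / of_real (1 + norm (c n x))) * gauss x"
      unfolding h_def norm_mult norm_of_real by (simp add: gauss_bounds(1) less_imp_le)
    ultimately show ?thesis by linarith
  qed
  have hi: "integrable lborel (h n)" for n
    by (rule Bochner_Integration.integrable_bound[OF gauss_integrable])
       (use hb in \<open>auto simp: gauss_bounds(1) less_imp_le\<close>)
  have z': "(LINT x|lborel. w x * h n x) = 0" for n
    by (rule z[OF hc hi order_trans[OF hb gauss_bounds(2)]])
  have gL: "(\<lambda>x::real^'n. complex_of_real (gauss x)) \<in> L2"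
    using gauss_integrable
    by (intro bounded_integrable_L2[where B=1]) (auto simp: complex_of_real_integrable_eq gauss_bounds less_imp_le)
  have gi: "integrable lborel (\<lambda>x. norm (w x) * gauss x)"
    using L2_Cauchy_Schwarz(3)[OF w gL] by (simp add: gauss_bounds less_imp_le)
  let ?v = "\<lambda>x. (norm (w x))\<^sup>2 / (1 + norm (w x)) * gauss x"
  have vi: "integrable lborel ?v"
  proof (rule Bochner_Integration.integrable_bound[OF gi])
    show "AE x in lborel. norm (?v x) \<le> norm (norm (w x) * gauss x)"
    proof (rule AE_I2)
      fix x
      have "0 < 1 + norm (w x)" by (simp add: add_pos_nonneg)
      then have "(norm (w x))\<^sup>2 / (1 + norm (w x)) \<le> norm (w x)"
        by (simp add: divide_le_eq power2_eq_square distrib_left)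
      then have "?v x \<le> norm (w x) * gauss x"
        by (rule mult_right_mono) (simp add: gauss_bounds less_imp_le)
      moreover have "0 \<le> ?v x" by (simp add: gauss_bounds less_imp_le)
      ultimately show "norm (?v x) \<le> norm (norm (w x) * gauss x)"
        unfolding real_norm_def by linarith
    qed
  qed measurable
  have "(\<lambda>n. LINT x|lborel. w x * h n x) \<longlonglongrightarrow> (LINT x|lborel. complex_of_real (?v x))"
  proof (rule integral_dominated_convergence[OF _ _ gi])
    show "AE x in lborel. (\<lambda>n. w x * h n x) \<longlonglongrightarrow> complex_of_real (?v x)"
      using AEN
    proof eventually_elim
      case (elim x)
      have "(\<lambda>n. w x * h n x) \<longlonglongrightarrow> w x * (cnj (w x) / of_real (1 + norm (w x)) * of_real (gauss x))"
        unfolding h_def using pos by (intro tendsto_intros lim[OF elim]) auto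
      also have "w x * (cnj (w x) / of_real (1 + norm (w x)) * of_real (gauss x)) = complex_of_real (?v x)"
        by (simp add: complex_norm_square del: of_real_power of_real_add)
      finally show ?case .
    qed
    show "AE x in lborel. norm (w x * h n x) \<le> norm (w x) * gauss x" for n
      by (auto simp: norm_mult intro!: mult_left_mono hb)
  qed measurable
  then have "(LINT x|lborel. complex_of_real (?v x)) = 0"
    unfolding z' using LIMSEQ_unique tendsto_const by blast
  then have "(LINT x|lborel. ?v x) = 0" unfolding integral_complex_of_real by simp
  then have "AE x in lborel. ?v x = 0"
    by (subst (asm) integral_nonneg_eq_0_iff_AE[OF vi]) (auto simp: gauss_bounds less_imp_le)
  then show ?thesis
  proof eventually_elim
    case (elim x)
    have "1 + norm (w x) \<noteq> 0" "gauss x \<noteq> 0"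
      using gauss_bounds(1)[of x] norm_ge_zero[of "w x"] by linarith+
    with elim show ?case by simp
  qed
qed

text \<open>The substitution y -> x - \<epsilon> y moves \<epsilon> into the argument of h. The
  weight is then a fixed probability density, and continuity and boundedness of h give dominated
  convergence.\<close>

lemma mollify_gauss_tendsto:
  fixes h :: "real^'n \<Rightarrow> complex"
  assumes h: "continuous_on UNIV h" "\<And>x. norm (h x) \<le> B"
  shows "(\<lambda>n. mollify gauss (inverse (real (Suc n))) h x) \<longlonglongrightarrow> h x"
proof -
  have [measurable]: "h \<in> borel_measurable borel" using h(1) by (rule borel_measurable_continuous_onI)
  have [measurable]: "dilate gauss \<epsilon> \<in> borel_measurable borel" for \<epsilon> unfolding dilate_def by measurable
  have eq: "mollify gauss \<epsilon> h x = (LINT y|lborel. gauss y *\<^sub>R h (x - \<epsilon> *\<^sub>R y))" if "\<epsilon> > 0" for \<epsilon>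
  proof -
    have "mollify gauss \<epsilon> h x = \<epsilon> ^ CARD('n) *\<^sub>R (LINT y|lborel. dilate gauss \<epsilon> (\<epsilon> *\<^sub>R y) *\<^sub>R h (x - \<epsilon> *\<^sub>R y))"
      using lborel_integral_affine[of "- \<epsilon>" "\<lambda>y. dilate gauss \<epsilon> (x - y) *\<^sub>R h y" x] that
      by (simp add: mollify_def)
    also have "\<dots> = (LINT y|lborel. gauss y *\<^sub>R h (x - \<epsilon> *\<^sub>R y))"
      using that unfolding integral_scaleR_right[symmetric] by (simp add: dilate_def)
    finally show ?thesis .
  qed
  have "(\<lambda>n. LINT y|lborel. gauss y *\<^sub>R h (x - inverse (real (Suc n)) *\<^sub>R y)) \<longlonglongrightarrow> (LINT y::real^'n|lborel. gauss y *\<^sub>R h x)"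
  proof (rule integral_dominated_convergence)
    show "integrable lborel (\<lambda>y::real^'n. gauss y * B)" by (intro integrable_mult_left gauss_integrable)
    show "AE y in lborel. (\<lambda>n. gauss y *\<^sub>R h (x - inverse (real (Suc n)) *\<^sub>R y)) \<longlonglongrightarrow> gauss y *\<^sub>R h x"
    proof (rule AE_I2)
      fix y
      have "(\<lambda>n. x - inverse (real (Suc n)) *\<^sub>R y) \<longlonglongrightarrow> x - 0 *\<^sub>R y"
        by (intro tendsto_intros LIMSEQ_inverse_real_of_nat)
      then have "(\<lambda>n. h (x - inverse (real (Suc n)) *\<^sub>R y)) \<longlonglongrightarrow> h x"
        using h(1) by (intro continuous_on_tendsto_compose[OF h(1)]) auto
      then show "(\<lambda>n. gauss y *\<^sub>R h (x - inverse (real (Suc n)) *\<^sub>R y)) \<longlonglongrightarrow> gauss y *\<^sub>R h x"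
        by (intro tendsto_intros)
    qed
    show "AE y in lborel. norm (gauss y *\<^sub>R h (x - inverse (real (Suc n)) *\<^sub>R y)) \<le> gauss y * B" for n
      by (auto simp: gauss_bounds less_imp_le intro!: mult_left_mono h)
  qed measurable
  also have "(LINT y::real^'n|lborel. gauss y *\<^sub>R h x) = h x"
    by (simp add: gauss_integral gauss_integrable)
  finally show ?thesis by (simp add: eq)
qed

lemma L2_integral_mult_tendsto:
  assumes "\<And>i. s i \<in> L2" "f \<in> L2" "h \<in> L2" "((\<lambda>i. L2norm (\<lambda>x. s i x - f x)) \<longlongrightarrow> 0) F"
  shows "((\<lambda>i. LINT x|lborel. s i x * h x) \<longlongrightarrow> (LINT x|lborel. f x * h x)) F"
proof -
  have "((\<lambda>i. (LINT x|lborel. s i x * h x) - (LINT x|lborel. f x * h x)) \<longlongrightarrow> 0) F"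
  proof (rule Lim_null_comparison)
    show "\<forall>\<^sub>F i in F. norm ((LINT x|lborel. s i x * h x) - (LINT x|lborel. f x * h x))
        \<le> L2norm (\<lambda>x. s i x - f x) * L2norm h"
    proof (rule always_eventually, rule)
      fix i
      have "(LINT x|lborel. s i x * h x) - (LINT x|lborel. f x * h x) = (LINT x|lborel. (s i x - f x) * h x)"
        by (simp add: left_diff_distrib L2_Cauchy_Schwarz assms)
      then show "norm ((LINT x|lborel. s i x * h x) - (LINT x|lborel. f x * h x))
        \<le> L2norm (\<lambda>x. s i x - f x) * L2norm h"
        using L2_Cauchy_Schwarz(4)[OF L2_diff(1)[OF assms(1,2)] assms(3)] by simp
    qed
    show "((\<lambda>i. L2norm (\<lambda>x. s i x - f x) * L2norm h) \<longlongrightarrow> 0) F"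
      using tendsto_mult_right[OF assms(4), of "L2norm h"] by (simp add: mult.commute)
  qed
  then show ?thesis by (simp add: LIM_zero_iff)
qed

text \<open>\<open>fourier f\<close> may fail to be integrable, so it is damped by Gaussians
  \<open>s n\<close> that converge to it in L2. Paired with a test function h, the transform of
  \<open>s n\<close> becomes a pairing of f with a reflected mollification of h, which tends to the
  pairing of f(- x) with h.\<close>

lemma fourier_inversion_L1:
  fixes f :: "real^'n \<Rightarrow> complex"
  assumes f: "integrable lborel f" "f \<in> L2" and K: "has_fourier_L2 (fourier f) K"
  shows "AE x in lborel. K x = f (- x)"
proof -
  note KL = has_fourier_L2D(2)[OF K]
  note fr = L2_reflect(1)[OF f(2)]
  note [measurable] = L2_measurable[OF f(2)] L2_measurable[OF KL]
  let ?\<epsilon> = "\<lambda>n. inverse (real (Suc n))"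
  define s where "s n \<xi> = complex_of_real (gauss (?\<epsilon> n *\<^sub>R \<xi>)) * fourier f \<xi>" for n \<xi>
  have [measurable]: "s n \<in> borel_measurable borel" for n unfolding s_def by measurable
  have si: "integrable lborel (s n)" for n
    unfolding s_def by (rule bounded_gauss_integrable[OF _ fourier_norm_le]) auto
  have sL: "s n \<in> L2" and slim: "(\<lambda>n. L2norm (\<lambda>x. s n x - fourier f x)) \<longlonglongrightarrow> 0" for n
  proof -
    have 1: "AE x in lborel. (\<lambda>n. s n x) \<longlonglongrightarrow> fourier f x"
    proof (rule AE_I2)
      fix x
      have "(\<lambda>n. s n x) \<longlonglongrightarrow> complex_of_real (exp (- pi * (norm (0 *\<^sub>R x))\<^sup>2)) * fourier f x"
        unfolding s_def gauss_def by (intro tendsto_intros LIMSEQ_inverse_real_of_nat)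
      then show "(\<lambda>n. s n x) \<longlonglongrightarrow> fourier f x" by simp
    qed
    have 2: "AE x in lborel. norm (s n x) \<le> norm (fourier f x)" for n
      by (auto simp: s_def norm_mult gauss_bounds less_imp_le intro!: mult_left_le_one_le)
    show "s n \<in> L2" "(\<lambda>n. L2norm (\<lambda>x. s n x - fourier f x)) \<longlonglongrightarrow> 0"
      by (rule L2_dominated_convergence[OF _ _ fourier_Bessel(1)[OF f] 1 2]; measurable)+
  qed
  have Slim: "(\<lambda>n. L2norm (\<lambda>x. fourier (s n) x - K x)) \<longlonglongrightarrow> 0"
    by (rule has_fourier_L2_tendsto[OF has_fourier_L2_fourier[OF si sL] K slim])
  have "AE x in lborel. K x - f (- x) = 0"
  proof (rule L2_weak_zero[OF L2_diff(1)[OF KL fr]])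
    fix h :: "real^'n \<Rightarrow> complex" and B
    assume h: "continuous_on UNIV h" "integrable lborel h" "\<And>x. norm (h x) \<le> B"
    note hL = bounded_integrable_L2[OF h(2,3)]
    have [measurable]: "h \<in> borel_measurable borel" using h(1) by (rule borel_measurable_continuous_onI)
    have 1: "(\<lambda>n. LINT x|lborel. fourier (s n) x * h x) \<longlonglongrightarrow> (LINT x|lborel. K x * h x)"
      by (rule L2_integral_mult_tendsto[OF fourier_Bessel(1)[OF si sL] KL hL Slim])
    \<comment> \<open>The multiplication formula is used twice: the outer transform moves onto h,
      and then the inner one onto the damped transform of h, where \<open>gauss_inversion\<close>
      evaluates it.\<close>
    have 2: "(LINT x|lborel. fourier (s n) x * h x) = (LINT x|lborel. f x * mollify gauss (?\<epsilon> n) h (- x))" for n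
    proof -
      have i: "integrable lborel (\<lambda>\<xi>. complex_of_real (gauss (?\<epsilon> n *\<^sub>R \<xi>)) * fourier h \<xi>)"
        by (rule bounded_gauss_integrable[OF _ fourier_norm_le]) auto
      have "(LINT x|lborel. fourier (s n) x * h x) = (LINT x|lborel. s n x * fourier h x)"
        by (rule fourier_multiplication[OF si h(2)])
      also have "\<dots> = (LINT x|lborel. fourier f x * (complex_of_real (gauss (?\<epsilon> n *\<^sub>R x)) * fourier h x))"
        by (simp add: s_def mult_ac)
      also have "\<dots> = (LINT x|lborel. f x * fourier (\<lambda>\<xi>. complex_of_real (gauss (?\<epsilon> n *\<^sub>R \<xi>)) * fourier h \<xi>) x)"
        by (rule fourier_multiplication[OF f(1) i])
      also have "\<dots> = (LINT x|lborel. f x * mollify gauss (?\<epsilon> n) h (- x))"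
        using gauss_inversion[OF h(2), of "?\<epsilon> n" "- x" for x] by simp
      finally show ?thesis .
    qed
    have [measurable]: "mollify gauss \<epsilon> h \<in> borel_measurable borel" for \<epsilon>
      unfolding mollify_eq_conv by (rule conv_measurable) (simp_all add: dilate_def[abs_def])
    \<comment> \<open>The dilated Gaussian is a probability density, so mollification preserves the
      bound of h.\<close>
    have mb: "norm (mollify gauss (?\<epsilon> n) h x) \<le> B" for n x
    proof -
      have di: "integrable lborel (dilate (gauss :: real^'n \<Rightarrow> real) (?\<epsilon> n))"
        by (intro dilate_integrable gauss_integrable) auto
      have d0: "0 \<le> dilate gauss (?\<epsilon> n) y" for y :: "real^'n" by (simp add: dilate_def gauss_def)
      have d1: "(LINT y|lborel. dilate gauss (?\<epsilon> n) (x - y)) = 1"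
      proof -
        have "(LINT y|lborel. dilate gauss (?\<epsilon> n) (x - y)) = (LINT y|lborel. dilate (gauss :: real^'n \<Rightarrow> real) (?\<epsilon> n) y)"
          using lborel_integral_affine[of "-1" "dilate (gauss :: real^'n \<Rightarrow> real) (?\<epsilon> n)" x] di by simp
        also have "\<dots> = 1"
          using integral_dilate_norm[of "gauss :: real^'n \<Rightarrow> real" "?\<epsilon> n"] d0 gauss_integral
          by (simp add: gauss_bounds less_imp_le)
        finally show ?thesis .
      qed
      have di': "integrable lborel (\<lambda>y. dilate gauss (?\<epsilon> n) (x - y))"
        using lborel_integrable_affine[OF _ di, of "-1" x] by simp
      have "norm (mollify gauss (?\<epsilon> n) h x) \<le> (LINT y|lborel. dilate gauss (?\<epsilon> n) (x - y) * B)"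
        unfolding mollify_def
      proof (rule Bochner_Integration.integral_norm_bound_integral)
        show "integrable lborel (\<lambda>y. dilate gauss (?\<epsilon> n) (x - y) *\<^sub>R h y)"
          by (rule Bochner_Integration.integrable_bound[OF integrable_mult_left[OF di', of B]])
             (use h(3) d0 di' in \<open>auto simp: abs_mult intro!: AE_I2 mult_left_mono order_trans[OF h(3)]\<close>)
      qed (use h(3) d0 di' in \<open>auto intro: mult_left_mono\<close>)
      then show ?thesis using di' d1 by simp
    qed
    have 3: "(\<lambda>n. LINT x|lborel. f x * mollify gauss (?\<epsilon> n) h (- x)) \<longlonglongrightarrow> (LINT x|lborel. f x * h (- x))"
    proof (rule integral_dominated_convergence)
      show "integrable lborel (\<lambda>x. norm (f x) * B)" using f(1) by simp
      show "AE x in lborel. norm (f x * mollify gauss (?\<epsilon> n) h (- x)) \<le> norm (f x) * B" for n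
        by (intro AE_I2) (auto simp: norm_mult simp del: of_nat_Suc intro!: mult_left_mono mb)
      show "AE x in lborel. (\<lambda>n. f x * mollify gauss (?\<epsilon> n) h (- x)) \<longlonglongrightarrow> f x * h (- x)"
        by (intro AE_I2 tendsto_mult tendsto_const mollify_gauss_tendsto[OF h(1,3)])
    qed measurable
    have "(LINT x|lborel. K x * h x) = (LINT x|lborel. f x * h (- x))"
      using 1 3 unfolding 2 by (rule LIMSEQ_unique)
    also have "\<dots> = (LINT x|lborel. f (- x) * h x)"
      using lborel_integral_affine[of "-1" "\<lambda>x. f x * h (- x)" 0] by simp
    finally show "(LINT x|lborel. (K x - f (- x)) * h x) = 0"
      by (simp add: left_diff_distrib L2_Cauchy_Schwarz(1)[OF KL hL] L2_Cauchy_Schwarz(1)[OF fr hL])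
  qed
  then show ?thesis by simp
qed

text \<open>Truncations satisfy the claim by the integrable case, and both sides depend continuously
  on f in the square norm.\<close>

lemma fourier_inversion:
  assumes F: "has_fourier_L2 f F" and K: "has_fourier_L2 F K"
  shows "AE x in lborel. K x = f (- x)"
proof -
  note f = has_fourier_L2D(1)[OF F]
  obtain S where S: "\<And>R. has_fourier_L2 (fourier (trunc R f)) (S R)"
    using has_fourier_L2_exists[OF fourier_trunc_L2[OF f]] by metis
  have ae: "AE x in lborel. S R x = trunc R f (- x)" for R
    by (rule fourier_inversion_L1[OF trunc_integrable[OF f] trunc_L2[OF f] S])
  have SL: "\<And>R. S R \<in> L2" using S by (rule has_fourier_L2D)
  have "((\<lambda>R. L2norm (\<lambda>x. fourier (trunc R f) x - F x)) \<longlongrightarrow> 0) at_top"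
    using F by (simp add: has_fourier_L2_trunc L2norm_minus_commute)
  from has_fourier_L2_tendsto[OF S K this]
  have lim: "((\<lambda>R. L2norm (\<lambda>x. K x - S R x)) \<longlongrightarrow> 0) at_top" by (simp add: L2norm_minus_commute)
  have "L2norm (\<lambda>x. f (- x) - S R x) = L2norm (\<lambda>x. f x - trunc R f x)" for R
  proof -
    have "L2norm (\<lambda>x. f (- x) - S R x) = L2norm (\<lambda>x. f (- x) - trunc R f (- x))"
      using ae[of R]
      by (intro L2norm_cong_AE L2_measurable(1)[OF L2_diff(1)[OF L2_reflect(1)[OF f] SL]]
          L2_measurable(1)[OF L2_diff(1)[OF L2_reflect(1)[OF f] L2_reflect(1)[OF trunc_L2[OF f]]]]) auto
    also have "\<dots> = L2norm (\<lambda>x. f x - trunc R f x)"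
      by (rule L2_reflect(2)[OF L2_diff(1)[OF f trunc_L2[OF f]]])
    finally show ?thesis .
  qed
  then have "((\<lambda>R. L2norm (\<lambda>x. f (- x) - S R x)) \<longlongrightarrow> 0) at_top"
    using trunc_tendsto[OF f] by simp
  then show ?thesis
    by (rule L2_unique_limit[OF trivial_limit_at_top_linorder has_fourier_L2D(2)[OF K] L2_reflect(1)[OF f] SL lim])
qed

text \<open>Bessel's inequality is applied a second time, to the double transform: by inversion this
  is the reflection of f and so has the norm of f.\<close>

lemma has_fourier_L2_Plancherel:
  assumes F: "has_fourier_L2 f F" shows "L2norm F = L2norm f"
proof (rule antisym[OF has_fourier_L2_Bessel[OF F]])
  note f = has_fourier_L2D(1)[OF F]
  obtain K where K: "has_fourier_L2 F K" using has_fourier_L2_exists has_fourier_L2D(2)[OF F] by blast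
  have "L2norm f = L2norm (\<lambda>x. f (- x))" by (rule L2_reflect(2)[OF f, symmetric])
  also have "\<dots> = L2norm K"
    using fourier_inversion[OF F K]
    by (intro L2norm_cong_AE L2_measurable(1)[OF L2_reflect(1)[OF f]] L2_measurable(1)[OF has_fourier_L2D(2)[OF K]]) auto
  also have "\<dots> \<le> L2norm F" by (rule has_fourier_L2_Bessel[OF K])
  finally show "L2norm f \<le> L2norm F" .
qed

text \<open>The preimage is the reflected transform of G: transforming G twice reflects it, and one
  further reflection undoes this.\<close>

lemma has_fourier_L2_surj:
  assumes G: "G \<in> L2" shows "\<exists>f. has_fourier_L2 f G"
proof -
  obtain H where H: "has_fourier_L2 G H" using has_fourier_L2_exists[OF G] by blast
  obtain K where K: "has_fourier_L2 H K" using has_fourier_L2_exists has_fourier_L2D(2)[OF H] by blast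
  note refl = has_fourier_L2_reflect[OF K]
  have "AE x in lborel. K x = G (- x)" by (rule fourier_inversion[OF H K])
  then have "L2norm (\<lambda>x. K x - G (- x)) = 0"
    by (rule L2norm_diff_AE_eq[OF has_fourier_L2D(2)[OF K] L2_reflect(1)[OF G]])
  then have "L2norm (\<lambda>x. K (- x) - G x) = 0"
    using L2_reflect(2)[OF L2_diff(1)[OF has_fourier_L2D(2)[OF K] L2_reflect(1)[OF G]]] by simp
  then have "AE x in lborel. K (- x) = G x"
    using has_fourier_L2D(2)[OF refl] G by (intro L2_AE_eqI)
  then have "has_fourier_L2 (\<lambda>x. H (- x)) G"
    using has_fourier_L2D[OF refl] G by (intro has_fourier_L2_cong_AE[OF refl]) (auto intro: L2_measurable)
  then show ?thesis by blast
qed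

section \<open>Multipliers and mollification on the Fourier side\<close>

lemma fourier_L2: "f \<in> L2 \<Longrightarrow> has_fourier_L2 f (fourier_L2 f)"
  unfolding fourier_L2_def using someI_ex[OF has_fourier_L2_exists] .

lemma inv_fourier_L2: "F \<in> L2 \<Longrightarrow> has_fourier_L2 (inv_fourier_L2 F) F"
  unfolding inv_fourier_L2_def using someI_ex[OF has_fourier_L2_surj] .

text \<open>Stated for an arbitrary transform \<open>F\<close> of f rather than for
  \<open>fourier_L2 f\<close>, so that multipliers can be composed through explicit formulas.
  Boundedness of the symbol keeps the product in L2, where the inverse transform exists.\<close>

lemma fourier_multiplier:
  assumes f: "has_fourier_L2 f F" and [measurable]: "m \<in> borel_measurable borel"
    and b: "\<And>\<xi>. \<bar>m \<xi>\<bar> \<le> B"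
  shows "has_fourier_L2 (fourier_multiplier m f) (\<lambda>\<xi>. complex_of_real (m \<xi>) * F \<xi>)"
proof -
  note fL = has_fourier_L2D(1)[OF f]
  have mF: "(\<lambda>\<xi>. complex_of_real (m \<xi>) * F \<xi>) \<in> L2"
    by (rule L2_mult_bounded[OF has_fourier_L2D(2)[OF f], where B=B]) (auto simp: b)
  have mF': "(\<lambda>\<xi>. complex_of_real (m \<xi>) * fourier_L2 f \<xi>) \<in> L2"
    by (rule L2_mult_bounded[OF has_fourier_L2D(2)[OF fourier_L2[OF fL]], where B=B]) (auto simp: b)
  note h = inv_fourier_L2[OF mF']
  have "AE x in lborel. fourier_L2 f x = F x"
    by (rule has_fourier_L2_unique_AE[OF fourier_L2[OF fL] f]) simp
  then have "AE \<xi> in lborel. complex_of_real (m \<xi>) * fourier_L2 f \<xi> = complex_of_real (m \<xi>) * F \<xi>"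
    by eventually_elim simp
  then show ?thesis unfolding fourier_multiplier_def
    by (intro has_fourier_L2_cong_AE[OF h]) (auto intro: L2_measurable mF has_fourier_L2D(1)[OF h])
qed

lemma norm_fourier_real_le:
  fixes \<phi> :: "real^'n \<Rightarrow> real"
  assumes "integrable lborel \<phi>"
  shows "norm (fourier_real \<phi> \<xi>) \<le> (LINT x|lborel. \<bar>\<phi> x\<bar>)"
  using fourier_norm_le[of "\<lambda>x. complex_of_real (\<phi> x)" \<xi>] by simp

text \<open>The convolution theorem for integrable functions covers the truncations of u. Young's
  inequality on one side and the bounded symbol on the other carry it to the limit.\<close>

lemma has_fourier_L2_mollify:
  fixes \<phi> :: "real^'n \<Rightarrow> real"
  assumes \<phi>: "integrable lborel \<phi>" and \<beta>: "\<beta> > 0" and u: "has_fourier_L2 u U"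
  shows "has_fourier_L2 (mollify \<phi> \<beta> u) (\<lambda>\<xi>. fourier_real \<phi> (\<beta> *\<^sub>R \<xi>) * U \<xi>)"
proof -
  note uL = has_fourier_L2D(1)[OF u] and UL = has_fourier_L2D(2)[OF u]
  have [measurable]: "\<phi> \<in> borel_measurable borel" using \<phi> by simp
  define k where "k = dilate \<phi> \<beta>"
  have k: "integrable lborel k" unfolding k_def by (rule dilate_integrable[OF \<phi> \<beta>])
  have [measurable]: "k \<in> borel_measurable borel" using k by simp
  let ?J = "LINT x|lborel. \<bar>k x\<bar>"
  have fk: "fourier_real k \<xi> = fourier_real \<phi> (\<beta> *\<^sub>R \<xi>)" for \<xi>
    unfolding k_def by (rule fourier_dilate[OF _ \<beta>]) simp
  have mb: "(\<lambda>\<xi>. fourier_real k \<xi> * W \<xi>) \<in> L2 \<and> L2norm (\<lambda>\<xi>. fourier_real k \<xi> * W \<xi>) \<le> ?J * L2norm W"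
    if "W \<in> L2" for W
    using L2_mult_bounded[OF that _ norm_fourier_real_le[OF k]] by simp
  have kuL: "conv k u \<in> L2" by (rule conv_L2[OF k uL])
  have hR: "has_fourier_L2 (conv k (trunc R u)) (\<lambda>\<xi>. fourier_real k \<xi> * fourier (trunc R u) \<xi>)" for R
    using has_fourier_L2_fourier[OF conv_integrable[OF k trunc_integrable[OF uL]] conv_L2[OF k trunc_L2[OF uL]], of R]
    by (simp add: fourier_conv[OF k trunc_integrable[OF uL], abs_def])
  obtain F where F: "has_fourier_L2 (conv k u) F" using has_fourier_L2_exists[OF kuL] by blast
  have "((\<lambda>R. L2norm (\<lambda>x. conv k (trunc R u) x - conv k u x)) \<longlongrightarrow> 0) at_top"
  proof (rule Lim_null_comparison)
    show "((\<lambda>R. ?J * L2norm (\<lambda>x. u x - trunc R u x)) \<longlongrightarrow> 0) at_top"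
      using tendsto_mult_right[OF trunc_tendsto[OF uL], of ?J] by (simp add: mult.commute)
    show "\<forall>\<^sub>F R in at_top. norm (L2norm (\<lambda>x. conv k (trunc R u) x - conv k u x)) \<le> ?J * L2norm (\<lambda>x. u x - trunc R u x)"
    proof (rule always_eventually, rule)
      fix R
      have d: "(\<lambda>x. u x - trunc R u x) \<in> L2" by (intro L2_diff uL trunc_L2)
      have "L2norm (\<lambda>x. conv k (trunc R u) x - conv k u x) = L2norm (\<lambda>x. conv k u x - conv k (trunc R u) x)"
        by (rule L2norm_minus_commute)
      also have "\<dots> = L2norm (conv k (\<lambda>x. u x - trunc R u x))"
        using conv_diff[OF k uL trunc_L2[OF uL], of R]
        by (intro L2norm_cong_AE L2_measurable conv_L2[OF k d] L2_diff kuL conv_L2[OF k trunc_L2[OF uL]]) auto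
      also have "\<dots> \<le> ?J * L2norm (\<lambda>x. u x - trunc R u x)" by (rule conv_norm[OF k d])
      finally show "norm (L2norm (\<lambda>x. conv k (trunc R u) x - conv k u x)) \<le> ?J * L2norm (\<lambda>x. u x - trunc R u x)"
        by simp
    qed
  qed
  from has_fourier_L2_tendsto[OF hR F this]
  have 1: "((\<lambda>R. L2norm (\<lambda>\<xi>. F \<xi> - fourier_real k \<xi> * fourier (trunc R u) \<xi>)) \<longlongrightarrow> 0) at_top"
    by (simp add: L2norm_minus_commute)
  have 2: "((\<lambda>R. L2norm (\<lambda>\<xi>. fourier_real k \<xi> * U \<xi> - fourier_real k \<xi> * fourier (trunc R u) \<xi>)) \<longlongrightarrow> 0) at_top"
  proof (rule Lim_null_comparison)
    show "((\<lambda>R. ?J * L2norm (\<lambda>\<xi>. U \<xi> - fourier (trunc R u) \<xi>)) \<longlongrightarrow> 0) at_top"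
      using tendsto_mult_right[of "\<lambda>R. L2norm (\<lambda>\<xi>. U \<xi> - fourier (trunc R u) \<xi>)" 0 at_top ?J] u
      by (simp add: has_fourier_L2_trunc mult.commute)
    show "\<forall>\<^sub>F R in at_top. norm (L2norm (\<lambda>\<xi>. fourier_real k \<xi> * U \<xi> - fourier_real k \<xi> * fourier (trunc R u) \<xi>))
        \<le> ?J * L2norm (\<lambda>\<xi>. U \<xi> - fourier (trunc R u) \<xi>)"
      using mb[OF L2_diff(1)[OF UL fourier_trunc_L2[OF uL]]] by (simp add: right_diff_distrib)
  qed
  have "AE \<xi> in lborel. F \<xi> = fourier_real k \<xi> * U \<xi>"
    using mb[OF UL] mb[OF fourier_trunc_L2[OF uL]]
    by (intro L2_unique_limit[OF trivial_limit_at_top_linorder has_fourier_L2D(2)[OF F] _ _ 1 2]) auto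
  then have "has_fourier_L2 (conv k u) (\<lambda>\<xi>. fourier_real k \<xi> * U \<xi>)"
    using mb[OF UL] by (intro has_fourier_L2_cong_AE[OF F]) (auto intro: L2_measurable kuL)
  then show ?thesis by (simp add: mollify_eq_conv k_def[symmetric] fk)
qed

section \<open>Decay of the Fourier transform along rays\<close>

text \<open>Riemann-Lebesgue in the weak form that suffices when limits along rays are known to
  exist. Tested against a modulated Gaussian, the transform at n \<xi> becomes the integral of
  \<phi>(y) times a Gaussian at n y + x, which tends to 0. Hence the Fourier transform of the limit
  times a Gaussian vanishes identically, and Plancherel applies.\<close>

lemma fourier_ray_limit_zero:
  fixes \<phi> :: "real^'n \<Rightarrow> real"
  assumes \<phi>: "integrable lborel \<phi>"
    and L: "\<And>\<xi>. (\<lambda>n. fourier_real \<phi> (real (Suc n) *\<^sub>R \<xi>)) \<longlonglongrightarrow> L \<xi>"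
  shows "AE \<xi> in lborel. L \<xi> = 0"
proof -
  have [measurable]: "\<phi> \<in> borel_measurable borel" using \<phi> by simp
  let ?\<Phi> = "fourier_real \<phi>"
  let ?b = "\<lambda>n. real (Suc n)"
  let ?J = "LINT x|lborel. \<bar>\<phi> x\<bar>"
  have [measurable]: "L \<in> borel_measurable borel"
    by (rule borel_measurable_LIMSEQ_metric[OF _ L]) measurable
  have \<Phi>b: "norm (?\<Phi> \<xi>) \<le> ?J" for \<xi> by (rule norm_fourier_real_le[OF \<phi>])
  have Lb: "norm (L \<xi>) \<le> ?J" for \<xi>
    by (rule LIMSEQ_le_const2[OF tendsto_norm[OF L]]) (use \<Phi>b in blast)
  \<comment> \<open>The limit is only bounded; the Gaussian factor puts it into both L1 and
    L2.\<close>
  let ?w = "\<lambda>\<xi>. complex_of_real (gauss \<xi>) * L \<xi>"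
  have wi: "integrable lborel ?w"
    using bounded_gauss_integrable[of L ?J 1] Lb by simp
  have "norm (?w \<xi>) \<le> ?J" for \<xi>
    unfolding norm_mult using Lb[of \<xi>]
    by (simp add: gauss_bounds less_imp_le mult_le_one) (meson gauss_bounds less_imp_le mult_left_le_one_le norm_ge_zero order_trans)
  then have wL: "?w \<in> L2" by (rule bounded_integrable_L2[OF wi])
  have "fourier ?w x = 0" for x
  proof -
    have hi: "integrable lborel (\<lambda>\<xi>. cis (- 2 * pi * (x \<bullet> \<xi>)) * complex_of_real (gauss \<xi>))" for x :: "real^'n"
      using fourier_integrable[of "\<lambda>\<xi>. complex_of_real (gauss \<xi>)" x] gauss_integrable
      by (simp add: inner_commute complex_of_real_integrable_eq)
    have 1: "(\<lambda>n. LINT \<xi>|lborel. ?\<Phi> (?b n *\<^sub>R \<xi>) * (cis (- 2 * pi * (x \<bullet> \<xi>)) * complex_of_real (gauss \<xi>)))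
       \<longlonglongrightarrow> (LINT \<xi>|lborel. L \<xi> * (cis (- 2 * pi * (x \<bullet> \<xi>)) * complex_of_real (gauss \<xi>)))"
    proof (rule integral_dominated_convergence)
      show "integrable lborel (\<lambda>\<xi>::real^'n. ?J * gauss \<xi>)"
        by (intro integrable_mult_right gauss_integrable)
      show "AE \<xi> in lborel. norm (?\<Phi> (?b n *\<^sub>R \<xi>) * (cis (- 2 * pi * (x \<bullet> \<xi>)) * complex_of_real (gauss \<xi>))) \<le> ?J * gauss \<xi>" for n
        by (intro AE_I2) (auto simp: norm_mult gauss_bounds less_imp_le intro!: mult_right_mono \<Phi>b)
      show "AE \<xi> in lborel. (\<lambda>n. ?\<Phi> (?b n *\<^sub>R \<xi>) * (cis (- 2 * pi * (x \<bullet> \<xi>)) * complex_of_real (gauss \<xi>)))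
         \<longlonglongrightarrow> L \<xi> * (cis (- 2 * pi * (x \<bullet> \<xi>)) * complex_of_real (gauss \<xi>))"
        by (intro AE_I2 tendsto_mult tendsto_const L)
    qed measurable
    \<comment> \<open>The dilation is moved from the transform to \<phi> itself, through the
      multiplication formula onto the pairing, and by a change of variables onto the
      Gaussian.\<close>
    have 2: "(LINT \<xi>|lborel. ?\<Phi> (?b n *\<^sub>R \<xi>) * (cis (- 2 * pi * (x \<bullet> \<xi>)) * complex_of_real (gauss \<xi>)))
      = (LINT y|lborel. complex_of_real (\<phi> y * gauss (?b n *\<^sub>R y + x)))" for n
    proof -
      have b: "?b n > 0" by simp
      have di: "integrable lborel (\<lambda>y. complex_of_real (dilate \<phi> (?b n) y))"
        using dilate_integrable[OF \<phi> b] by (simp add: complex_of_real_integrable_eq)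
      have fd: "fourier_real (dilate \<phi> (?b n)) \<xi> = ?\<Phi> (?b n *\<^sub>R \<xi>)" for \<xi>
        by (rule fourier_dilate[OF _ b]) simp
      have fg: "fourier (\<lambda>\<xi>. cis (- 2 * pi * (x \<bullet> \<xi>)) * complex_of_real (gauss \<xi>)) y = complex_of_real (gauss (y + x))" for y
        using fourier_modulate[of "- x" "\<lambda>\<xi>. complex_of_real (gauss \<xi>)" y] by (simp add: fourier_gauss)
      have "(LINT \<xi>|lborel. ?\<Phi> (?b n *\<^sub>R \<xi>) * (cis (- 2 * pi * (x \<bullet> \<xi>)) * complex_of_real (gauss \<xi>)))
         = (LINT y|lborel. complex_of_real (dilate \<phi> (?b n) y) * complex_of_real (gauss (y + x)))"
        using fourier_multiplication[OF di hi[of x]] unfolding fg fd .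
      also have "\<dots> = \<bar>?b n\<bar> ^ DIM(real^'n) *\<^sub>R (LINT y|lborel. complex_of_real (dilate \<phi> (?b n) (0 + ?b n *\<^sub>R y)) * complex_of_real (gauss ((0 + ?b n *\<^sub>R y) + x)))"
        by (rule lborel_integral_affine) (use di in auto)
      also have "\<dots> = (LINT y|lborel. complex_of_real (\<phi> y * gauss (?b n *\<^sub>R y + x)))"
        unfolding integral_scaleR_right[symmetric]
        by (rule Bochner_Integration.integral_cong) (auto simp: dilate_def scaleR_conv_of_real[where 'a=complex] simp del: of_nat_Suc)
      finally show ?thesis .
    qed
    have 3: "(\<lambda>n. LINT y|lborel. complex_of_real (\<phi> y * gauss (?b n *\<^sub>R y + x))) \<longlonglongrightarrow> (LINT y|(lborel :: (real^'n) measure). 0)"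
    proof (rule integral_dominated_convergence)
      show "integrable lborel (\<lambda>y. \<bar>\<phi> y\<bar>)" using \<phi> by simp
      show "AE y in lborel. norm (complex_of_real (\<phi> y * gauss (?b n *\<^sub>R y + x))) \<le> \<bar>\<phi> y\<bar>" for n
        unfolding norm_of_real abs_mult
        by (intro AE_I2) (auto simp: gauss_bounds less_imp_le intro!: mult_right_le_one_le)
      \<comment> \<open>At y = 0 the Gaussian factor stays constant in n; everywhere else its
        argument escapes to infinity.\<close>
      have "AE y::real^'n in lborel. y \<noteq> 0" using AE_lborel_singleton[of "0::real^'n"] by simp
      then show "AE y in lborel. (\<lambda>n. complex_of_real (\<phi> y * gauss (?b n *\<^sub>R y + x))) \<longlonglongrightarrow> 0"
      proof eventually_elim
        case (elim y)
        have "filterlim (\<lambda>n. ?b n * norm y - norm x) at_top sequentially"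
          using elim by real_asymp
        then have "filterlim (\<lambda>n. norm (?b n *\<^sub>R y + x)) at_top sequentially"
        proof (rule filterlim_at_top_mono, intro always_eventually allI)
          fix n
          have "norm (?b n *\<^sub>R y) \<le> norm (?b n *\<^sub>R y + x) + norm x"
            by (metis add_diff_cancel norm_triangle_ineq4)
          then show "?b n * norm y - norm x \<le> norm (?b n *\<^sub>R y + x)" by simp
        qed
        moreover have "((\<lambda>t::real. exp (- pi * t\<^sup>2)) \<longlongrightarrow> 0) at_top" by real_asymp
        ultimately have "(\<lambda>n. exp (- pi * (norm (?b n *\<^sub>R y + x))\<^sup>2)) \<longlonglongrightarrow> 0"
          by (rule filterlim_compose[rotated])
        then have "(\<lambda>n. complex_of_real (\<phi> y * gauss (?b n *\<^sub>R y + x))) \<longlonglongrightarrow> complex_of_real (\<phi> y * 0)"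
          unfolding gauss_def by (intro tendsto_intros)
        then show ?case by simp
      qed
    qed measurable
    have "(LINT \<xi>|lborel. L \<xi> * (cis (- 2 * pi * (x \<bullet> \<xi>)) * complex_of_real (gauss \<xi>))) = 0"
      using LIMSEQ_unique[OF 1 3[folded 2]] by simp
    then show ?thesis by (simp add: fourier_def mult_ac inner_commute)
  qed
  then have "has_fourier_L2 ?w (\<lambda>_. 0)"
    using has_fourier_L2_fourier[OF wi wL] by presburger
  from has_fourier_L2_Plancherel[OF this] have "L2norm ?w = 0" by (simp add: L2norm_def)
  from L2norm_eq_0[OF wL this] show ?thesis
    by eventually_elim (use gauss_bounds(1) in \<open>auto simp: less_le\<close>)
qed

section \<open>Symbols of the operators\<close>

lemma fourier_tendsto:
  assumes f: "integrable lborel f" and x: "(\<lambda>n. x n) \<longlonglongrightarrow> \<xi>"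
  shows "(\<lambda>n. fourier f (x n)) \<longlonglongrightarrow> fourier f \<xi>"
  unfolding fourier_def
proof (rule integral_dominated_convergence)
  show "integrable lborel (\<lambda>y. norm (f y))" using f by simp
  show "AE y in lborel. (\<lambda>n. cis (- 2 * pi * (y \<bullet> x n)) * f y) \<longlonglongrightarrow> cis (- 2 * pi * (y \<bullet> \<xi>)) * f y"
    by (intro AE_I2 tendsto_intros tendsto_cis x)
qed (use f in \<open>auto simp: norm_mult\<close>)

locale heat_mollification =
  fixes \<tau> T s :: real and \<gamma> :: "real \<Rightarrow> real" and \<phi> :: "real^'n \<Rightarrow> real"
  assumes T: "T > 0" and \<tau>: "0 < \<tau>"
    and \<gamma>: "\<And>l. l \<in> {0<..<T} \<Longrightarrow> \<gamma> l > 0"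
    and \<gamma>i: "set_integrable lborel {0<..<T} \<gamma>"
    and s: "s > 0" and adm: "admissible_kernel s \<phi>"
begin

abbreviation \<psi> :: "real^'n \<Rightarrow> real" where "\<psi> \<equiv> heat_symbol \<tau> T \<gamma>"

text \<open>Collects the constants of the symbol, which becomes the exponential of - B |\<xi>|^(2
  \<tau>).\<close>

definition B :: real where "B = (2 * pi) powr (2 * \<tau>) * (LINT l:{0<..<T}|lborel. \<gamma> l)"

text \<open>The symbol of I - C_\<beta>, made real valued. The real part loses nothing because
  \<open>radially_decreasing\<close> contains that the transform is real.\<close>

definition m :: "real \<Rightarrow> real^'n \<Rightarrow> real" where "m \<beta> \<xi> = 1 - Re (fourier_real \<phi> (\<beta> *\<^sub>R \<xi>))"

text \<open>In Fourier variables the regularized solution is \<open>k \<beta>\<close> times the datum and its residual is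
  \<open>- \<kappa> \<beta>\<close> times the datum.\<close>

definition k :: "real \<Rightarrow> real^'n \<Rightarrow> real" where "k \<beta> \<xi> = \<psi> \<xi> / ((\<psi> \<xi>)\<^sup>2 + (m \<beta> \<xi>)\<^sup>2)"

definition \<kappa> :: "real \<Rightarrow> real^'n \<Rightarrow> real" where "\<kappa> \<beta> \<xi> = (m \<beta> \<xi>)\<^sup>2 / ((\<psi> \<xi>)\<^sup>2 + (m \<beta> \<xi>)\<^sup>2)"

lemma \<phi>i: "integrable lborel \<phi>"
  using adm by (simp add: admissible_kernel_def)

lemma \<phi>_measurable [measurable]: "\<phi> \<in> borel_measurable borel"
  using \<phi>i by simp

text \<open>A vanishing integral of a nonnegative function would force \<gamma> to vanish almost
  everywhere on an interval of positive length.\<close>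

lemma B_pos: "B > 0"
proof -
  let ?g = "\<lambda>l. indicator {0<..<T} l *\<^sub>R \<gamma> l"
  have gi: "integrable lborel ?g" using \<gamma>i by (simp add: set_integrable_def)
  have g0: "0 \<le> ?g l" for l using \<gamma>[of l] by (auto simp: indicator_def less_imp_le)
  have "(LINT l|lborel. ?g l) \<noteq> 0"
  proof
    assume "(LINT l|lborel. ?g l) = 0"
    then have "AE l in lborel. ?g l = 0" using integral_nonneg_eq_0_iff_AE[OF gi] g0 by simp
    then have "AE l in lborel. l \<notin> {0<..<T}"
      by eventually_elim (use \<gamma> in \<open>force simp: indicator_def\<close>)
    then have "emeasure lborel {0<..<T} = 0"
      by (subst (asm) AE_iff_measurable[of "{0<..<T}"]) auto
    then show False using T by simp
  qed
  moreover have "0 \<le> (LINT l|lborel. ?g l)" using g0 by simp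
  ultimately show ?thesis by (simp add: B_def set_lebesgue_integral_def)
qed

lemma \<psi>_eq: "\<psi> \<xi> = exp (- (B * norm \<xi> powr (2 * \<tau>)))"
  by (simp add: heat_symbol_def B_def powr_mult mult_ac)

lemma \<psi>_pos [simp]: "0 < \<psi> \<xi>" and \<psi>_le1: "\<psi> \<xi> \<le> 1"
  using B_pos by (auto simp: \<psi>_eq)

lemma \<psi>_lower: "norm \<xi> \<le> R \<Longrightarrow> exp (- (B * R powr (2 * \<tau>))) \<le> \<psi> \<xi>"
  using B_pos \<tau> by (auto simp: \<psi>_eq intro!: mult_left_mono powr_mono2)

lemma \<psi>_less1: "\<xi> \<noteq> 0 \<Longrightarrow> \<psi> \<xi> < 1"
  using B_pos by (simp add: \<psi>_eq)

lemma \<psi>_measurable [measurable]: "\<psi> \<in> borel_measurable borel"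
  unfolding \<psi>_eq[abs_def] by measurable

lemma fourier_\<phi>_real: "fourier_real \<phi> \<xi> = complex_of_real (Re (fourier_real \<phi> \<xi>))"
  using adm by (simp add: admissible_kernel_def radially_decreasing_def complex_eq_iff)

lemma fourier_\<phi>_0: "fourier_real \<phi> 0 = 1"
  using adm by (simp add: admissible_kernel_def fourier_def)

lemma m_eq: "complex_of_real (m \<beta> \<xi>) = 1 - fourier_real \<phi> (\<beta> *\<^sub>R \<xi>)"
  by (subst fourier_\<phi>_real) (simp add: m_def)

lemma m_nonneg: "0 \<le> m \<beta> \<xi>" and m_le2: "m \<beta> \<xi> \<le> 2"
proof -
  have "norm (fourier_real \<phi> \<zeta>) \<le> 1" for \<zeta>
    using adm by (cases "\<zeta> = 0") (auto simp: admissible_kernel_def fourier_\<phi>_0 less_imp_le)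
  then have "\<bar>Re (fourier_real \<phi> (\<beta> *\<^sub>R \<xi>))\<bar> \<le> 1" using abs_Re_le_cmod order_trans by blast
  then show "0 \<le> m \<beta> \<xi>" "m \<beta> \<xi> \<le> 2" by (auto simp: m_def)
qed

lemma m_measurable [measurable]: "m \<beta> \<in> borel_measurable borel"
  unfolding m_def by measurable

lemma m_mono: "0 \<le> \<beta> \<Longrightarrow> \<beta> \<le> \<beta>' \<Longrightarrow> m \<beta> \<xi> \<le> m \<beta>' \<xi>"
  using adm by (auto simp: admissible_kernel_def radially_decreasing_def m_def)

lemma m_tendsto: "b \<longlonglongrightarrow> \<beta> \<Longrightarrow> (\<lambda>n. m (b n) \<xi>) \<longlonglongrightarrow> m \<beta> \<xi>"
  unfolding m_def using \<phi>i
  by (intro tendsto_intros fourier_tendsto) (auto simp: complex_of_real_integrable_eq)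

lemma m_scale: "m 1 (\<beta> *\<^sub>R \<xi>) = m \<beta> \<xi>"
  by (simp add: m_def)

section \<open>Two-sided power bounds for the penalty symbol\<close>

lemma m_at_0:
  obtains c d \<eta> where "c > 0" "d > 0" "\<eta> > 0"
    "\<And>\<xi>. \<xi> \<noteq> 0 \<Longrightarrow> norm \<xi> < \<eta> \<Longrightarrow> c * norm \<xi> powr s \<le> m 1 \<xi> \<and> m 1 \<xi> \<le> d * norm \<xi> powr s"
proof -
  have nm: "norm (1 - fourier_real \<phi> \<xi>) = m 1 \<xi>" for \<xi>
    using m_eq[of 1 \<xi>, symmetric] m_nonneg[of 1 \<xi>] by simp
  have th: "m 1 \<in> \<Theta>[at 0](\<lambda>\<xi>. norm \<xi> powr s)"
    using adm by (simp add: admissible_kernel_def nm)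
  from th have "m 1 \<in> O[at 0](\<lambda>\<xi>. norm \<xi> powr s)" by (rule bigthetaD1)
  then obtain d where d: "d > 0" "eventually (\<lambda>\<xi>. norm (m 1 \<xi>) \<le> d * norm (norm \<xi> powr s)) (at 0)"
    by (auto elim: landau_o.bigE)
  from th have "m 1 \<in> \<Omega>[at 0](\<lambda>\<xi>. norm \<xi> powr s)" by (rule bigthetaD2)
  then obtain c where c: "c > 0" "eventually (\<lambda>\<xi>. norm (m 1 \<xi>) \<ge> c * norm (norm \<xi> powr s)) (at 0)"
    by (auto elim: landau_omega.bigE)
  have "eventually (\<lambda>\<xi>. c * norm \<xi> powr s \<le> m 1 \<xi> \<and> m 1 \<xi> \<le> d * norm \<xi> powr s) (at 0)"
    using c(2) d(2) by eventually_elim (simp add: m_nonneg)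
  then obtain \<eta> where "\<eta> > 0" "\<And>\<xi>. \<xi> \<noteq> 0 \<Longrightarrow> norm \<xi> < \<eta> \<Longrightarrow> c * norm \<xi> powr s \<le> m 1 \<xi> \<and> m 1 \<xi> \<le> d * norm \<xi> powr s"
    by (auto simp: eventually_at)
  with c(1) d(1) show ?thesis using that by blast
qed

text \<open>The kernel asymptotics give the bound near the origin. Outside radius \<eta> the trivial
  bound 2 is below a multiple of the power, which explains the term 2 / \<eta>^s in the
  constant.\<close>

lemma m_upper: "\<exists>d>0. \<forall>\<beta>>0. \<forall>\<xi>. m \<beta> \<xi> \<le> d * (\<beta> * norm \<xi>) powr s"
proof -
  obtain c d \<eta> where h: "c > 0" "d > 0" "\<eta> > 0"
    "\<And>\<xi>. \<xi> \<noteq> 0 \<Longrightarrow> norm \<xi> < \<eta> \<Longrightarrow> c * norm \<xi> powr s \<le> m 1 \<xi> \<and> m 1 \<xi> \<le> d * norm \<xi> powr s"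
    by (rule m_at_0) blast
  let ?d = "d + 2 / \<eta> powr s"
  have *: "m 1 \<xi> \<le> ?d * norm \<xi> powr s" for \<xi>
  proof (cases "norm \<xi> < \<eta>")
    case True
    show ?thesis
    proof (cases "\<xi> = 0")
      case True
      then show ?thesis using fourier_\<phi>_0 by (simp add: m_def)
    next
      case False
      have "d * norm \<xi> powr s \<le> ?d * norm \<xi> powr s" using h by (intro mult_right_mono) auto
      then show ?thesis using h(4)[OF False True] by linarith
    qed
  next
    case False
    have "m 1 \<xi> \<le> 2" by (rule m_le2)
    also have "2 = 2 / \<eta> powr s * \<eta> powr s" using h(3) by simp
    also have "\<dots> \<le> ?d * norm \<xi> powr s"
      using h False s by (intro mult_mono powr_mono2) auto
    finally show ?thesis .
  qed
  have "?d > 0" using h by (simp add: add_pos_nonneg)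
  moreover have "m \<beta> \<xi> \<le> ?d * (\<beta> * norm \<xi>) powr s" if "\<beta> > 0" for \<beta> \<xi>
    using *[of "\<beta> *\<^sub>R \<xi>"] that by (simp add: m_scale)
  ultimately show ?thesis by blast
qed

text \<open>The asymptotics control only a neighbourhood of the origin. Beyond it, monotonicity
  along rays carries the value at a small radius outwards, so the power is capped by 1.\<close>

lemma m_lower: "\<exists>c>0. \<forall>\<beta>>0. \<forall>\<xi>. c * min 1 ((\<beta> * norm \<xi>) powr s) \<le> m \<beta> \<xi>"
proof -
  obtain c d \<eta> where h: "c > 0" "d > 0" "\<eta> > 0"
    "\<And>\<xi>. \<xi> \<noteq> 0 \<Longrightarrow> norm \<xi> < \<eta> \<Longrightarrow> c * norm \<xi> powr s \<le> m 1 \<xi> \<and> m 1 \<xi> \<le> d * norm \<xi> powr s"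
    by (rule m_at_0) blast
  \<comment> \<open>Half of \<eta> stays strictly inside the ball where the asymptotics hold; the
    cap at 1 makes the power of \<open>?h\<close> at most 1.\<close>
  let ?h = "min 1 (\<eta> / 2)"
  let ?c = "c * ?h powr s"
  have hp: "0 < ?h" "?h < \<eta>" using h(3) by auto
  have *: "?c * min 1 (norm \<xi> powr s) \<le> m 1 \<xi>" if \<xi>: "\<xi> \<noteq> 0" for \<xi>
  proof -
    \<comment> \<open>Scaling by \<open>?t\<close> pulls \<xi> back along its ray to radius at most
      \<open>?h\<close>.\<close>
    let ?t = "min 1 (?h / norm \<xi>)"
    have nz: "norm \<xi> > 0" using \<xi> by simp
    have t: "0 < ?t" "?t \<le> 1" using hp nz by auto
    have nt: "norm (?t *\<^sub>R \<xi>) = min (norm \<xi>) ?h"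
      using nz hp t by (auto simp: min_def field_simps)
    have "?h powr s * min 1 (norm \<xi> powr s) \<le> min (norm \<xi>) ?h powr s"
    proof (cases "norm \<xi> \<le> ?h")
      case True
      have "?h powr s * min 1 (norm \<xi> powr s) \<le> 1 * norm \<xi> powr s"
        using hp s by (intro mult_mono powr_le1) auto
      then show ?thesis using True by (simp add: min_absorb1)
    next
      case False
      have "?h powr s * min 1 (norm \<xi> powr s) \<le> ?h powr s * 1" by (intro mult_left_mono) auto
      moreover have "min (norm \<xi>) ?h = ?h" using False by (intro min_absorb2) linarith
      ultimately show ?thesis by simp
    qed
    then have "?c * min 1 (norm \<xi> powr s) \<le> c * norm (?t *\<^sub>R \<xi>) powr s"
      unfolding nt using h(1) by (simp add: mult.assoc)
    also have "\<dots> \<le> m 1 (?t *\<^sub>R \<xi>)"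
    proof -
      have "norm (?t *\<^sub>R \<xi>) < \<eta>" unfolding nt using hp by linarith
      moreover have "?t *\<^sub>R \<xi> \<noteq> 0" using \<xi> t by auto
      ultimately show ?thesis using h(4) by blast
    qed
    also have "\<dots> = m ?t \<xi>" by (rule m_scale)
    also have "\<dots> \<le> m 1 \<xi>" using t by (intro m_mono) auto
    finally show ?thesis .
  qed
  have "?c > 0" using h(1) hp by simp
  moreover have "?c * min 1 ((\<beta> * norm \<xi>) powr s) \<le> m \<beta> \<xi>" if "\<beta> > 0" for \<beta> \<xi>
  proof (cases "\<xi> = 0")
    case False
    then show ?thesis using *[of "\<beta> *\<^sub>R \<xi>"] that by (simp add: m_scale)
  qed (simp add: m_nonneg)
  ultimately show ?thesis by blast
qed

text \<open>Monotonicity and boundedness give limits of the transform along every ray, and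
  \<open>fourier_ray_limit_zero\<close> identifies them almost everywhere. The origin is a genuine
  exception, since \<open>m\<close> vanishes there.\<close>

lemma m_at_top: "AE \<xi> in lborel. (\<lambda>n. m (real (Suc n)) \<xi>) \<longlonglongrightarrow> 1"
proof -
  define f where "f n \<xi> = Re (fourier_real \<phi> (real (Suc n) *\<^sub>R \<xi>))" for n \<xi>
  have "convergent (\<lambda>n. f n \<xi>)" for \<xi>
  proof (rule Bseq_monoseq_convergent)
    have "\<bar>f n \<xi>\<bar> \<le> 1" for n
      using m_nonneg[of "real (Suc n)" \<xi>] m_le2[of "real (Suc n)" \<xi>] by (auto simp: f_def m_def abs_le_iff)
    then show "Bseq (\<lambda>n. f n \<xi>)" by (intro BseqI'[where K=1]) simp
    show "monoseq (\<lambda>n. f n \<xi>)"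
      using m_mono[of "real (Suc n)" "real (Suc n')" \<xi> for n n']
      by (intro decseq_imp_monoseq) (auto simp: decseq_def f_def m_def)
  qed
  then obtain L where L: "\<And>\<xi>. (\<lambda>n. f n \<xi>) \<longlonglongrightarrow> L \<xi>" unfolding convergent_def by metis
  have "(\<lambda>n. fourier_real \<phi> (real (Suc n) *\<^sub>R \<xi>)) \<longlonglongrightarrow> complex_of_real (L \<xi>)" for \<xi>
    using tendsto_of_real[OF L[of \<xi>], where 'a=complex] unfolding f_def by (subst fourier_\<phi>_real)
  from fourier_ray_limit_zero[OF \<phi>i this] show ?thesis
  proof eventually_elim
    case (elim \<xi>)
    have "(\<lambda>n. 1 - f n \<xi>) \<longlonglongrightarrow> 1 - L \<xi>" by (intro tendsto_intros L)
    then show ?case using elim by (simp add: f_def m_def)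
  qed
qed

section \<open>The solution and residual multipliers\<close>

lemma \<psi>_nonzero [simp]: "\<psi> \<xi> \<noteq> 0"
  using \<psi>_pos[of \<xi>] by linarith

lemma denom_pos [simp]: "0 < (\<psi> \<xi>)\<^sup>2 + (m \<beta> \<xi>)\<^sup>2"
  by (intro add_pos_nonneg zero_less_power) auto

lemma k_measurable [measurable]: "k \<beta> \<in> borel_measurable borel"
  unfolding k_def by measurable

lemma \<kappa>_measurable [measurable]: "\<kappa> \<beta> \<in> borel_measurable borel"
  unfolding \<kappa>_def by measurable

lemma k_nonneg: "0 \<le> k \<beta> \<xi>"
  by (simp add: k_def less_imp_le)

lemma \<kappa>_nonneg: "0 \<le> \<kappa> \<beta> \<xi>" and \<kappa>_le1: "\<kappa> \<beta> \<xi> \<le> 1"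
  by (auto simp: \<kappa>_def divide_le_eq less_imp_le)

lemma \<kappa>_eq: "\<kappa> \<beta> \<xi> = 1 - \<psi> \<xi> * k \<beta> \<xi>"
  using denom_pos[of \<xi> \<beta>] by (simp add: \<kappa>_def k_def field_simps power2_eq_square less_imp_neq[symmetric])

lemma \<kappa>_mono:
  assumes "0 \<le> \<beta>" "\<beta> \<le> \<beta>'" shows "\<kappa> \<beta> \<xi> \<le> \<kappa> \<beta>' \<xi>"
proof -
  have "(m \<beta> \<xi>)\<^sup>2 \<le> (m \<beta>' \<xi>)\<^sup>2" using m_mono[OF assms] m_nonneg by (intro power_mono)
  then have "(m \<beta> \<xi>)\<^sup>2 * ((\<psi> \<xi>)\<^sup>2 + (m \<beta>' \<xi>)\<^sup>2) \<le> (m \<beta>' \<xi>)\<^sup>2 * ((\<psi> \<xi>)\<^sup>2 + (m \<beta> \<xi>)\<^sup>2)"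
    by (simp add: distrib_left mult.commute mult_right_mono)
  then show ?thesis by (simp add: \<kappa>_def frac_le_eq divide_le_eq pos_le_divide_eq)
qed

lemma \<kappa>_tendsto: "b \<longlonglongrightarrow> \<beta> \<Longrightarrow> (\<lambda>n. \<kappa> (b n) \<xi>) \<longlonglongrightarrow> \<kappa> \<beta> \<xi>"
  unfolding \<kappa>_def using less_imp_neq[OF denom_pos[of \<xi> \<beta>]] by (intro tendsto_intros m_tendsto) auto

text \<open>The multiplier is at most 1 / \<psi>, which is bounded on the unit ball, where
  \<open>m\<close> may vanish. Outside it the arithmetic-geometric mean inequality gives 1 / (2 m),
  and \<open>m\<close> is at least a multiple of min(1, \<beta>^s) by
  \<open>m_lower\<close>.\<close>

lemma k_bound: "\<exists>M>0. \<forall>\<beta>>0. \<forall>\<xi>. k \<beta> \<xi> \<le> M * (1 + \<beta> powr (- s))"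
proof -
  obtain c where c: "c > 0" "\<And>\<beta> \<xi>. \<beta> > 0 \<Longrightarrow> c * min 1 ((\<beta> * norm \<xi>) powr s) \<le> m \<beta> \<xi>"
    using m_lower by blast
  let ?M = "exp B + 1 / (2 * c)"
  have "k \<beta> \<xi> \<le> ?M * (1 + \<beta> powr (- s))" if \<beta>: "\<beta> > 0" for \<beta> \<xi>
  proof (cases "norm \<xi> \<le> 1")
    case True
    have "exp (- B) \<le> \<psi> \<xi>" using \<psi>_lower[OF True] by simp
    then have e: "1 / \<psi> \<xi> \<le> exp B" by (simp add: exp_minus field_simps)
    have "k \<beta> \<xi> \<le> \<psi> \<xi> / (\<psi> \<xi>)\<^sup>2"
      unfolding k_def by (intro divide_left_mono) (auto simp: less_imp_le)
    also have "\<dots> = 1 / \<psi> \<xi>" by (simp add: power2_eq_square)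
    also have "\<dots> \<le> exp B * 1" using e by simp
    also have "\<dots> \<le> ?M * (1 + \<beta> powr (- s))"
      using c(1) by (intro mult_mono) auto
    finally show ?thesis .
  next
    case False
    let ?\<mu> = "min 1 (\<beta> powr s)"
    have \<mu>: "?\<mu> > 0" using \<beta> by simp
    have "\<beta> powr s \<le> (\<beta> * norm \<xi>) powr s" using False \<beta> s by (intro powr_mono2) auto
    then have "c * ?\<mu> \<le> c * min 1 ((\<beta> * norm \<xi>) powr s)" using c(1) by (intro mult_left_mono) auto
    then have m: "c * ?\<mu> \<le> m \<beta> \<xi>" using c(2)[OF \<beta>, of \<xi>] by linarith
    have mp: "0 < m \<beta> \<xi>" using m \<mu> c(1) by (meson less_le_trans mult_pos_pos)
    have "2 * m \<beta> \<xi> * \<psi> \<xi> \<le> (\<psi> \<xi>)\<^sup>2 + (m \<beta> \<xi>)\<^sup>2"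
      using sum_squares_bound[of "m \<beta> \<xi>" "\<psi> \<xi>"] by simp
    then have "k \<beta> \<xi> \<le> 1 / (2 * m \<beta> \<xi>)"
      using mp by (simp add: k_def divide_le_eq pos_le_divide_eq mult_ac)
    also have "\<dots> \<le> 1 / (2 * (c * ?\<mu>))"
      using m mp \<mu> c(1) by (intro divide_left_mono) auto
    also have "\<dots> = 1 / (2 * c) * (1 / ?\<mu>)" by simp
    also have "1 / ?\<mu> \<le> 1 + \<beta> powr (- s)"
      using \<beta> by (auto simp: min_def powr_minus field_simps)
    then have "1 / (2 * c) * (1 / ?\<mu>) \<le> ?M * (1 + \<beta> powr (- s))"
      using c(1) \<mu> by (intro mult_mono) auto
    finally show ?thesis .
  qed
  moreover have "?M > 0" using c(1) by (simp add: add_pos_pos)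
  ultimately show ?thesis by blast
qed

lemma powr_exp_bounded:
  fixes u c v :: real
  assumes "u > 0" "c > 0" "v > 0"
  shows "\<exists>K>0. \<forall>x\<ge>0. x powr u * exp (- (c * x powr v)) \<le> K"
proof -
  have "((\<lambda>x. x powr u * exp (- (c * x powr v))) \<longlongrightarrow> 0) at_top"
    using assms by real_asymp
  then have "eventually (\<lambda>x. x powr u * exp (- (c * x powr v)) < 1) at_top"
    by (rule order_tendstoD) simp
  then obtain X where X: "\<And>x. x \<ge> X \<Longrightarrow> x powr u * exp (- (c * x powr v)) < 1"
    by (auto simp: eventually_at_top_linorder)
  have "x powr u * exp (- (c * x powr v)) \<le> \<bar>X\<bar> powr u + 1" if "x \<ge> 0" for x
  proof (cases "x \<ge> X")
    case True
    have "0 \<le> \<bar>X\<bar> powr u" by simp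
    with X[OF True] show ?thesis by linarith
  next
    case False
    have "x powr u * exp (- (c * x powr v)) \<le> \<bar>X\<bar> powr u * 1"
      using assms that False by (intro mult_mono powr_mono2) auto
    then show ?thesis by simp
  qed
  moreover have "\<bar>X\<bar> powr u + 1 > 0" by (simp add: add_nonneg_pos)
  ultimately show ?thesis by blast
qed

text \<open>Interpolating between \<open>\<kappa> \<psi> \<le> m\<close> and \<open>\<kappa> \<psi> \<le> \<psi>\<close>: any power of \<open>\<psi>\<close> absorbs the growth of \<open>m\<close>,
  so no smoothness is needed.\<close>

lemma \<kappa>\<psi>_bound:
  assumes a: "0 < a" "a < 1"
  shows "\<exists>K>0. \<forall>\<beta>>0. \<forall>\<xi>. \<kappa> \<beta> \<xi> * \<psi> \<xi> \<le> K * \<beta> powr (a * s)"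
proof -
  obtain d where d: "d > 0" "\<And>\<beta> \<xi>. \<beta> > 0 \<Longrightarrow> m \<beta> \<xi> \<le> d * (\<beta> * norm \<xi>) powr s"
    using m_upper by blast
  obtain K where K: "K > 0" "\<And>x. x \<ge> 0 \<Longrightarrow> x powr (s * a) * exp (- ((1 - a) * B * x powr (2 * \<tau>))) \<le> K"
    using powr_exp_bounded[of "s * a" "(1 - a) * B" "2 * \<tau>"] a s \<tau> B_pos by auto
  have "\<kappa> \<beta> \<xi> * \<psi> \<xi> \<le> d powr a * K * \<beta> powr (a * s)" if \<beta>: "\<beta> > 0" for \<beta> \<xi>
  proof -
    have "\<kappa> \<beta> \<xi> * \<psi> \<xi> \<le> m \<beta> \<xi> powr a * \<psi> \<xi> powr (1 - a)"
    proof (cases "m \<beta> \<xi> \<le> \<psi> \<xi>")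
      case True
      have "\<kappa> \<beta> \<xi> \<le> (m \<beta> \<xi>)\<^sup>2 / (\<psi> \<xi>)\<^sup>2"
        unfolding \<kappa>_def by (intro divide_left_mono) auto
      then have "\<kappa> \<beta> \<xi> * \<psi> \<xi> \<le> (m \<beta> \<xi>)\<^sup>2 / (\<psi> \<xi>)\<^sup>2 * \<psi> \<xi>"
        by (intro mult_right_mono) (auto simp: less_imp_le)
      also have "\<dots> = m \<beta> \<xi> * (m \<beta> \<xi> / \<psi> \<xi>)" by (simp add: power2_eq_square)
      also have "\<dots> \<le> m \<beta> \<xi> * 1" using True m_nonneg by (intro mult_left_mono) auto
      also have "\<dots> = m \<beta> \<xi> powr a * m \<beta> \<xi> powr (1 - a)"
        using m_nonneg[of \<beta> \<xi>] by (cases "m \<beta> \<xi> = 0") (auto simp flip: powr_add)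
      also have "\<dots> \<le> m \<beta> \<xi> powr a * \<psi> \<xi> powr (1 - a)"
        using True m_nonneg a by (intro mult_left_mono powr_mono2) auto
      finally show ?thesis .
    next
      case False
      have "\<kappa> \<beta> \<xi> * \<psi> \<xi> \<le> 1 * \<psi> \<xi>"
        by (intro mult_right_mono \<kappa>_le1) (auto simp: less_imp_le)
      also have "\<dots> = \<psi> \<xi> powr a * \<psi> \<xi> powr (1 - a)" by (simp add: abs_of_pos flip: powr_add)
      also have "\<dots> \<le> m \<beta> \<xi> powr a * \<psi> \<xi> powr (1 - a)"
        using False a by (intro mult_right_mono powr_mono2) (auto simp: less_imp_le)
      finally show ?thesis .
    qed
    also have "\<dots> \<le> (d * (\<beta> * norm \<xi>) powr s) powr a * \<psi> \<xi> powr (1 - a)"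
      using a d(2)[OF \<beta>] m_nonneg by (intro mult_right_mono powr_mono2) auto
    also have "\<dots> = d powr a * \<beta> powr (a * s) * (norm \<xi> powr (s * a) * exp (- ((1 - a) * B * norm \<xi> powr (2 * \<tau>))))"
      using d(1) \<beta> by (simp add: powr_mult powr_powr \<psi>_eq exp_powr_real mult_ac)
    also have "\<dots> \<le> d powr a * \<beta> powr (a * s) * K"
      using K(2)[of "norm \<xi>"] by (intro mult_left_mono) auto
    finally show ?thesis by (simp add: mult_ac)
  qed
  moreover have "d powr a * K > 0" using d(1) K(1) by simp
  ultimately show ?thesis by blast
qed

section \<open>The regularized solution\<close>

lemma has_fourier_L2_heat_op:
  "has_fourier_L2 u U \<Longrightarrow> has_fourier_L2 (heat_op \<tau> T \<gamma> u) (\<lambda>\<xi>. complex_of_real (\<psi> \<xi>) * U \<xi>)"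
  unfolding heat_op_def
  by (rule fourier_multiplier[where B=1]) (auto simp: \<psi>_le1 less_imp_le)

lemma has_fourier_L2_penalty:
  assumes u: "has_fourier_L2 u U" and \<beta>: "\<beta> > 0"
  shows "has_fourier_L2 (\<lambda>x. u x - mollify \<phi> \<beta> u x) (\<lambda>\<xi>. complex_of_real (m \<beta> \<xi>) * U \<xi>)"
  using has_fourier_L2_diff[OF u has_fourier_L2_mollify[OF \<phi>i \<beta> u]]
  by (simp add: m_eq left_diff_distrib)

text \<open>A real identity applied separately to real and imaginary parts. Pointwise it turns the
  functional into a weighted squared distance to the candidate minimizer plus a remainder
  independent of U.\<close>

lemma completing_the_square:
  fixes U G :: complex
  assumes D: "0 < p\<^sup>2 + q\<^sup>2"
  shows "(norm (complex_of_real p * U - G))\<^sup>2 + (norm (complex_of_real q * U))\<^sup>2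
    = (p\<^sup>2 + q\<^sup>2) * (norm (U - complex_of_real (p / (p\<^sup>2 + q\<^sup>2)) * G))\<^sup>2 + q\<^sup>2 / (p\<^sup>2 + q\<^sup>2) * (norm G)\<^sup>2"
proof -
  have c: "(p * a - g)\<^sup>2 + (q * a)\<^sup>2 = (p\<^sup>2 + q\<^sup>2) * (a - p / (p\<^sup>2 + q\<^sup>2) * g)\<^sup>2 + q\<^sup>2 / (p\<^sup>2 + q\<^sup>2) * g\<^sup>2" for a g :: real
  proof -
    define d where "d = p\<^sup>2 + q\<^sup>2"
    have d: "d \<noteq> 0" and q: "q\<^sup>2 = d - p\<^sup>2" using D by (auto simp: d_def)
    have "d * (a - p / d * g)\<^sup>2 + q\<^sup>2 / d * g\<^sup>2 = d * a\<^sup>2 - 2 * a * p * g + (p\<^sup>2 + q\<^sup>2) * g\<^sup>2 / d"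
      using d by (simp add: field_simps power2_eq_square)
    also have "\<dots> = (p * a - g)\<^sup>2 + (q * a)\<^sup>2"
      unfolding d_def[symmetric] using d by (simp add: power_mult_distrib q power2_diff algebra_simps)
    finally show ?thesis by (simp add: d_def)
  qed
  show ?thesis
    unfolding cmod_power2 using c[of "Re U" "Re G"] c[of "Im U" "Im G"] by (simp add: distrib_left)
qed

text \<open>Plancherel followed by completing the square at each frequency. The second integral does
  not depend on u, so minimizing means making the first one vanish.\<close>

lemma functional_eq:
  assumes u: "has_fourier_L2 u U" and g: "has_fourier_L2 g G" and \<beta>: "\<beta> > 0"
    and kG: "(\<lambda>\<xi>. complex_of_real (k \<beta> \<xi>) * G \<xi>) \<in> L2"
  shows "integrable lborel (\<lambda>\<xi>. ((\<psi> \<xi>)\<^sup>2 + (m \<beta> \<xi>)\<^sup>2) * (norm (U \<xi> - complex_of_real (k \<beta> \<xi>) * G \<xi>))\<^sup>2)"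
    and "mollifier_functional \<tau> T \<gamma> \<phi> \<beta> g u =
      (LINT \<xi>|lborel. ((\<psi> \<xi>)\<^sup>2 + (m \<beta> \<xi>)\<^sup>2) * (norm (U \<xi> - complex_of_real (k \<beta> \<xi>) * G \<xi>))\<^sup>2)
      + (LINT \<xi>|lborel. \<kappa> \<beta> \<xi> * (norm (G \<xi>))\<^sup>2)"
proof -
  note U = has_fourier_L2D(2)[OF u] and G = has_fourier_L2D(2)[OF g]
  note [measurable] = L2_measurable[OF U] L2_measurable[OF G]
  note h1 = has_fourier_L2_diff[OF has_fourier_L2_heat_op[OF u] g] and h2 = has_fourier_L2_penalty[OF u \<beta>]
  note i1 = L2_integrable[OF has_fourier_L2D(2)[OF h1]] and i2 = L2_integrable[OF has_fourier_L2D(2)[OF h2]]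
  have i3: "integrable lborel (\<lambda>\<xi>. \<kappa> \<beta> \<xi> * (norm (G \<xi>))\<^sup>2)"
    by (rule Bochner_Integration.integrable_bound[OF L2_integrable[OF G]])
       (auto simp: abs_mult \<kappa>_nonneg \<kappa>_le1 intro!: mult_left_le_one_le)
  have eq: "((\<psi> \<xi>)\<^sup>2 + (m \<beta> \<xi>)\<^sup>2) * (norm (U \<xi> - complex_of_real (k \<beta> \<xi>) * G \<xi>))\<^sup>2
    = (norm (complex_of_real (\<psi> \<xi>) * U \<xi> - G \<xi>))\<^sup>2 + (norm (complex_of_real (m \<beta> \<xi>) * U \<xi>))\<^sup>2 - \<kappa> \<beta> \<xi> * (norm (G \<xi>))\<^sup>2" for \<xi>
    using completing_the_square[OF denom_pos[of \<xi> \<beta>], of "U \<xi>" "G \<xi>"] unfolding k_def \<kappa>_def by linarith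
  show "integrable lborel (\<lambda>\<xi>. ((\<psi> \<xi>)\<^sup>2 + (m \<beta> \<xi>)\<^sup>2) * (norm (U \<xi> - complex_of_real (k \<beta> \<xi>) * G \<xi>))\<^sup>2)"
    unfolding eq by (intro Bochner_Integration.integrable_add Bochner_Integration.integrable_diff i1 i2 i3)
  have "mollifier_functional \<tau> T \<gamma> \<phi> \<beta> g u =
    (LINT \<xi>|lborel. (norm (complex_of_real (\<psi> \<xi>) * U \<xi> - G \<xi>))\<^sup>2) + (LINT \<xi>|lborel. (norm (complex_of_real (m \<beta> \<xi>) * U \<xi>))\<^sup>2)"
    unfolding mollifier_functional_def
    by (simp only: has_fourier_L2_Plancherel[OF h1, symmetric] has_fourier_L2_Plancherel[OF h2, symmetric] L2norm_squared)
  also have "\<dots> = (LINT \<xi>|lborel. ((\<psi> \<xi>)\<^sup>2 + (m \<beta> \<xi>)\<^sup>2) * (norm (U \<xi> - complex_of_real (k \<beta> \<xi>) * G \<xi>))\<^sup>2)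
      + (LINT \<xi>|lborel. \<kappa> \<beta> \<xi> * (norm (G \<xi>))\<^sup>2)"
    unfolding eq using i1 i2 i3 by simp
  finally show "mollifier_functional \<tau> T \<gamma> \<phi> \<beta> g u =
      (LINT \<xi>|lborel. ((\<psi> \<xi>)\<^sup>2 + (m \<beta> \<xi>)\<^sup>2) * (norm (U \<xi> - complex_of_real (k \<beta> \<xi>) * G \<xi>))\<^sup>2)
      + (LINT \<xi>|lborel. \<kappa> \<beta> \<xi> * (norm (G \<xi>))\<^sup>2)" .
qed

lemma kG_L2:
  assumes G: "G \<in> L2" and \<beta>: "\<beta> > 0"
  shows "(\<lambda>\<xi>. complex_of_real (k \<beta> \<xi>) * G \<xi>) \<in> L2"
proof -
  obtain M where "\<And>\<xi>. k \<beta> \<xi> \<le> M * (1 + \<beta> powr (- s))" using k_bound \<beta> by blast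
  then show ?thesis by (intro L2_mult_bounded(1)[OF G]) (auto simp: k_nonneg)
qed

text \<open>Surjectivity of the transform provides a minimizer, so the choice in
  \<open>arg_min\<close> is a true minimizer. Its weighted distance to \<open>k \<beta>\<close>
  times the datum is then zero, and positivity of the weight gives equality almost
  everywhere.\<close>

lemma has_fourier_L2_reg_solution:
  assumes g: "has_fourier_L2 g G" and \<beta>: "\<beta> > 0"
  shows "has_fourier_L2 (reg_solution \<tau> T \<gamma> \<phi> \<beta> g) (\<lambda>\<xi>. complex_of_real (k \<beta> \<xi>) * G \<xi>)"
proof -
  let ?J = "mollifier_functional \<tau> T \<gamma> \<phi> \<beta> g"
  let ?kG = "\<lambda>\<xi>. complex_of_real (k \<beta> \<xi>) * G \<xi>"
  note kG = kG_L2[OF has_fourier_L2D(2)[OF g] \<beta>]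
  obtain u0 where u0: "has_fourier_L2 u0 ?kG" using has_fourier_L2_surj[OF kG] by blast
  let ?Q = "LINT \<xi>|lborel. \<kappa> \<beta> \<xi> * (norm (G \<xi>))\<^sup>2"
  have J0: "?J u0 = ?Q" using functional_eq(2)[OF u0 g \<beta> kG] by simp
  have J: "?Q \<le> ?J u" if "u \<in> L2" for u
    using functional_eq(2)[OF fourier_L2[OF that] g \<beta> kG] by (simp add: less_imp_le)
  have "is_arg_min ?J (\<lambda>u. u \<in> L2) u0"
    using J J0 has_fourier_L2D(1)[OF u0] by (auto simp: is_arg_min_def not_less)
  then have am: "is_arg_min ?J (\<lambda>u. u \<in> L2) (reg_solution \<tau> T \<gamma> \<phi> \<beta> g)"
    unfolding reg_solution_def arg_min_def by (rule someI[of "is_arg_min ?J (\<lambda>u. u \<in> L2)"])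
  let ?v = "reg_solution \<tau> T \<gamma> \<phi> \<beta> g"
  have v: "?v \<in> L2" using am by (simp add: is_arg_min_def)
  have "?J ?v \<le> ?Q" using am has_fourier_L2D(1)[OF u0] J0 by (auto simp: is_arg_min_def not_less)
  let ?f = "\<lambda>\<xi>. ((\<psi> \<xi>)\<^sup>2 + (m \<beta> \<xi>)\<^sup>2) * (norm (fourier_L2 ?v \<xi> - ?kG \<xi>))\<^sup>2"
  have f0: "0 \<le> ?f \<xi>" for \<xi> by (simp add: less_imp_le)
  have "(LINT \<xi>|lborel. ?f \<xi>) \<le> 0"
    using functional_eq(2)[OF fourier_L2[OF v] g \<beta> kG] \<open>?J ?v \<le> ?Q\<close> by simp
  moreover have "0 \<le> (LINT \<xi>|lborel. ?f \<xi>)" using f0 by simp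
  ultimately have "(LINT \<xi>|lborel. ?f \<xi>) = 0" by simp
  then have "AE \<xi> in lborel. ?f \<xi> = 0"
    using integral_nonneg_eq_0_iff_AE[OF functional_eq(1)[OF fourier_L2[OF v] g \<beta> kG]] f0 by simp
  then have "AE \<xi> in lborel. fourier_L2 ?v \<xi> = ?kG \<xi>"
  proof eventually_elim
    case (elim \<xi>)
    then show ?case using less_imp_neq[OF denom_pos[of \<xi> \<beta>]] by auto
  qed
  then show ?thesis
    using v kG by (intro has_fourier_L2_cong_AE[OF fourier_L2[OF v]]) (auto intro: L2_measurable)
qed

section \<open>The residual as a function of the parameter\<close>

definition residual :: "(real^'n \<Rightarrow> complex) \<Rightarrow> real \<Rightarrow> real" where
  "residual G \<beta> = L2norm (\<lambda>\<xi>. complex_of_real (\<kappa> \<beta> \<xi>) * G \<xi>)"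

lemma residual_eq:
  assumes g: "has_fourier_L2 g G" and \<beta>: "\<beta> > 0"
  shows "L2norm (\<lambda>x. heat_op \<tau> T \<gamma> (reg_solution \<tau> T \<gamma> \<phi> \<beta> g) x - g x) = residual G \<beta>"
proof -
  have "L2norm (\<lambda>x. heat_op \<tau> T \<gamma> (reg_solution \<tau> T \<gamma> \<phi> \<beta> g) x - g x)
     = L2norm (\<lambda>\<xi>. complex_of_real (\<psi> \<xi>) * (complex_of_real (k \<beta> \<xi>) * G \<xi>) - G \<xi>)"
    using has_fourier_L2_Plancherel[OF has_fourier_L2_diff[OF has_fourier_L2_heat_op[OF has_fourier_L2_reg_solution[OF g \<beta>]] g]]
    by simp
  also have "\<dots> = L2norm (\<lambda>\<xi>. G \<xi> - complex_of_real (\<psi> \<xi>) * (complex_of_real (k \<beta> \<xi>) * G \<xi>))"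
    by (rule L2norm_minus_commute)
  also have "\<dots> = residual G \<beta>"
    by (simp add: residual_def \<kappa>_eq left_diff_distrib mult.assoc)
  finally show ?thesis .
qed

lemma \<kappa>G_L2:
  assumes "G \<in> L2"
  shows "(\<lambda>\<xi>. complex_of_real (\<kappa> \<beta> \<xi>) * G \<xi>) \<in> L2" "L2norm (\<lambda>\<xi>. complex_of_real (\<kappa> \<beta> \<xi>) * G \<xi>) \<le> L2norm G"
  using L2_mult_bounded[OF assms, of "\<lambda>\<xi>. complex_of_real (\<kappa> \<beta> \<xi>)" 1] by (auto simp: \<kappa>_nonneg \<kappa>_le1)

lemma residual_mono:
  assumes G: "G \<in> L2" and "0 \<le> \<beta>" "\<beta> \<le> \<beta>'"
  shows "residual G \<beta> \<le> residual G \<beta>'"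
  unfolding residual_def
  by (rule L2_bound(2)[OF L2_measurable(1)[OF \<kappa>G_L2(1)[OF G]] \<kappa>G_L2(1)[OF G]])
     (use assms in \<open>auto simp: norm_mult \<kappa>_nonneg intro!: mult_right_mono \<kappa>_mono\<close>)

text \<open>Serves three limits: \<beta> tending to infinity, \<beta> increasing to the supremum,
  and the radius of the Sobolev tail tending to infinity.\<close>

lemma L2_multiplier_tendsto:
  fixes G :: "real^'n \<Rightarrow> complex"
  assumes G: "G \<in> L2" and [measurable]: "\<And>n. h n \<in> borel_measurable borel" "h' \<in> borel_measurable borel"
    and b: "\<And>n \<xi>. \<bar>h n \<xi>\<bar> \<le> 1" and lim: "AE \<xi> in lborel. (\<lambda>n. h n \<xi>) \<longlonglongrightarrow> h' \<xi>"
  shows "(\<lambda>n. L2norm (\<lambda>\<xi>. complex_of_real (h n \<xi>) * G \<xi>)) \<longlonglongrightarrow> L2norm (\<lambda>\<xi>. complex_of_real (h' \<xi>) * G \<xi>)"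
proof -
  note [measurable] = L2_measurable[OF G]
  have 1: "AE \<xi> in lborel. (\<lambda>n. complex_of_real (h n \<xi>) * G \<xi>) \<longlonglongrightarrow> complex_of_real (h' \<xi>) * G \<xi>"
    using lim by eventually_elim (intro tendsto_intros)
  have 2: "AE \<xi> in lborel. norm (complex_of_real (h n \<xi>) * G \<xi>) \<le> norm (G \<xi>)" for n
    by (intro AE_I2) (auto simp: norm_mult b intro!: mult_left_le_one_le)
  have a: "(\<lambda>n. L2norm (\<lambda>\<xi>. complex_of_real (h n \<xi>) * G \<xi> - complex_of_real (h' \<xi>) * G \<xi>)) \<longlonglongrightarrow> 0"
    by (rule L2_dominated_convergence(1)[OF _ _ G 1 2]) measurable
  have b: "(\<lambda>\<xi>. complex_of_real (h' \<xi>) * G \<xi>) \<in> L2"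
    by (rule L2_dominated_convergence(2)[OF _ _ G 1 2]) measurable
  have c: "(\<lambda>\<xi>. complex_of_real (h n \<xi>) * G \<xi>) \<in> L2" for n
    by (rule L2_dominated_convergence(3)[OF _ _ G 1 2]) measurable
  show ?thesis by (rule L2_norm_convergence[OF c b a])
qed

text \<open>Otherwise monotonicity would keep the residual at all integer parameters below \<eta>.
  Its limit has multiplier 1 / (1 + \<psi>^2), greater than 1/2 off the origin because \<psi> < 1
  there, so the limit strictly exceeds half the norm of a nonzero G.\<close>

lemma residual_bounded_set:
  assumes G: "G \<in> L2" and \<eta>: "0 < \<eta>" "\<eta> \<le> L2norm G / 2"
  shows "\<exists>b. \<forall>\<beta>>0. residual G \<beta> < \<eta> \<longrightarrow> \<beta> \<le> b"
proof (rule ccontr)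
  note [measurable] = L2_measurable[OF G]
  assume "\<not> ?thesis"
  then have un: "\<exists>\<beta>>b. 0 < \<beta> \<and> residual G \<beta> < \<eta>" for b by (meson not_le)
  have le: "residual G (real (Suc n)) \<le> \<eta>" for n
  proof -
    obtain \<beta> where "\<beta> > real (Suc n)" "residual G \<beta> < \<eta>" using un by blast
    then show ?thesis using residual_mono[OF G, of "real (Suc n)" \<beta>] by linarith
  qed
  define h where "h \<xi> = 1 / ((\<psi> \<xi>)\<^sup>2 + 1)" for \<xi> :: "real^'n"
  have [measurable]: "h \<in> borel_measurable borel" unfolding h_def by measurable
  have h0: "0 \<le> h \<xi>" "h \<xi> \<le> 1" for \<xi> by (auto simp: h_def divide_le_eq add_nonneg_pos)
  have lim: "AE \<xi> in lborel. (\<lambda>n. \<kappa> (real (Suc n)) \<xi>) \<longlonglongrightarrow> h \<xi>"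
    using m_at_top
  proof eventually_elim
    case (elim \<xi>)
    have "(\<psi> \<xi>)\<^sup>2 + 1\<^sup>2 \<noteq> 0" by (metis add_nonneg_pos less_irrefl one_power2 zero_le_power2 zero_less_one)
    then have "(\<lambda>n. \<kappa> (real (Suc n)) \<xi>) \<longlonglongrightarrow> 1\<^sup>2 / ((\<psi> \<xi>)\<^sup>2 + 1\<^sup>2)"
      unfolding \<kappa>_def by (intro tendsto_intros elim)
    then show ?case by (simp add: h_def)
  qed
  have "(\<lambda>n. residual G (real (Suc n))) \<longlonglongrightarrow> L2norm (\<lambda>\<xi>. complex_of_real (h \<xi>) * G \<xi>)"
    unfolding residual_def
    by (rule L2_multiplier_tendsto[OF G _ _ _ lim]) (auto simp: \<kappa>_nonneg \<kappa>_le1)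
  then have hle: "L2norm (\<lambda>\<xi>. complex_of_real (h \<xi>) * G \<xi>) \<le> L2norm G / 2"
    by (rule LIMSEQ_le_const2) (use order_trans[OF le \<eta>(2)] in blast)
  have hL: "(\<lambda>\<xi>. complex_of_real (h \<xi>) * G \<xi>) \<in> L2"
    by (rule L2_mult_bounded(1)[OF G, where B=1]) (auto simp: h0)
  \<comment> \<open>This difference is nonnegative because \<open>h\<close> is at least 1/2, yet its
    integral is at most 0 by \<open>hle\<close>. It therefore vanishes almost everywhere, which
    forces G = 0 off the origin.\<close>
  let ?f = "\<lambda>\<xi>. (norm (complex_of_real (h \<xi>) * G \<xi>))\<^sup>2 - (norm (G \<xi>))\<^sup>2 / 4"
  have fi: "integrable lborel ?f"
    by (intro Bochner_Integration.integrable_diff L2_integrable hL integrable_divide G)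
  have hh: "1/2 \<le> h \<xi>" for \<xi>
  proof -
    have "(\<psi> \<xi>)\<^sup>2 \<le> 1" using \<psi>_le1[of \<xi>] by (simp add: power_le_one less_imp_le)
    then have "(\<psi> \<xi>)\<^sup>2 + 1 \<le> 2" "0 < (\<psi> \<xi>)\<^sup>2 + 1" by (auto simp: add_nonneg_pos)
    then show ?thesis by (simp add: h_def pos_le_divide_eq)
  qed
  have hh': "1/2 < h \<xi>" if "\<xi> \<noteq> 0" for \<xi>
  proof -
    have "(\<psi> \<xi>)\<^sup>2 < 1" using \<psi>_less1[OF that] by (simp add: power_less_one_iff less_imp_le)
    then have "(\<psi> \<xi>)\<^sup>2 + 1 < 2" "0 < (\<psi> \<xi>)\<^sup>2 + 1" by (auto simp: add_nonneg_pos)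
    then show ?thesis by (simp add: h_def pos_less_divide_eq)
  qed
  have fe: "?f \<xi> = ((h \<xi>)\<^sup>2 - 1/4) * (norm (G \<xi>))\<^sup>2" for \<xi>
    by (simp add: norm_mult power_mult_distrib left_diff_distrib)
  have f0: "0 \<le> ?f \<xi>" for \<xi>
  proof -
    have "(1/2)\<^sup>2 \<le> (h \<xi>)\<^sup>2" using hh[of \<xi>] by (intro power_mono) auto
    then show ?thesis unfolding fe by (intro mult_nonneg_nonneg) (auto simp: power2_eq_square)
  qed
  have "(LINT \<xi>|lborel. ?f \<xi>) = (L2norm (\<lambda>\<xi>. complex_of_real (h \<xi>) * G \<xi>))\<^sup>2 - (L2norm G)\<^sup>2 / 4"
    unfolding L2norm_squared using L2_integrable[OF hL] L2_integrable[OF G] by simp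
  also have "\<dots> \<le> (L2norm G / 2)\<^sup>2 - (L2norm G)\<^sup>2 / 4"
    using power_mono[OF hle, of 2] by simp
  also have "\<dots> = 0" by (simp add: power_divide)
  finally have "(LINT \<xi>|lborel. ?f \<xi>) = 0"
    by (rule antisym) (rule Bochner_Integration.integral_nonneg, rule f0)
  then have "AE \<xi> in lborel. ?f \<xi> = 0"
    using integral_nonneg_eq_0_iff_AE[OF fi] f0 by simp
  moreover have "AE \<xi>::real^'n in lborel. \<xi> \<noteq> 0" using AE_lborel_singleton[of "0::real^'n"] by simp
  ultimately have "AE \<xi> in lborel. G \<xi> = 0"
  proof eventually_elim
    case (elim \<xi>)
    have "(1/2)\<^sup>2 < (h \<xi>)\<^sup>2" using hh'[OF elim(2)] by (intro power_strict_mono) auto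
    then have "(h \<xi>)\<^sup>2 - 1/4 \<noteq> 0" by (simp add: power2_eq_square)
    with elim(1) show ?case unfolding fe by simp
  qed
  then have "L2norm G = L2norm (\<lambda>\<xi>. 0 * G \<xi>)" by (intro L2norm_cong_AE) auto
  then have "L2norm G = 0" by (simp add: L2norm_def)
  then show False using \<eta> by simp
qed

text \<open>The supremum need not belong to its set. The residual there is the limit of residuals at
  smaller parameters, each lying below some member of the set and hence controlled by monotonicity.
  The witness \<open>\<beta>0\<close> shows that the set is nonempty.\<close>

lemma beta_choice_bounds:
  assumes g: "has_fourier_L2 g G" and \<delta>: "0 < \<delta>" "\<delta> + \<delta> powr r \<le> L2norm g / 2"
    and \<beta>0: "0 < \<beta>0" "residual G \<beta>0 < \<delta> + \<delta> powr r"
  shows "\<beta>0 \<le> beta_choice \<tau> T \<gamma> \<phi> \<delta> g r"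
    and "residual G (beta_choice \<tau> T \<gamma> \<phi> \<delta> g r) \<le> \<delta> + \<delta> powr r"
proof -
  note G = has_fourier_L2D(2)[OF g]
  let ?\<eta> = "\<delta> + \<delta> powr r"
  let ?S = "{\<beta>. \<beta> > 0 \<and> residual G \<beta> < ?\<eta>}"
  let ?b = "beta_choice \<tau> T \<gamma> \<phi> \<delta> g r"
  have b: "?b = Sup ?S"
    unfolding beta_choice_def using residual_eq[OF g] by (intro arg_cong[where f=Sup]) auto
  have "0 < ?\<eta>" using \<delta>(1) by (simp add: add_pos_nonneg)
  then have bdd: "bdd_above ?S"
    using residual_bounded_set[OF G, of ?\<eta>] \<delta>(2) has_fourier_L2_Plancherel[OF g]
    by (auto simp: bdd_above_def)
  have mem: "\<beta>0 \<in> ?S" using \<beta>0 by simp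
  show b0: "\<beta>0 \<le> ?b" unfolding b by (rule cSup_upper[OF mem bdd])
  \<comment> \<open>The shift by two starts the sequence at half the supremum, so it is nonnegative
    and stays strictly below the limit.\<close>
  let ?x = "\<lambda>n. ?b - ?b * inverse (real (Suc (Suc n)))"
  have "?x \<longlonglongrightarrow> ?b - ?b * 0"
    by (intro tendsto_diff tendsto_mult tendsto_const LIMSEQ_Suc[OF LIMSEQ_inverse_real_of_nat])
  then have lim: "?x \<longlonglongrightarrow> ?b" by (simp only: mult_zero_right diff_zero)
  have "residual G (?x n) \<le> ?\<eta>" for n
  proof -
    have "inverse (real (Suc (Suc n))) \<le> 1" "0 < inverse (real (Suc (Suc n)))" by (auto simp: field_simps)
    then have x: "0 \<le> ?x n" "?x n < ?b"
      using b0 \<beta>0(1) by (auto simp: mult_le_cancel_left1 simp del: of_nat_Suc)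
    then obtain \<beta> where "\<beta> \<in> ?S" "?x n < \<beta>"
      unfolding b using less_cSup_iff[of ?S "?x n"] mem bdd by (auto simp: b)
    then show ?thesis using residual_mono[OF G x(1), of \<beta>] by auto
  qed
  moreover have "(\<lambda>n. residual G (?x n)) \<longlonglongrightarrow> residual G ?b"
    unfolding residual_def
    by (rule L2_multiplier_tendsto[OF G _ _ _ AE_I2[OF \<kappa>_tendsto[OF lim]]]) (auto simp: \<kappa>_nonneg \<kappa>_le1)
  ultimately show "residual G ?b \<le> ?\<eta>" by (intro LIMSEQ_le_const2) auto
qed

end

section \<open>Error estimate\<close>

context heat_mollification
begin

abbreviation misfit :: "(real^'n \<Rightarrow> complex) \<Rightarrow> (real^'n \<Rightarrow> complex) \<Rightarrow> real" where
  "misfit g u \<equiv> L2norm (\<lambda>x. heat_op \<tau> T \<gamma> u x - g x)"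

abbreviation reg_error ::
    "real \<Rightarrow> real \<Rightarrow> (real^'n \<Rightarrow> complex) \<Rightarrow> (real^'n \<Rightarrow> complex) \<Rightarrow> real" where
  "reg_error r \<delta> g u \<equiv> L2norm (\<lambda>x. u x - reg_solution \<tau> T \<gamma> \<phi> (beta_choice \<tau> T \<gamma> \<phi> \<delta> g r) g x)"

text \<open>The body of \<open>error_bound\<close> with a right-hand side that may depend on the
  exact solution, as the Sobolev tail does.\<close>

abbreviation eventually_le ::
    "real \<Rightarrow> (real^'n \<Rightarrow> complex) set \<Rightarrow> ((real^'n \<Rightarrow> complex) \<Rightarrow> real \<Rightarrow> real) \<Rightarrow> bool" where
  "eventually_le r U f \<equiv> eventually (\<lambda>\<delta>. \<forall>u\<in>U. \<forall>g\<in>L2.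
     misfit g u \<le> \<delta> \<and> \<delta> + \<delta> powr r \<le> L2norm g / 2 \<longrightarrow> reg_error r \<delta> g u \<le> f u \<delta>) (at_right 0)"

abbreviation weighted :: "real \<Rightarrow> (real^'n \<Rightarrow> complex) \<Rightarrow> real^'n \<Rightarrow> complex" where
  "weighted p U \<equiv> (\<lambda>\<xi>. complex_of_real ((1 + (norm \<xi>)\<^sup>2) powr (p / 2)) * U \<xi>)"

definition sobolev_tail :: "real \<Rightarrow> (real^'n \<Rightarrow> complex) \<Rightarrow> real \<Rightarrow> real" where
  "sobolev_tail p U R =
     L2norm (\<lambda>\<xi>. complex_of_real (indicator {\<zeta>. R < norm \<zeta>} \<xi>) * (complex_of_real ((1 + (norm \<xi>)\<^sup>2) powr (p / 2)) * U \<xi>))"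

lemma sobolev_tail_le:
  assumes "weighted p U \<in> L2"
  shows "sobolev_tail p U R \<le> L2norm (weighted p U)"
  unfolding sobolev_tail_def
  using L2_mult_bounded(2)[OF assms, of "\<lambda>\<xi>. complex_of_real (indicator {\<zeta>. R < norm \<zeta>} \<xi>)" 1]
  by (auto simp: indicator_def)

text \<open>Dominated convergence for a single function. The decay is not uniform over a Sobolev
  ball, which is why balls use the constant bound \<open>sobolev_tail_le\<close> instead.\<close>

lemma sobolev_tail_tendsto:
  assumes "weighted p U \<in> L2"
  shows "(sobolev_tail p U \<longlongrightarrow> 0) at_top"
proof (rule tendsto_at_topI_sequentially)
  fix X :: "nat \<Rightarrow> real" assume X: "filterlim X at_top sequentially"
  let ?W = "\<lambda>\<xi>. complex_of_real ((1 + (norm \<xi>)\<^sup>2) powr (p / 2)) * U \<xi>"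
  have "(\<lambda>n. sobolev_tail p U (X n)) \<longlonglongrightarrow> L2norm (\<lambda>\<xi>. complex_of_real ((\<lambda>_. 0) \<xi>) * ?W \<xi>)"
    unfolding sobolev_tail_def
  proof (rule L2_multiplier_tendsto[OF assms])
    show "AE \<xi>::real^'n in lborel. (\<lambda>n. indicator {\<zeta>. X n < norm \<zeta>} \<xi> :: real) \<longlonglongrightarrow> 0"
    proof (intro AE_I2 tendsto_eventually)
      fix \<xi> :: "real^'n"
      from X have "eventually (\<lambda>n. X n \<ge> norm \<xi>) sequentially" by (simp add: filterlim_at_top)
      then show "\<forall>\<^sub>F n in sequentially. indicator {\<zeta>. X n < norm \<zeta>} \<xi> = (0::real)"
        by eventually_elim (simp add: indicator_def)
    qed
  qed (auto simp: indicator_def)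
  then show "(\<lambda>n. sobolev_tail p U (X n)) \<longlonglongrightarrow> 0" by (simp add: L2norm_def)
qed

text \<open>\<open>M\<close> and \<open>K\<close> are fixed before p, E and the solution, so they
  cannot spoil the independence of the final constants from \<rho>. The radius R is left free; the
  exponential is the price of dividing by \<psi> on the frequencies below R.\<close>

lemma error_estimate:
  assumes r: "0 < r" "r < 1"
  shows "\<exists>M>0. \<exists>K>0. \<forall>p>0. \<forall>E>0. \<forall>u U g \<delta> R. has_fourier_L2 u U \<longrightarrow> L2norm U \<le> E \<longrightarrow>
    (weighted p U) \<in> L2 \<longrightarrow> g \<in> L2 \<longrightarrow> 0 < \<delta> \<longrightarrow>
    misfit g u \<le> \<delta> \<longrightarrow> \<delta> + \<delta> powr r \<le> L2norm g / 2 \<longrightarrow> 0 < R \<longrightarrow>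
    reg_error r \<delta> g u
      \<le> M * (1 + (K * E / \<delta> powr r) powr (2 / (1 + r))) * \<delta>
        + (2 * \<delta> + \<delta> powr r) * exp (B * R powr (2 * \<tau>)) + R powr (- p) * sobolev_tail p U R"
proof -
  \<comment> \<open>The midpoint of r and 1. With \<beta> of order \<delta>^(r / (a s)), the noise
    term \<delta> \<beta>^(- s) has exponent 1 - r / a, which is positive because a > r, while a < 1
    is required by \<open>\<kappa>\<psi>_bound\<close>.\<close>
  define a where "a = (1 + r) / 2"
  have a: "0 < a" "a < 1" "1 / a = 2 / (1 + r)" using r by (auto simp: a_def)
  obtain M where M: "M > 0" "\<And>\<beta> \<xi>. \<beta> > 0 \<Longrightarrow> k \<beta> \<xi> \<le> M * (1 + \<beta> powr (- s))"
    using k_bound by blast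
  obtain K where K: "K > 0" "\<And>\<beta> \<xi>. \<beta> > 0 \<Longrightarrow> \<kappa> \<beta> \<xi> * \<psi> \<xi> \<le> K * \<beta> powr (a * s)"
    using \<kappa>\<psi>_bound[OF a(1,2)] by blast
  have "reg_error r \<delta> g u
      \<le> M * (1 + (2 * K * E / \<delta> powr r) powr (2 / (1 + r))) * \<delta>
        + (2 * \<delta> + \<delta> powr r) * exp (B * R powr (2 * \<tau>)) + R powr (- p) * sobolev_tail p U R"
    if p: "p > 0" and E: "E > 0" and u: "has_fourier_L2 u U" and UE: "L2norm U \<le> E"
      and W: "weighted p U \<in> L2" and gL: "g \<in> L2" and \<delta>: "0 < \<delta>"
      and noise: "misfit g u \<le> \<delta>" and g\<delta>: "\<delta> + \<delta> powr r \<le> L2norm g / 2"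
      and R: "0 < R"
    for p E u U g \<delta> R
  proof -
    define G where "G = fourier_L2 g"
    have g: "has_fourier_L2 g G" unfolding G_def by (rule fourier_L2[OF gL])
    note UL = has_fourier_L2D(2)[OF u] and GL = has_fourier_L2D(2)[OF g]
    note [measurable] = L2_measurable[OF UL] L2_measurable[OF GL] L2_measurable[OF W]
    let ?\<eta> = "\<delta> + \<delta> powr r"
    let ?N = "\<lambda>\<xi>. complex_of_real (\<psi> \<xi>) * U \<xi> - G \<xi>"
    note hN = has_fourier_L2_diff[OF has_fourier_L2_heat_op[OF u] g]
    have NL: "?N \<in> L2" using hN by (rule has_fourier_L2D)
    have N\<delta>: "L2norm ?N \<le> \<delta>" using noise has_fourier_L2_Plancherel[OF hN] by simp
    have \<psi>U: "(\<lambda>\<xi>. complex_of_real (\<psi> \<xi>) * U \<xi>) \<in> L2"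
      using has_fourier_L2D(2)[OF has_fourier_L2_heat_op[OF u]] .
    \<comment> \<open>Chosen so that K \<beta>0^(a s) E equals half of \<delta>^r. The other half is
      the slack that makes the residual inequality at \<beta>0 strict.\<close>
    define \<beta>0 where "\<beta>0 = (\<delta> powr r / (2 * K * E)) powr (1 / (a * s))"
    have \<beta>0: "\<beta>0 > 0" using \<delta> K(1) E by (simp add: \<beta>0_def)
    have as: "a * s \<noteq> 0" using a(1) s by simp
    have \<beta>0_as: "\<beta>0 powr (a * s) = \<delta> powr r / (2 * K * E)"
      unfolding \<beta>0_def powr_powr using as \<delta> K(1) E by simp
    have \<beta>0_s: "\<beta>0 powr (- s) = (2 * K * E / \<delta> powr r) powr (2 / (1 + r))"
    proof -
      have "\<beta>0 powr (- s) = (\<delta> powr r / (2 * K * E)) powr (- (1 / a))"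
        unfolding \<beta>0_def powr_powr using a(1) s by simp
      also have "\<dots> = (2 * K * E / \<delta> powr r) powr (1 / a)"
        using \<delta> K(1) E by (simp add: powr_minus_divide powr_divide)
      finally show ?thesis by (simp add: a(3))
    qed
    have "residual G \<beta>0 \<le> L2norm (\<lambda>\<xi>. complex_of_real (\<kappa> \<beta>0 \<xi>) * (complex_of_real (\<psi> \<xi>) * U \<xi>))
        + L2norm (\<lambda>\<xi>. complex_of_real (\<kappa> \<beta>0 \<xi>) * ?N \<xi>)"
    proof -
      have "residual G \<beta>0 = L2norm (\<lambda>\<xi>. complex_of_real (\<kappa> \<beta>0 \<xi>) * (complex_of_real (\<psi> \<xi>) * U \<xi>) - complex_of_real (\<kappa> \<beta>0 \<xi>) * ?N \<xi>)"
        unfolding residual_def by (simp add: right_diff_distrib)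
      also have "\<dots> \<le> L2norm (\<lambda>\<xi>. complex_of_real (\<kappa> \<beta>0 \<xi>) * (complex_of_real (\<psi> \<xi>) * U \<xi>)) + L2norm (\<lambda>\<xi>. complex_of_real (\<kappa> \<beta>0 \<xi>) * ?N \<xi>)"
        by (rule L2_diff(2)[OF \<kappa>G_L2(1)[OF \<psi>U] \<kappa>G_L2(1)[OF NL]])
      finally show ?thesis .
    qed
    also have "L2norm (\<lambda>\<xi>. complex_of_real (\<kappa> \<beta>0 \<xi>) * ?N \<xi>) \<le> \<delta>"
      using \<kappa>G_L2(2)[OF NL] N\<delta> by (rule order_trans)
    also have "L2norm (\<lambda>\<xi>. complex_of_real (\<kappa> \<beta>0 \<xi>) * (complex_of_real (\<psi> \<xi>) * U \<xi>)) \<le> \<delta> powr r / 2"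
    proof -
      have "L2norm (\<lambda>\<xi>. complex_of_real (\<kappa> \<beta>0 \<xi> * \<psi> \<xi>) * U \<xi>) \<le> (K * \<beta>0 powr (a * s)) * L2norm U"
      proof (rule L2_mult_bounded(2)[OF UL])
        show "norm (complex_of_real (\<kappa> \<beta>0 \<xi> * \<psi> \<xi>)) \<le> K * \<beta>0 powr (a * s)" for \<xi>
          unfolding norm_of_real using K(2)[OF \<beta>0, of \<xi>]
          by (simp add: abs_mult \<kappa>_nonneg less_imp_le)
      qed measurable
      also have "\<dots> \<le> (K * \<beta>0 powr (a * s)) * E" using UE K(1) by (intro mult_left_mono) auto
      also have "\<dots> = \<delta> powr r / 2" unfolding \<beta>0_as using K(1) E by simp
      finally show ?thesis by (simp add: mult.assoc)
    qed
    finally have "residual G \<beta>0 \<le> \<delta> powr r / 2 + \<delta>" by simp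
    moreover have "0 < \<delta> powr r" using \<delta> by simp
    ultimately have res0: "residual G \<beta>0 < ?\<eta>" by linarith
    define b where "b = beta_choice \<tau> T \<gamma> \<phi> \<delta> g r"
    have b0: "\<beta>0 \<le> b" and resb: "residual G b \<le> ?\<eta>"
      unfolding b_def using beta_choice_bounds[OF g \<delta> g\<delta> \<beta>0 res0] by auto
    have b: "b > 0" using b0 \<beta>0 by linarith
    have "b powr (- s) \<le> \<beta>0 powr (- s)" using b0 \<beta>0 s by (intro powr_mono2') auto
    then have kM: "k b \<xi> \<le> M * (1 + (2 * K * E / \<delta> powr r) powr (2 / (1 + r)))" for \<xi>
      using M(2)[OF b, of \<xi>] M(1) unfolding \<beta>0_s
      by (meson add_left_mono less_imp_le mult_left_mono order_trans)
    let ?A = "M * (1 + (2 * K * E / \<delta> powr r) powr (2 / (1 + r)))"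
    let ?kN = "\<lambda>\<xi>. complex_of_real (k b \<xi>) * ?N \<xi>"
    have kN: "?kN \<in> L2" "L2norm ?kN \<le> ?A * L2norm ?N"
      using kM by (auto intro!: L2_mult_bounded[OF NL] simp: k_nonneg)
    have A0: "0 \<le> ?A" using M(1) by (intro mult_nonneg_nonneg add_nonneg_nonneg) auto
    have kN\<delta>: "L2norm ?kN \<le> ?A * \<delta>" using kN(2) mult_left_mono[OF N\<delta> A0] by linarith
    let ?\<kappa>U = "\<lambda>\<xi>. complex_of_real (\<kappa> b \<xi>) * U \<xi>"
    let ?i = "\<lambda>\<xi>. indicator {\<zeta>. R < norm \<zeta>} \<xi> :: real"
    have \<kappa>U: "?\<kappa>U \<in> L2" by (rule \<kappa>G_L2(1)[OF UL])
    let ?lo = "\<lambda>\<xi>. complex_of_real ((1 - ?i \<xi>) * \<kappa> b \<xi>) * U \<xi>" and ?hi = "\<lambda>\<xi>. complex_of_real (?i \<xi> * \<kappa> b \<xi>) * U \<xi>"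
    let ?e = "exp (B * R powr (2 * \<tau>))"
    have mn: "(\<lambda>\<xi>. complex_of_real (\<kappa> b \<xi>) * (complex_of_real (\<psi> \<xi>) * U \<xi>)) \<in> L2"
      by (rule \<kappa>G_L2(1)[OF \<psi>U])
    \<comment> \<open>Since \<psi> U is the sum of G and \<open>?N\<close>, this is the residual at
      the selected parameter plus noise damped by \<kappa>.\<close>
    have "L2norm (\<lambda>\<xi>. complex_of_real (\<kappa> b \<xi>) * (complex_of_real (\<psi> \<xi>) * U \<xi>)) \<le> 2 * \<delta> + \<delta> powr r"
    proof -
      have "L2norm (\<lambda>\<xi>. complex_of_real (\<kappa> b \<xi>) * (complex_of_real (\<psi> \<xi>) * U \<xi>))
         = L2norm (\<lambda>\<xi>. complex_of_real (\<kappa> b \<xi>) * G \<xi> + complex_of_real (\<kappa> b \<xi>) * ?N \<xi>)"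
        by (simp add: right_diff_distrib)
      also have "\<dots> \<le> residual G b + L2norm (\<lambda>\<xi>. complex_of_real (\<kappa> b \<xi>) * ?N \<xi>)"
        unfolding residual_def by (rule L2_add(2)[OF \<kappa>G_L2(1)[OF GL] \<kappa>G_L2(1)[OF NL]])
      also have "\<dots> \<le> ?\<eta> + \<delta>"
        using resb \<kappa>G_L2(2)[OF NL, of b] N\<delta> by linarith
      finally show ?thesis by simp
    qed
    note low\<psi> = this
    have lo: "?lo \<in> L2 \<and> L2norm ?lo \<le> ?e * (2 * \<delta> + \<delta> powr r)"
    proof -
      \<comment> \<open>Undoes the smoothing by \<psi> on the frequencies up to R, where 1 / \<psi>
        is at most \<open>?e\<close>.\<close>
      define h where "h \<xi> = (1 - ?i \<xi>) / \<psi> \<xi>" for \<xi>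
      have [measurable]: "h \<in> borel_measurable borel" unfolding h_def by measurable
      have hb: "norm (complex_of_real (h \<xi>)) \<le> ?e" for \<xi>
      proof (cases "R < norm \<xi>")
        case False
        then have "1 / \<psi> \<xi> \<le> 1 / exp (- (B * R powr (2 * \<tau>)))"
          by (intro divide_left_mono \<psi>_lower) auto
        then show ?thesis unfolding norm_of_real using False
          by (simp add: h_def exp_minus divide_inverse less_imp_le)
      qed (simp add: h_def)
      have eq: "?lo = (\<lambda>\<xi>. complex_of_real (h \<xi>) * (complex_of_real (\<kappa> b \<xi>) * (complex_of_real (\<psi> \<xi>) * U \<xi>)))"
        by (simp add: h_def fun_eq_iff)
      have "L2norm ?lo \<le> ?e * L2norm (\<lambda>\<xi>. complex_of_real (\<kappa> b \<xi>) * (complex_of_real (\<psi> \<xi>) * U \<xi>))"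
        unfolding eq by (rule L2_mult_bounded(2)[OF mn _ hb]) simp
      also have "\<dots> \<le> ?e * (2 * \<delta> + \<delta> powr r)" by (intro mult_left_mono low\<psi>) simp
      finally show ?thesis using L2_mult_bounded(1)[OF mn _ hb] unfolding eq by simp
    qed
    have hi: "?hi \<in> L2 \<and> L2norm ?hi \<le> R powr (- p) * sobolev_tail p U R"
    proof -
      define w where "w \<xi> = (1 + (norm \<xi>)\<^sup>2) powr (p / 2)" for \<xi> :: "real^'n"
      have [measurable]: "w \<in> borel_measurable borel" unfolding w_def by measurable
      have wp: "w \<xi> > 0" for \<xi>
      proof -
        have "0 < 1 + (norm \<xi>)\<^sup>2" by (intro add_pos_nonneg) auto
        then show ?thesis by (simp add: w_def)
      qed
      have tl: "(\<lambda>\<xi>. complex_of_real (?i \<xi>) * (complex_of_real (w \<xi>) * U \<xi>)) \<in> L2"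
        using W unfolding w_def[symmetric]
        by (rule L2_mult_bounded(1)[where B=1]) (auto simp: indicator_def)
      define h where "h \<xi> = ?i \<xi> * \<kappa> b \<xi> / w \<xi>" for \<xi>
      have [measurable]: "h \<in> borel_measurable borel" unfolding h_def by measurable
      have hb: "norm (complex_of_real (h \<xi>)) \<le> R powr (- p)" for \<xi>
      proof (cases "R < norm \<xi>")
        case True
        have "R powr p = (R\<^sup>2) powr (p / 2)" using R by (simp add: powr_powr flip: powr_numeral)
        also have "\<dots> \<le> w \<xi>" unfolding w_def
        proof (intro powr_mono2)
          have "R\<^sup>2 \<le> (norm \<xi>)\<^sup>2" using True R by (intro power_mono) auto
          then show "R\<^sup>2 \<le> 1 + (norm \<xi>)\<^sup>2" by simp
        qed (use p in auto)
        finally have "R powr p \<le> w \<xi>" .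
        then have "\<kappa> b \<xi> / w \<xi> \<le> 1 / R powr p"
          using R wp by (intro frac_le) (auto simp: \<kappa>_le1)
        then show ?thesis using True wp[of \<xi>]
          by (simp add: h_def \<kappa>_nonneg powr_minus_divide less_imp_le norm_divide)
      qed (simp add: h_def)
      have eq: "?hi = (\<lambda>\<xi>. complex_of_real (h \<xi>) * (complex_of_real (?i \<xi>) * (complex_of_real (w \<xi>) * U \<xi>)))"
      proof
        fix \<xi> show "?hi \<xi> = complex_of_real (h \<xi>) * (complex_of_real (?i \<xi>) * (complex_of_real (w \<xi>) * U \<xi>))"
          using wp[of \<xi>] by (cases "R < norm \<xi>") (auto simp: h_def)
      qed
      show ?thesis unfolding eq sobolev_tail_def w_def[symmetric]
        using L2_mult_bounded[OF tl _ hb] by simp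
    qed
    have \<kappa>Ue: "L2norm ?\<kappa>U \<le> ?e * (2 * \<delta> + \<delta> powr r) + R powr (- p) * sobolev_tail p U R"
    proof -
      have "?\<kappa>U = (\<lambda>\<xi>. ?lo \<xi> + ?hi \<xi>)" by (simp add: algebra_simps fun_eq_iff)
      then have "L2norm ?\<kappa>U \<le> L2norm ?lo + L2norm ?hi" using L2_add(2)[OF conjunct1[OF lo] conjunct1[OF hi]] by simp
      then show ?thesis using lo hi by linarith
    qed
    \<comment> \<open>With G = \<psi> U - N and 1 - \<psi> k = \<kappa>, the error U - k G splits
      into the approximation part \<kappa> U and the propagated noise k N.\<close>
    have "L2norm (\<lambda>x. u x - reg_solution \<tau> T \<gamma> \<phi> b g x) = L2norm (\<lambda>\<xi>. U \<xi> - complex_of_real (k b \<xi>) * G \<xi>)"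
      using has_fourier_L2_Plancherel[OF has_fourier_L2_diff[OF u has_fourier_L2_reg_solution[OF g b]]] by simp
    also have "\<dots> = L2norm (\<lambda>\<xi>. ?\<kappa>U \<xi> + ?kN \<xi>)"
      by (simp add: \<kappa>_eq algebra_simps)
    also have "\<dots> \<le> L2norm ?\<kappa>U + L2norm ?kN" by (rule L2_add(2)[OF \<kappa>U kN(1)])
    also have "\<dots> \<le> ?A * \<delta> + (2 * \<delta> + \<delta> powr r) * ?e + R powr (- p) * sobolev_tail p U R"
      using \<kappa>Ue kN\<delta> by (simp add: mult.commute)
    finally show ?thesis unfolding b_def .
  qed
  then show ?thesis using M(1) K(1) by (intro exI[of _ M] conjI exI[of _ "2 * K"]) auto
qed

section \<open>Rates\<close>

definition lograte :: "real \<Rightarrow> real \<Rightarrow> real \<Rightarrow> real" where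
  "lograte p \<rho> \<delta> = f_log (p / (2 * \<tau>)) (\<delta>\<^sup>2 / \<rho>\<^sup>2)"

lemma lograte_range:
  assumes "\<rho> > 0" "p > 0"
  shows "eventually (\<lambda>\<delta>. 0 < lograte p \<rho> \<delta> \<and> lograte p \<rho> \<delta> \<le> 1) (at_right 0)"
proof -
  have "eventually (\<lambda>\<delta>::real. - ln (\<delta>\<^sup>2/\<rho>\<^sup>2) > 1) (at_right 0)" using assms by real_asymp
  then show ?thesis
  proof eventually_elim
    case (elim \<delta>)
    then have "(- ln (\<delta>\<^sup>2/\<rho>\<^sup>2)) powr (- (p / (2 * \<tau>))) \<le> (- ln (\<delta>\<^sup>2/\<rho>\<^sup>2)) powr 0"
      using assms \<tau> by (intro powr_mono) auto
    then show ?case using elim by (simp add: lograte_def f_log_def)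
  qed
qed

text \<open>The solution R of B R^(2 \<tau>) = (r / 2) ln (1 / \<delta>). Dividing a residual of
  order \<delta>^r by \<delta>^(r / 2) still leaves a positive power of \<delta>, while R grows like
  a power of the logarithm.\<close>

definition cutoff :: "real \<Rightarrow> real \<Rightarrow> real" where
  "cutoff r \<delta> = (r / (2 * B) * ln (1 / \<delta>)) powr (1 / (2 * \<tau>))"

lemma cutoff_at_top: "0 < r \<Longrightarrow> filterlim (cutoff r) at_top (at_right 0)"
proof -
  assume r: "0 < r"
  define c v where "c = r / (2 * B)" and "v = 1 / (2 * \<tau>)"
  have "c > 0" "v > 0" using r B_pos \<tau> by (auto simp: c_def v_def)
  then have "filterlim (\<lambda>\<delta>::real. (c * ln (1 / \<delta>)) powr v) at_top (at_right 0)" by real_asymp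
  then show ?thesis unfolding c_def v_def cutoff_def[abs_def] .
qed

text \<open>Both quantities are powers of logarithms with the same exponent, so only the ratio of
  the logarithms matters. The contribution of \<rho> to it is bounded and vanishes in the limit,
  which makes the constant independent of \<rho>.\<close>

lemma cutoff_rate:
  assumes r: "0 < r" and \<rho>: "\<rho> > 0"
  shows "((\<lambda>\<delta>. cutoff r \<delta> powr (- p) / lograte p \<rho> \<delta>) \<longlongrightarrow> (4 * B / r) powr (p / (2 * \<tau>))) (at_right 0)"
proof -
  define c where "c = r / (2 * B)"
  have c: "c > 0" using r B_pos by (simp add: c_def)
  have "((\<lambda>\<delta>::real. (- ln (\<delta>\<^sup>2/\<rho>\<^sup>2)) / (c * ln (1 / \<delta>))) \<longlongrightarrow> 2 * inverse c) (at_right 0)"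
    using c \<rho> by real_asymp
  then have lim: "((\<lambda>\<delta>::real. ((- ln (\<delta>\<^sup>2/\<rho>\<^sup>2)) / (c * ln (1 / \<delta>))) powr (p / (2 * \<tau>))) \<longlongrightarrow> (2 * inverse c) powr (p / (2 * \<tau>))) (at_right 0)"
    using c by (intro tendsto_powr tendsto_const) auto
  have cc: "2 * inverse c = 4 * B / r" using r B_pos by (simp add: c_def field_simps)
  have quot: "x powr (- y) / z powr (- y) = z powr y / x powr y" for x y z :: real
    unfolding powr_minus by (simp add: divide_inverse)
  have ev: "eventually (\<lambda>\<delta>. ((- ln (\<delta>\<^sup>2/\<rho>\<^sup>2)) / (c * ln (1 / \<delta>))) powr (p / (2 * \<tau>)) = cutoff r \<delta> powr (- p) / lograte p \<rho> \<delta>) (at_right 0)"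
  proof -
    have "eventually (\<lambda>\<delta>::real. - ln (\<delta>\<^sup>2/\<rho>\<^sup>2) > 1) (at_right 0)" using \<rho> by real_asymp
    moreover have "eventually (\<lambda>\<delta>::real. ln (1 / \<delta>) > 0) (at_right 0)" by real_asymp
    ultimately show ?thesis
    proof eventually_elim
      case (elim \<delta>)
      have "cutoff r \<delta> powr (- p) / lograte p \<rho> \<delta> = (c * ln (1 / \<delta>)) powr (- (p / (2 * \<tau>))) / (- ln (\<delta>\<^sup>2/\<rho>\<^sup>2)) powr (- (p / (2 * \<tau>)))"
        by (simp add: cutoff_def c_def lograte_def f_log_def powr_powr)
      also have "\<dots> = (- ln (\<delta>\<^sup>2/\<rho>\<^sup>2)) powr (p / (2 * \<tau>)) / (c * ln (1 / \<delta>)) powr (p / (2 * \<tau>))"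
        by (rule quot)
      also have "\<dots> = ((- ln (\<delta>\<^sup>2/\<rho>\<^sup>2)) / (c * ln (1 / \<delta>))) powr (p / (2 * \<tau>))"
        by (rule powr_divide[symmetric])
      finally show ?case by simp
    qed
  qed
  show ?thesis using Lim_transform_eventually[OF lim ev] unfolding cc .
qed

text \<open>The part of the estimate at the cutoff that is common to all solutions in a Sobolev
  ball; only the tail term is left out.\<close>

definition noise_part :: "real \<Rightarrow> real \<Rightarrow> real \<Rightarrow> real \<Rightarrow> real \<Rightarrow> real" where
  "noise_part M K E r \<delta> = M * (1 + (K * E / \<delta> powr r) powr (2 / (1 + r))) * \<delta>
        + (2 * \<delta> + \<delta> powr r) * exp (B * cutoff r \<delta> powr (2 * \<tau>))"

text \<open>At the cutoff the expression is a combination of powers of \<delta> with exponents 1, 1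
  - 2 r / (1 + r), 1 - r / 2 and r / 2. All are positive because 0 < r < 1, and every such power
  beats a power of the logarithm.\<close>

lemma noise_part_rate:
  assumes r: "0 < r" "r < 1" and \<rho>: "\<rho> > 0" and p: "p > 0" and KE: "K > 0" "E > 0"
  shows "((\<lambda>\<delta>. noise_part M K E r \<delta> / lograte p \<rho> \<delta>) \<longlongrightarrow> 0) (at_right 0)"
proof -
  define q where "q = p / (2 * \<tau>)"
  have q: "q > 0" using p \<tau> by (simp add: q_def)
  have L: "((\<lambda>\<delta>::real. \<delta> powr x * (- ln (\<delta>\<^sup>2/\<rho>\<^sup>2)) powr q) \<longlongrightarrow> 0) (at_right 0)" if "x > 0" for x
    using that \<rho> q by real_asymp
  let ?z = "2 / (1 + r)"
  let ?l = "\<lambda>\<delta>. (- ln (\<delta>\<^sup>2/\<rho>\<^sup>2)) powr q"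
  have ex: "1 - r * ?z > 0" "1 - r / 2 > 0" "r / 2 > 0" using r by (auto simp: field_simps)
  have lim: "((\<lambda>\<delta>::real. M * (\<delta> powr 1 * ?l \<delta>) + M * (K * E) powr ?z * (\<delta> powr (1 - r * ?z) * ?l \<delta>)
      + 2 * (\<delta> powr (1 - r / 2) * ?l \<delta>) + \<delta> powr (r / 2) * ?l \<delta>) \<longlongrightarrow> M * 0 + M * (K * E) powr ?z * 0 + 2 * 0 + 0) (at_right 0)"
    using ex by (intro tendsto_intros L) auto
  have ev: "eventually (\<lambda>\<delta>. M * (\<delta> powr 1 * ?l \<delta>) + M * (K * E) powr ?z * (\<delta> powr (1 - r * ?z) * ?l \<delta>)
      + 2 * (\<delta> powr (1 - r / 2) * ?l \<delta>) + \<delta> powr (r / 2) * ?l \<delta> = noise_part M K E r \<delta> / lograte p \<rho> \<delta>) (at_right 0)"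
  proof -
    have "eventually (\<lambda>\<delta>::real. ln (1 / \<delta>) > 0) (at_right 0)" by real_asymp
    moreover have "eventually (\<lambda>\<delta>::real. \<delta> > 0) (at_right 0)" by (rule eventually_at_right_less)
    ultimately show ?thesis
    proof eventually_elim
      case (elim \<delta>)
      note l = elim(1) and \<delta> = elim(2)
      have "cutoff r \<delta> powr (2 * \<tau>) = r / (2 * B) * ln (1 / \<delta>)"
        unfolding cutoff_def powr_powr using \<tau> r B_pos l by simp
      then have "B * cutoff r \<delta> powr (2 * \<tau>) = - (r / 2) * ln \<delta>"
        using B_pos \<delta> by (simp add: ln_div)
      then have e: "exp (B * cutoff r \<delta> powr (2 * \<tau>)) = \<delta> powr (- (r / 2))"
        using \<delta> by (simp add: powr_def)
      have e1: "\<delta> * \<delta> powr (- (r / 2)) = \<delta> powr (1 - r / 2)"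
        using \<delta> powr_add[of \<delta> 1 "- (r / 2)"] by simp
      have e2: "\<delta> powr r * \<delta> powr (- (r / 2)) = \<delta> powr (r / 2)" by (simp flip: powr_add)
      have "(K * E / \<delta> powr r) powr ?z = (K * E) powr ?z * \<delta> powr (- (r * ?z))"
        by (simp only: powr_divide powr_powr powr_minus_divide times_divide_eq_right mult_1_right)
      moreover have "\<delta> powr (- (r * ?z)) * \<delta> = \<delta> powr (1 - r * ?z)"
        using \<delta> powr_add[of \<delta> "- (r * ?z)" 1] by simp
      ultimately have e3: "(K * E / \<delta> powr r) powr ?z * \<delta> = (K * E) powr ?z * \<delta> powr (1 - r * ?z)" by simp
      have "noise_part M K E r \<delta> = M * \<delta> + M * ((K * E / \<delta> powr r) powr ?z * \<delta>) + 2 * (\<delta> * \<delta> powr (- (r / 2))) + \<delta> powr r * \<delta> powr (- (r / 2))"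
        unfolding noise_part_def e by (simp add: algebra_simps)
      also have "\<dots> = M * \<delta> powr 1 + M * ((K * E) powr ?z * \<delta> powr (1 - r * ?z)) + 2 * \<delta> powr (1 - r / 2) + \<delta> powr (r / 2)"
        unfolding e1 e2 e3 using \<delta> by simp
      finally have n: "noise_part M K E r \<delta> = M * \<delta> powr 1 + M * ((K * E) powr ?z * \<delta> powr (1 - r * ?z)) + 2 * \<delta> powr (1 - r / 2) + \<delta> powr (r / 2)" .
      have d: "x / lograte p \<rho> \<delta> = x * ?l \<delta>" for x
        unfolding lograte_def f_log_def q_def[symmetric] powr_minus
        by (simp only: divide_inverse inverse_inverse_eq)
      show ?case unfolding n d by (simp add: algebra_simps)
    qed
  qed
  show ?thesis using Lim_transform_eventually[OF lim ev] by simp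
qed

section \<open>Asymptotic error bounds on balls and for fixed solutions\<close>

lemma error_boundI:
  assumes e: "(e \<longlongrightarrow> 0) (at_right 0)"
    and b: "eventually_le r U (\<lambda>u \<delta>. b \<delta> * (1 + e \<delta>))"
  shows "error_bound \<tau> T \<gamma> \<phi> r U b"
  unfolding error_bound_def
proof (rule bexI[of _ e])
  show "e \<in> o[at_right 0](\<lambda>_. 1)" using e by (intro smalloI_tendsto) auto
qed (rule b)

text \<open>The same o(1) term can be kept: it eventually exceeds -1, so multiplication by 1 + o(1)
  preserves the inequality between the two bounds.\<close>

lemma error_bound_mono:
  assumes eb: "error_bound \<tau> T \<gamma> \<phi> r U b" and le: "eventually (\<lambda>\<delta>. b \<delta> \<le> b' \<delta>) (at_right 0)"
  shows "error_bound \<tau> T \<gamma> \<phi> r U b'"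
proof -
  obtain e where e: "e \<in> o[at_right 0](\<lambda>_. 1)" and
    b: "eventually_le r U (\<lambda>u \<delta>. b \<delta> * (1 + e \<delta>))"
    using eb unfolding error_bound_def by blast
  have e0: "(e \<longlongrightarrow> 0) (at_right 0)" using smalloD_tendsto[OF e] by simp
  have e1: "eventually (\<lambda>\<delta>. e \<delta> > -1) (at_right 0)" by (rule order_tendstoD[OF e0]) simp
  show ?thesis
  proof (rule error_boundI[OF e0])
    show "eventually_le r U (\<lambda>u \<delta>. b' \<delta> * (1 + e \<delta>))"
      using b le e1
    proof eventually_elim
      case (elim \<delta>)
    have "b \<delta> * (1 + e \<delta>) \<le> b' \<delta> * (1 + e \<delta>)" using elim by (intro mult_right_mono) auto
    note le = this
    show ?case
    proof (intro ballI impI)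
      fix u g :: "real^'n \<Rightarrow> complex" assume "u \<in> U" "g \<in> L2"
        "misfit g u \<le> \<delta> \<and> \<delta> + \<delta> powr r \<le> L2norm g / 2"
      then show "reg_error r \<delta> g u \<le> b' \<delta> * (1 + e \<delta>)"
        using order_trans[OF elim(1)[rule_format] le] by blast
    qed
    qed
  qed
qed

lemma Sobolev_ballD:
  fixes u :: "real^'n \<Rightarrow> complex"
  assumes u: "u \<in> Sobolev_ball p E" and p: "p > 0"
  shows "has_fourier_L2 u (fourier_L2 u)" "L2norm (fourier_L2 u) \<le> E"
    "weighted p (fourier_L2 u) \<in> L2"
    "L2norm (weighted p (fourier_L2 u)) \<le> E"
proof -
  show h: "has_fourier_L2 u (fourier_L2 u)"
    using u by (intro fourier_L2) (simp add: Sobolev_ball_def Sobolev_def)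
  note UL = has_fourier_L2D(2)[OF h]
  note [measurable] = L2_measurable[OF UL]
  let ?W = "\<lambda>\<xi>. complex_of_real ((1 + (norm \<xi>)\<^sup>2) powr (p / 2)) * fourier_L2 u \<xi>"
  have eq: "(norm (?W \<xi>))\<^sup>2 = (1 + (norm \<xi>)\<^sup>2) powr p * (norm (fourier_L2 u \<xi>))\<^sup>2" for \<xi>
    by (simp add: norm_mult power_mult_distrib power2_eq_square[of "_ powr _"] flip: powr_add)
  show W: "?W \<in> L2" unfolding L2_def mem_Collect_eq eq
    using u by (simp add: Sobolev_ball_def Sobolev_def)
  show WE: "L2norm ?W \<le> E"
    unfolding L2norm_def eq using u by (simp add: Sobolev_ball_def Sobolev_norm_def)
  have "AE \<xi> in lborel. norm (fourier_L2 u \<xi>) \<le> norm (?W \<xi>)"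
  proof (rule AE_I2)
    fix \<xi> :: "real^'n"
    have "1 \<le> (1 + (norm \<xi>)\<^sup>2) powr (p / 2)" using p by (intro ge_one_powr_ge_zero) auto
    then have "1 * norm (fourier_L2 u \<xi>) \<le> (1 + (norm \<xi>)\<^sup>2) powr (p / 2) * norm (fourier_L2 u \<xi>)"
      by (intro mult_right_mono) auto
    then show "norm (fourier_L2 u \<xi>) \<le> norm (?W \<xi>)" by (simp add: norm_mult)
  qed
  from L2_bound(2)[OF L2_measurable(1)[OF UL] W this] WE show "L2norm (fourier_L2 u) \<le> E" by linarith
qed

lemma error_at_cutoff:
  assumes r: "0 < r" "r < 1"
  shows "\<exists>M>0. \<exists>K>0. \<forall>p>0. \<forall>E>0. eventually_le r (Sobolev_ball p E) (\<lambda>u \<delta>. noise_part M K E r \<delta> + cutoff r \<delta> powr (- p) * sobolev_tail p (fourier_L2 u) (cutoff r \<delta>))"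
proof -
  obtain M K where MK: "M > 0" "K > 0" and est: "\<forall>p>0. \<forall>E>0. \<forall>u U g \<delta> R. has_fourier_L2 u U \<longrightarrow> L2norm U \<le> E \<longrightarrow>
    (weighted p U) \<in> L2 \<longrightarrow> g \<in> L2 \<longrightarrow> 0 < \<delta> \<longrightarrow>
    misfit g u \<le> \<delta> \<longrightarrow> \<delta> + \<delta> powr r \<le> L2norm g / 2 \<longrightarrow> 0 < R \<longrightarrow>
    reg_error r \<delta> g u
      \<le> M * (1 + (K * E / \<delta> powr r) powr (2 / (1 + r))) * \<delta>
        + (2 * \<delta> + \<delta> powr r) * exp (B * R powr (2 * \<tau>)) + R powr (- p) * sobolev_tail p U R"
    using error_estimate[OF r] by (elim exE conjE) (rule that)
  have "eventually_le r (Sobolev_ball p E) (\<lambda>u \<delta>. noise_part M K E r \<delta> + cutoff r \<delta> powr (- p) * sobolev_tail p (fourier_L2 u) (cutoff r \<delta>))"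
    if pE: "p > 0" "E > 0" for p E
  proof -
    have "eventually (\<lambda>\<delta>. cutoff r \<delta> > 0) (at_right 0)"
      using cutoff_at_top[OF r(1)] by (simp add: filterlim_at_top_dense)
    moreover have "eventually (\<lambda>\<delta>::real. \<delta> > 0) (at_right 0)" by (rule eventually_at_right_less)
    ultimately show ?thesis
    proof eventually_elim
      case (elim \<delta>)
      show ?case unfolding noise_part_def
      proof (intro ballI impI, elim conjE)
        fix u g :: "real^'n \<Rightarrow> complex" assume u: "u \<in> Sobolev_ball p E" and g: "g \<in> L2"
          and n: "misfit g u \<le> \<delta>" "\<delta> + \<delta> powr r \<le> L2norm g / 2"
        show "reg_error r \<delta> g u
          \<le> M * (1 + (K * E / \<delta> powr r) powr (2 / (1 + r))) * \<delta>
            + (2 * \<delta> + \<delta> powr r) * exp (B * cutoff r \<delta> powr (2 * \<tau>))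
            + cutoff r \<delta> powr (- p) * sobolev_tail p (fourier_L2 u) (cutoff r \<delta>)"
          by (rule est[rule_format, OF pE Sobolev_ballD(1-3)[OF u pE(1)] g elim(2) n elim(1)])
      qed
    qed
  qed
  with MK show ?thesis by blast
qed

text \<open>The noise is negligible against the rate, and the tail is at most E uniformly on the
  ball. The leading constant is thus the limit found in \<open>cutoff_rate\<close>; the division by
  C only rewrites E as (C E) / C.\<close>

lemma error_bound_ball:
  assumes r: "0 < r" "r < 1" and p: "p > 0" and C: "C > 0" and E: "E > 0"
  shows "error_bound \<tau> T \<gamma> \<phi> r (Sobolev_ball p E)
    (\<lambda>\<delta>. (4 * B / r) powr (p / (2 * \<tau>)) / C * (C * E) * lograte p (C * E) \<delta>)"
proof -
  let ?c = "(4 * B / r) powr (p / (2 * \<tau>))"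
  have c: "?c > 0" using r B_pos by simp
  have \<rho>: "C * E > 0" using C E by simp
  obtain M K where MK: "M > 0" "K > 0" and est: "eventually_le r (Sobolev_ball p E) (\<lambda>u \<delta>. noise_part M K E r \<delta> + cutoff r \<delta> powr (- p) * sobolev_tail p (fourier_L2 u) (cutoff r \<delta>))"
    using error_at_cutoff[OF r] p E by blast
  let ?n = "\<lambda>\<delta>. noise_part M K E r \<delta>" and ?f = "lograte p (C * E)"
  \<comment> \<open>Defined as the exact relative excess of the estimate over the leading term, so
    the required bound becomes an equality.\<close>
  define e where "e \<delta> = (?n \<delta> / ?f \<delta> + cutoff r \<delta> powr (- p) / ?f \<delta> * E) / (?c * E) - 1" for \<delta>
  have "((\<lambda>\<delta>. (?n \<delta> / ?f \<delta> + cutoff r \<delta> powr (- p) / ?f \<delta> * E) / (?c * E) - 1) \<longlongrightarrow> (0 + ?c * E) / (?c * E) - 1) (at_right 0)"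
    using c E by (intro tendsto_intros noise_part_rate cutoff_rate r \<rho> p MK E) auto
  then have e0: "(e \<longlongrightarrow> 0) (at_right 0)" using c E by (simp add: e_def[abs_def])
  show ?thesis
  proof (rule error_boundI[OF e0])
    show "eventually_le r (Sobolev_ball p E) (\<lambda>u \<delta>. ?c / C * (C * E) * ?f \<delta> * (1 + e \<delta>))"
      using est lograte_range[OF \<rho> p]
    proof eventually_elim
      case (elim \<delta>)
      have eq: "?c / C * (C * E) * ?f \<delta> * (1 + e \<delta>) = ?n \<delta> + cutoff r \<delta> powr (- p) * E"
        using c C E elim(2) by (simp add: e_def field_simps)
      have "sobolev_tail p (fourier_L2 u) (cutoff r \<delta>) \<le> E" if "u \<in> Sobolev_ball p E" for u
        using sobolev_tail_le[OF Sobolev_ballD(3)[OF that p]] Sobolev_ballD(4)[OF that p] by (rule order_trans)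
      then have t: "?n \<delta> + cutoff r \<delta> powr (- p) * sobolev_tail p (fourier_L2 u) (cutoff r \<delta>) \<le> ?n \<delta> + cutoff r \<delta> powr (- p) * E"
        if "u \<in> Sobolev_ball p E" for u using that by (intro add_left_mono mult_left_mono) auto
      show ?case unfolding eq
      proof (intro ballI impI)
        fix u g :: "real^'n \<Rightarrow> complex" assume u: "u \<in> Sobolev_ball p E" and g: "g \<in> L2"
          "misfit g u \<le> \<delta> \<and> \<delta> + \<delta> powr r \<le> L2norm g / 2"
        show "reg_error r \<delta> g u \<le> ?n \<delta> + cutoff r \<delta> powr (- p) * E"
          by (rule order_trans[OF elim(1)[rule_format, OF u g] t[OF u]])
      qed
    qed
  qed
qed

text \<open>For a fixed solution the tail of its Sobolev norm tends to zero, hence the error is of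
  smaller order than \<open>lograte\<close> and the constant \<open>A\<close> is arbitrary.\<close>

lemma error_bound_fixed:
  assumes r: "0 < r" "r < 1" and p: "p > 0" and \<rho>: "\<rho> > 0" and E: "E > 0" and u: "u \<in> Sobolev_ball p E" and A: "A > 0"
  shows "error_bound \<tau> T \<gamma> \<phi> r {u} (\<lambda>\<delta>. A * lograte p \<rho> \<delta>)"
proof -
  obtain M K where MK: "M > 0" "K > 0" and est: "eventually_le r (Sobolev_ball p E) (\<lambda>u \<delta>. noise_part M K E r \<delta> + cutoff r \<delta> powr (- p) * sobolev_tail p (fourier_L2 u) (cutoff r \<delta>))"
    using error_at_cutoff[OF r] p E by blast
  let ?n = "\<lambda>\<delta>. noise_part M K E r \<delta>" and ?f = "lograte p \<rho>"
  let ?t = "\<lambda>\<delta>. sobolev_tail p (fourier_L2 u) (cutoff r \<delta>)"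
  have t: "(?t \<longlongrightarrow> 0) (at_right 0)"
    by (rule filterlim_compose[OF sobolev_tail_tendsto[OF Sobolev_ballD(3)[OF u p]] cutoff_at_top[OF r(1)]])
  define e where "e \<delta> = (?n \<delta> / ?f \<delta> + cutoff r \<delta> powr (- p) / ?f \<delta> * ?t \<delta>) / A" for \<delta>
  have "((\<lambda>\<delta>. (?n \<delta> / ?f \<delta> + cutoff r \<delta> powr (- p) / ?f \<delta> * ?t \<delta>) / A) \<longlongrightarrow> (0 + (4 * B / r) powr (p / (2 * \<tau>)) * 0) / A) (at_right 0)"
    using A by (intro tendsto_intros noise_part_rate cutoff_rate r \<rho> p MK E t) auto
  then have e0: "(e \<longlongrightarrow> 0) (at_right 0)" by (simp add: e_def[abs_def])
  show ?thesis
  proof (rule error_boundI[OF e0])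
    show "eventually_le r {u} (\<lambda>u \<delta>. A * ?f \<delta> * (1 + e \<delta>))"
      using est lograte_range[OF \<rho> p]
    proof eventually_elim
      case (elim \<delta>)
      have "A * ?f \<delta> * (1 + e \<delta>) = A * ?f \<delta> + (?n \<delta> + cutoff r \<delta> powr (- p) * ?t \<delta>)"
        using A elim(2) by (simp add: e_def field_simps)
      moreover have "0 \<le> A * ?f \<delta>" using A elim(2) by simp
      ultimately have "?n \<delta> + cutoff r \<delta> powr (- p) * ?t \<delta> \<le> A * ?f \<delta> * (1 + e \<delta>)" by linarith
      note le = this
      show ?case
      proof (intro ballI impI)
        fix v g :: "real^'n \<Rightarrow> complex" assume v: "v \<in> {u}" and g: "g \<in> L2"
          "misfit g v \<le> \<delta> \<and> \<delta> + \<delta> powr r \<le> L2norm g / 2"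
        have "v = u" using v by simp
        with g show "reg_error r \<delta> g v \<le> A * ?f \<delta> * (1 + e \<delta>)"
          using order_trans[OF elim(1)[rule_format, OF u] le] by simp
      qed
    qed
  qed
qed

end

text \<open>One constant, \<open>K r\<close>, serves all three cases. The weaker forms for s > p / 2
  follow by comparing powers of \<rho> and of the rate; the bound on the ball compares the powers of
  \<rho> for C E at least 1.\<close>

theorem theorem4:
  fixes \<tau> T s p C :: real
    and \<gamma> :: "real \<Rightarrow> real"
    and \<phi> :: "real^'n \<Rightarrow> real"
  assumes "T > 0" and "0 < \<tau>" and "\<tau> \<le> 1"
    and "\<And>l. l \<in> {0<..<T} \<Longrightarrow> \<gamma> l > 0"
    and "set_integrable lborel {0<..<T} \<gamma>"
    and "s > 0" and "admissible_kernel s \<phi>"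
    and "p > 0" and "source_constant TYPE('n) \<tau> T \<gamma> p C"
  shows
    "(s \<le> p / 2 \<longrightarrow> (\<forall>r. 0 < r \<and> r < 1 \<longrightarrow>
       (\<exists>K3>0. \<forall>E>0. error_bound \<tau> T \<gamma> \<phi> r (Sobolev_ball p E)
         (\<lambda>\<delta>. K3 * (C * E) * f_log (p / (2 * \<tau>)) (\<delta>\<^sup>2 / (C * E)\<^sup>2))))) \<and>
     (s > p / 2 \<longrightarrow>
       (\<forall>r. 0 < r \<and> r < p / (2 * s) \<longrightarrow>
         (\<exists>K4>0. \<forall>E>0.
           (\<forall>u \<in> Sobolev_ball p E. error_bound \<tau> T \<gamma> \<phi> r {u}
             (\<lambda>\<delta>. K4 * (C * E) powr (2 * s / p) * f_log (p / (2 * \<tau>)) (\<delta>\<^sup>2 / (C * E)\<^sup>2))) \<and>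
           (C * E \<ge> 1 \<longrightarrow> error_bound \<tau> T \<gamma> \<phi> r (Sobolev_ball p E)
             (\<lambda>\<delta>. K4 * (C * E) powr (2 * s / p) * f_log (p / (2 * \<tau>)) (\<delta>\<^sup>2 / (C * E)\<^sup>2))))) \<and>
       (\<forall>r. r = p / (2 * s) \<longrightarrow>
         (\<exists>K5>0. \<forall>E>0.
           (\<forall>u \<in> Sobolev_ball p E. error_bound \<tau> T \<gamma> \<phi> r {u}
             (\<lambda>\<delta>. K5 * (C * E) powr (2 * s / p) *
                   f_log (p / (2 * \<tau>)) (\<delta>\<^sup>2 / (C * E)\<^sup>2) powr (min 1 (s / p)))) \<and>
           (C * E \<ge> 1 \<longrightarrow> error_bound \<tau> T \<gamma> \<phi> r (Sobolev_ball p E)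
             (\<lambda>\<delta>. K5 * (C * E) powr (2 * s / p) *
                   f_log (p / (2 * \<tau>)) (\<delta>\<^sup>2 / (C * E)\<^sup>2) powr (min 1 (s / p)))))))"
proof -
  interpret heat_mollification \<tau> T s \<gamma> \<phi>
    by unfold_locales (use assms in auto)
  have C: "C > 0" using assms(9) by (simp add: source_constant_def)
  note p = \<open>p > 0\<close>
  define K where "K r = (4 * B / r) powr (p / (2 * \<tau>)) / C" for r
  have K: "K r > 0" if "r > 0" for r using that B_pos C by (simp add: K_def)
  have ball: "error_bound \<tau> T \<gamma> \<phi> r (Sobolev_ball p E) (\<lambda>\<delta>. K r * (C * E) * lograte p (C * E) \<delta>)"
    if "0 < r" "r < 1" "E > 0" for r E
    using error_bound_ball[OF that(1,2) p C that(3)] by (simp only: K_def)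
  \<comment> \<open>The rate is eventually at most 1, so lowering its exponent from 1 to
    \<open>min 1 (s / p)\<close> can only enlarge it.\<close>
  have powr_weaken: "eventually (\<lambda>\<delta>. A * lograte p (C * E) \<delta> \<le> A * lograte p (C * E) \<delta> powr (min 1 (s / p))) (at_right 0)"
    if "E > 0" "A > 0" for E A
  proof -
    have "C * E > 0" using C that by simp
    from lograte_range[OF this p] show ?thesis
    proof eventually_elim
      case (elim \<delta>)
      then have "lograte p (C * E) \<delta> powr 1 \<le> lograte p (C * E) \<delta> powr (min 1 (s / p))"
        by (intro powr_mono') auto
      then show ?case using elim that(2) by simp
    qed
  qed
  \<comment> \<open>For s > p / 2 the exponent 2 s / p exceeds 1, so raising C E to it enlarges it
    once C E is at least 1.\<close>
  have large: "error_bound \<tau> T \<gamma> \<phi> r (Sobolev_ball p E) (\<lambda>\<delta>. K r * (C * E) powr (2 * s / p) * lograte p (C * E) \<delta>)"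
    if "0 < r" "r < 1" "E > 0" "C * E \<ge> 1" "s > p / 2" for r E
  proof (rule error_bound_mono[OF ball[OF that(1-3)]])
    have "(C * E) powr 1 \<le> (C * E) powr (2 * s / p)"
      using that p by (intro powr_mono) (auto simp: field_simps)
    then have le: "K r * (C * E) \<le> K r * (C * E) powr (2 * s / p)"
      using that K[of r] by (intro mult_left_mono) auto
    have "C * E > 0" using that(4) by linarith
    from lograte_range[OF this p]
    show "eventually (\<lambda>\<delta>. K r * (C * E) * lograte p (C * E) \<delta> \<le> K r * (C * E) powr (2 * s / p) * lograte p (C * E) \<delta>) (at_right 0)"
      by eventually_elim (use le in \<open>auto intro!: mult_right_mono\<close>)
  qed
  \<comment> \<open>The factor in front is just some positive number, which
    \<open>error_bound_fixed\<close> permits; no comparison of powers of C E enters.\<close>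
  have fixed: "error_bound \<tau> T \<gamma> \<phi> r {u} (\<lambda>\<delta>. K r * (C * E) powr (2 * s / p) * lograte p (C * E) \<delta>)"
    if "0 < r" "r < 1" "E > 0" "u \<in> Sobolev_ball p E" for r E u
    using that C K[of r] by (intro error_bound_fixed p) auto
  have Kp: "K r * (C * E) powr (2 * s / p) > 0" if "r > 0" "E > 0" for r E
    using that C K[of r] by simp
  have r1: "r < 1" if "s > p / 2" "r \<le> p / (2 * s)" for r
  proof -
    have "p / (2 * s) < 1" using that(1) p \<open>s > 0\<close> by (simp add: field_simps)
    then show ?thesis using that(2) by linarith
  qed
  have rp: "0 < p / (2 * s)" using p \<open>s > 0\<close> by simp
  show ?thesis
    unfolding lograte_def[symmetric]
  proof (intro conjI impI allI)
    fix r :: real assume "0 < r \<and> r < 1"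
    then show "\<exists>K3>0. \<forall>E>0. error_bound \<tau> T \<gamma> \<phi> r (Sobolev_ball p E) (\<lambda>\<delta>. K3 * (C * E) * lograte p (C * E) \<delta>)"
      using ball K by blast
  next
    fix r :: real assume s: "s > p / 2" and r: "0 < r \<and> r < p / (2 * s)"
    then show "\<exists>K4>0. \<forall>E>0.
       (\<forall>u \<in> Sobolev_ball p E. error_bound \<tau> T \<gamma> \<phi> r {u} (\<lambda>\<delta>. K4 * (C * E) powr (2 * s / p) * lograte p (C * E) \<delta>)) \<and>
       (C * E \<ge> 1 \<longrightarrow> error_bound \<tau> T \<gamma> \<phi> r (Sobolev_ball p E) (\<lambda>\<delta>. K4 * (C * E) powr (2 * s / p) * lograte p (C * E) \<delta>))"
      using large fixed K r1[of r] by (intro exI[of _ "K r"]) auto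
  next
    fix r :: real assume s: "s > p / 2" and r: "r = p / (2 * s)"
    then have r': "0 < r" "r < 1" using rp r1[of r] by auto
    show "\<exists>K5>0. \<forall>E>0.
       (\<forall>u \<in> Sobolev_ball p E. error_bound \<tau> T \<gamma> \<phi> r {u}
          (\<lambda>\<delta>. K5 * (C * E) powr (2 * s / p) * lograte p (C * E) \<delta> powr (min 1 (s / p)))) \<and>
       (C * E \<ge> 1 \<longrightarrow> error_bound \<tau> T \<gamma> \<phi> r (Sobolev_ball p E)
          (\<lambda>\<delta>. K5 * (C * E) powr (2 * s / p) * lograte p (C * E) \<delta> powr (min 1 (s / p))))"
      using error_bound_mono[OF large[OF r' _ _ s] powr_weaken[OF _ Kp[OF r'(1)]]]
        error_bound_mono[OF fixed[OF r'] powr_weaken[OF _ Kp[OF r'(1)]]] K[OF r'(1)]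
      by (intro exI[of _ "K r"]) auto
  qed
qed

end
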